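(* Let $d\ge1$, let $\gamma$ be the standard Gaussian measure on $\mathbb{R}^d$, and let $d\nu=h\,d\gamma$ be a centered probability measure on $\mathbb{R}^d$ with smooth density $h$ with respect to $\gamma$, admitting a Stein kernel $\tau_\nu$ with finite Stein discrepancy ${\rm S}={\rm S}(\nu\,|\,\gamma)$. Let $(P_t)_{t\ge0}$ be the Ornstein-Uhlenbeck semigroup and $d\nu^t=P_th\,d\gamma$, $t\ge0$ (so $\nu^0=\nu$). Then, for any $t\ge0$, $$ {\rm H}(\nu^t\,|\,\gamma)\,\le\,\frac{e^{-4t}}{e^{-2t}+\frac{1-e^{-2t}}{{\rm S}^2}\,{\rm H}(\nu^0\,|\,\gamma)}\;{\rm H}(\nu^0\,|\,\gamma)\,\le\,\frac{e^{-4t}}{1-e^{-2t}}\,{\rm S}^2(\nu^0\,|\,\gamma). $$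
   Context: Here $d\gamma(x)=(2\pi)^{-d/2}e^{-|x|^2/2}dx$. A probability measure $\nu$ is centered if $\int x_j\,d\nu=0$ for all $j$. A measurable matrix-valued map $\tau_\nu=(\tau_\nu^{ij})_{1\le i,j\le d}$ on $\mathbb{R}^d$ is a Stein kernel for $\nu$ if $\tau_\nu^{ij}\in L^1(\nu)$ for all $i,j$ and, for every smooth test function $\varphi:\mathbb{R}^d\to\mathbb{R}$ (the coordinate functions $x_i$ and the products $x_ix_j$ being admissible), $$\int_{\mathbb{R}^d} x\cdot\nabla\varphi\,d\nu=\int_{\mathbb{R}^d}\langle\tau_\nu,{\rm Hess}(\varphi)\rangle_{\rm HS}\,d\nu,$$ with $\langle\cdot,\cdot\rangle_{\rm HS}$, $\|\cdot\|_{\rm HS}$ the Hilbert-Schmidt scalar product and norm; without loss of generality $\tau_\nu$ is taken symmetric $\nu$-a.e. The Stein discrepancy is ${\rm S}(\nu|\gamma)=\big(\int\|\tau_\nu-{\rm Id}\|_{\rm HS}^2\,d\nu\big)^{1/2}$. If ${\rm S}=0$ then $\nu=\gamma$ and all terms are read as $0$; when $t=0$ and ${\rm S}>0$ the right-most term is read as $+\infty$. The relative entropy of $f\,d\gamma$ is ${\rm H}(f\gamma|\gamma)=\int f\log f\,d\gamma$. The Ornstein-Uhlenbeck semigroup is $P_tf(x)=\int_{\mathbb{R}^d}f(e^{-t}x+\sqrt{1-e^{-2t}}\,y)\,d\gamma(y)$. *)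

theory Defs
  imports "HOL-Probability.Probability"
begin

definition partial :: "'n \<Rightarrow> (real ^ 'n::finite \<Rightarrow> real) \<Rightarrow> real ^ 'n \<Rightarrow> real" where
  "partial i f x = frechet_derivative f (at x) (axis i 1)"

definition grad :: "(real ^ 'n::finite \<Rightarrow> real) \<Rightarrow> real ^ 'n \<Rightarrow> real ^ 'n" where
  "grad f x = (\<chi> i. partial i f x)"

definition hess :: "(real ^ 'n::finite \<Rightarrow> real) \<Rightarrow> real ^ 'n \<Rightarrow> real ^ 'n ^ 'n" where
  "hess f x = (\<chi> i j. partial i (partial j f) x)"

primrec Ck :: "nat \<Rightarrow> (real ^ 'n::finite \<Rightarrow> real) \<Rightarrow> bool" where
  "Ck 0 f \<longleftrightarrow> continuous_on UNIV f"
| "Ck (Suc k) f \<longleftrightarrow> f differentiable_on UNIV \<and> (\<forall>i. Ck k (partial i f))"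

definition smooth :: "(real ^ 'n::finite \<Rightarrow> real) \<Rightarrow> bool" where
  "smooth f \<longleftrightarrow> (\<forall>k. Ck k f)"

definition std_gaussian :: "(real ^ 'n::finite) measure" where
  "std_gaussian = density lborel
     (\<lambda>x. ennreal ((2 * pi) powr (- real CARD('n) / 2) * exp (- (norm x)\<^sup>2 / 2)))"

definition centered :: "(real ^ 'n::finite) measure \<Rightarrow> bool" where
  "centered \<nu> \<longleftrightarrow> (\<forall>j. integrable \<nu> (\<lambda>x. x $ j) \<and> (\<integral>x. x $ j \<partial>\<nu>) = 0)"

(* The test functions are the smooth functions with bounded second derivatives.  They contain
   the compactly supported smooth functions, the coordinates x_i and the products x_i x_j, and
   the Hessian term is integrable for each of them because tau is.  Larger classes of test
   functions would only make the notion more restrictive.  On real ^ 'n ^ 'n, the inner product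
   and norm of the library are the Hilbert-Schmidt ones. *)
definition stein_kernel ::
  "(real ^ 'n::finite) measure \<Rightarrow> (real ^ 'n \<Rightarrow> real ^ 'n ^ 'n) \<Rightarrow> bool" where
  "stein_kernel \<nu> \<tau> \<longleftrightarrow>
     \<tau> \<in> borel_measurable borel \<and>
     (\<forall>i j. integrable \<nu> (\<lambda>x. \<tau> x $ i $ j)) \<and>
     (\<forall>\<phi>. smooth \<phi> \<and> bounded (range (hess \<phi>)) \<longrightarrow>
        integrable \<nu> (\<lambda>x. x \<bullet> grad \<phi> x) \<and>
        (\<integral>x. x \<bullet> grad \<phi> x \<partial>\<nu>) = (\<integral>x. \<tau> x \<bullet> hess \<phi> x \<partial>\<nu>))"

definition finite_stein_discrepancy ::
  "(real ^ 'n::finite) measure \<Rightarrow> (real ^ 'n \<Rightarrow> real ^ 'n ^ 'n) \<Rightarrow> bool" where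
  "finite_stein_discrepancy \<nu> \<tau> \<longleftrightarrow> integrable \<nu> (\<lambda>x. (norm (\<tau> x - mat 1))\<^sup>2)"

definition stein_discrepancy ::
  "(real ^ 'n::finite) measure \<Rightarrow> (real ^ 'n \<Rightarrow> real ^ 'n ^ 'n) \<Rightarrow> real" where
  "stein_discrepancy \<nu> \<tau> = sqrt (\<integral>x. (norm (\<tau> x - mat 1))\<^sup>2 \<partial>\<nu>)"

(* The relative entropy of the measure with density f >= 0 with respect to the standard Gaussian,
   with values in (-infinity, +infinity]: since u ln u >= - 1/e, the subtracted integral is
   finite. *)
definition gaussian_entropy :: "(real ^ 'n::finite \<Rightarrow> real) \<Rightarrow> ereal" where
  "gaussian_entropy f =
     enn2ereal (\<integral>\<^sup>+x. ennreal (f x * ln (f x)) \<partial>std_gaussian)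
     - enn2ereal (\<integral>\<^sup>+x. ennreal (- (f x * ln (f x))) \<partial>std_gaussian)"

definition ou_semigroup ::
  "real \<Rightarrow> (real ^ 'n::finite \<Rightarrow> real) \<Rightarrow> real ^ 'n \<Rightarrow> real" where
  "ou_semigroup t f x =
     (\<integral>y. f (exp (- t) *\<^sub>R x + sqrt (1 - exp (- 2 * t)) *\<^sub>R y) \<partial>std_gaussian)"

definition stein_decay :: "real \<Rightarrow> real \<Rightarrow> ereal" where
  "stein_decay t S =
     (if S = 0 then 0
      else if t = 0 then \<infinity>
      else ereal (exp (- 4 * t) / (1 - exp (- 2 * t)) * S\<^sup>2))"

(* For H = infinity the quotient is read as its limit for H tending to infinity, which is
   stein_decay t S: infinity for t = 0, and exp (- 4 t) S^2 / (1 - exp (- 2 t)) for t > 0. *)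
definition entropy_decay :: "real \<Rightarrow> real \<Rightarrow> ereal \<Rightarrow> ereal" where
  "entropy_decay t S H =
     (if S = 0 then 0
      else if H = \<infinity> then stein_decay t S
      else ereal (exp (- 4 * t)) /
             (ereal (exp (- 2 * t)) + ereal ((1 - exp (- 2 * t)) / S\<^sup>2) * H) * H)"

end

theory Submission
  imports Defs
begin

text \<open>Put \<open>y = e\<^bsup>-2t\<^esup>\<close> and let \<open>H(y)\<close> be the entropy of \<open>P\<^sub>t h\<close>. Two facts give the bound.

  First, by duality \<open>H(y) \<le> S\<^sup>2 (- y - ln (1 - y)) / 2\<close>: along the flow \<open>\<phi>\<^sub>r = ln (P\<^sub>r k)\<close> the integral
  \<open>\<integral> P\<^bsub>t+r\<^esub> \<phi>\<^sub>r d\<nu>\<close> tends to \<open>ln (\<integral> k d\<gamma>)\<close>, and the Stein identity with test function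
  \<open>P\<^bsub>t+r\<^esub> \<phi>\<^sub>r\<close> bounds its derivative below by \<open>- S\<^sup>2 e\<^bsup>-4(t+r)\<^esup> / (1 - e\<^bsup>-2(t+r)\<^esup>)\<close>. Regularity is only ever
  required of the test functions.

  Second, \<open>H\<close> is convex on \<open>(0, 1]\<close>, by superadditivity of the entropy with respect to product Gaussians
  and rotation invariance. The chord through the optimal \<open>w < y\<close>, where \<open>H(w)\<close> is bounded by the first fact,
  and \<open>1\<close> yields the claim.\<close>

section \<open>Rotation invariance of the Gaussian measure\<close>

text \<open>A proof through the Fisher information along the semigroup would need derivatives of
  \<open>h\<close> controlled at infinity, which smoothness alone does not give. In the dual form,
  the supremum over positive \<open>k\<close> of the integral of \<open>ln k\<close> under the
  evolved measure minus the logarithm of the Gaussian integral of \<open>k\<close>, every derivative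
  falls on \<open>k\<close> or on a Gaussian kernel, and the Hessian that meets the Stein kernel is
  bounded. The dual bound also proves the entropy finite for t > 0, so that infinite initial entropy
  is covered by it. Convexity in y stands in for the exponential decay of the Fisher information I:
  formally dH/dy = exp (2 t) I / 2, and the decay says that exp (2 t) I is nonincreasing in t. It is
  obtained without derivatives, from midpoint convexity and monotonicity.\<close>

lemma nn_integral_lborel_affine:
  fixes u :: "'a::euclidean_space"
  assumes [measurable]: "f \<in> borel_measurable borel" and "c \<noteq> 0"
  shows "(\<integral>\<^sup>+x. f x \<partial>lborel) = ennreal (\<bar>c\<bar> ^ DIM('a)) * (\<integral>\<^sup>+x. f (u + c *\<^sub>R x) \<partial>lborel)"
proof -
  have "(\<integral>\<^sup>+x. f x \<partial>lborel) =
      (\<integral>\<^sup>+x. f x \<partial>density (distr lborel borel (\<lambda>x. u + c *\<^sub>R x)) (\<lambda>_. \<bar>c\<bar>^DIM('a)))"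
    using lborel_affine[OF \<open>c \<noteq> 0\<close>, of u] by simp
  also have "\<dots> = ennreal (\<bar>c\<bar> ^ DIM('a)) * (\<integral>\<^sup>+x. f (u + c *\<^sub>R x) \<partial>lborel)"
    by (subst nn_integral_density) (auto simp: nn_integral_distr nn_integral_cmult)
  finally show ?thesis .
qed

section \<open>The standard Gaussian density as a product over coordinates\<close>

lemma norm_sq_Basis: "(norm (x::'a::euclidean_space))\<^sup>2 = (\<Sum>b\<in>Basis. (x \<bullet> b)\<^sup>2)"
  unfolding power2_norm_eq_inner by (subst euclidean_inner) (simp add: power2_eq_square)

definition gauss_dens :: "real ^ 'n::finite \<Rightarrow> real" where
  "gauss_dens x = (2 * pi) powr (- real CARD('n) / 2) * exp (- (norm x)\<^sup>2 / 2)"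

lemma std_gaussian_eq: "std_gaussian = density lborel (\<lambda>x. ennreal (gauss_dens x))"
  by (simp add: std_gaussian_def gauss_dens_def)

lemma gauss_dens_pos: "gauss_dens x > 0"
  by (simp add: gauss_dens_def)

lemma gauss_dens_nonneg: "gauss_dens x \<ge> 0"
  using gauss_dens_pos[of x] by linarith

lemma gauss_dens_measurable [measurable]: "gauss_dens \<in> borel_measurable borel"
  by (simp add: gauss_dens_def[abs_def])

lemma gauss_dens_prod: "gauss_dens x = (\<Prod>b\<in>Basis. std_normal_density (x \<bullet> b))"
proof -
  have "(\<Prod>b\<in>Basis. std_normal_density (x \<bullet> b))
      = (1 / sqrt (2 * pi)) ^ CARD('a) * exp (\<Sum>b\<in>Basis. - (x \<bullet> b)\<^sup>2 / 2)"
    unfolding normal_density_def prod.distrib by (simp add: exp_sum)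
  also have "(1 / sqrt (2 * pi)) ^ CARD('a) = (2 * pi) powr (- real CARD('a) / 2)"
  proof -
    have "(1 / sqrt (2 * pi)) = (2 * pi) powr (- 1 / 2)"
      by (simp add: powr_minus_divide powr_half_sqrt)
    hence "(1 / sqrt (2 * pi)) ^ CARD('a) = ((2 * pi) powr (- 1 / 2)) powr real CARD('a)"
      by (simp add: powr_realpow)
    thus ?thesis by (simp add: powr_powr)
  qed
  also have "(\<Sum>b\<in>Basis. - (x \<bullet> b)\<^sup>2 / 2) = - (norm x)\<^sup>2 / 2"
    by (simp add: norm_sq_Basis sum_negf sum_divide_distrib)
  finally show ?thesis by (simp add: gauss_dens_def)
qed

lemma nn_integral_gauss_dens: "(\<integral>\<^sup>+x. ennreal (gauss_dens (x::real^'n::finite)) \<partial>lborel) = 1"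
proof -
  have "(\<integral>\<^sup>+x. ennreal (gauss_dens (x::real^'n)) \<partial>lborel)
      = (\<integral>\<^sup>+x. (\<Prod>b\<in>Basis. ennreal (std_normal_density ((x::real^'n) \<bullet> b))) \<partial>lborel)"
    by (simp add: gauss_dens_prod prod_ennreal)
  also have "\<dots> = (\<Prod>b\<in>(Basis::(real^'n) set). (\<integral>\<^sup>+x. ennreal (std_normal_density x) \<partial>lborel))"
    by (subst nn_integral_lborel_prod) auto
  also have "\<dots> = 1"
    by (simp add: nn_integral_eq_integral)
  finally show ?thesis .
qed

lemma sets_std_gaussian [measurable_cong, simp]: "sets std_gaussian = sets borel"
  by (simp add: std_gaussian_def)

lemma space_std_gaussian [simp]: "space std_gaussian = UNIV"
  by (simp add: std_gaussian_def)

lemma prob_space_std_gaussian: "prob_space std_gaussian"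
  by (rule prob_spaceI) (simp add: std_gaussian_eq emeasure_density nn_integral_gauss_dens)

interpretation gauss: prob_space std_gaussian
  by (rule prob_space_std_gaussian)

lemma gauss_prob_UNIV [simp]: "gauss.prob UNIV = 1"
  using gauss.prob_space by simp

interpretation gauss2: pair_prob_space std_gaussian std_gaussian ..

lemma nn_integral_std_gaussian:
  assumes [measurable]: "f \<in> borel_measurable borel"
  shows "(\<integral>\<^sup>+x. f x \<partial>std_gaussian) = (\<integral>\<^sup>+x. ennreal (gauss_dens x) * f x \<partial>lborel)"
  by (simp add: std_gaussian_eq nn_integral_density)

lemma integral_std_gaussian:
  fixes f :: "real ^ 'n::finite \<Rightarrow> real"
  assumes [measurable]: "f \<in> borel_measurable borel"
  shows "(\<integral>x. f x \<partial>std_gaussian) = (\<integral>x. gauss_dens x * f x \<partial>lborel)"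
  by (simp add: std_gaussian_eq integral_density gauss_dens_nonneg)

lemma integrable_std_gaussian:
  fixes f :: "real ^ 'n::finite \<Rightarrow> real"
  assumes [measurable]: "f \<in> borel_measurable borel"
  shows "integrable std_gaussian f \<longleftrightarrow> integrable lborel (\<lambda>x. gauss_dens x * f x)"
  by (simp add: std_gaussian_eq integrable_density gauss_dens_nonneg)

lemma sets_gauss_pair: "sets (std_gaussian \<Otimes>\<^sub>M std_gaussian) = sets (borel \<Otimes>\<^sub>M borel)"
  by (rule sets_pair_measure_cong) auto

text \<open>The map is a linear isometry of pairs, so it preserves the product density; it is also
  its own inverse. Its effect on Lebesgue measure is computed one variable at a time:
  \<open>y\<close> is replaced by the first new coordinate, the order of integration is exchanged,
  then \<open>x\<close> is replaced by the second one, and the two Jacobians cancel.\<close>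

lemma nn_integral_gauss_rotate:
  fixes F :: "(real^'n::finite) \<times> (real^'n) \<Rightarrow> ennreal"
  assumes [measurable]: "F \<in> borel_measurable (borel \<Otimes>\<^sub>M borel)" and ab: "a\<^sup>2 + b\<^sup>2 = 1"
  shows "(\<integral>\<^sup>+x. \<integral>\<^sup>+y. F (a *\<^sub>R x + b *\<^sub>R y, b *\<^sub>R x - a *\<^sub>R y) \<partial>std_gaussian \<partial>std_gaussian)
       = (\<integral>\<^sup>+x. \<integral>\<^sup>+y. F (x, y) \<partial>std_gaussian \<partial>std_gaussian)"
proof -
  let ?r = "\<lambda>x::real^'n. ennreal (gauss_dens x)"
  let ?G = "\<lambda>x y. ?r x * ?r y * F (x, y)"
  have R: "(\<integral>\<^sup>+x. \<integral>\<^sup>+y. F' (x, y) \<partial>std_gaussian \<partial>std_gaussian)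
      = (\<integral>\<^sup>+x. \<integral>\<^sup>+y. ?r x * ?r y * F' (x, y) \<partial>lborel \<partial>lborel)"
    if [measurable]: "F' \<in> borel_measurable (borel \<Otimes>\<^sub>M borel)" for F' :: "(real^'n) \<times> (real^'n) \<Rightarrow> ennreal"
    by (subst nn_integral_std_gaussian, simp)
       (simp add: nn_integral_std_gaussian nn_integral_cmult[symmetric] mult.assoc)
  have rr: "?r x * ?r y = ?r (a *\<^sub>R x + b *\<^sub>R y) * ?r (b *\<^sub>R x - a *\<^sub>R y)" for x y
  proof -
    have "(norm (a *\<^sub>R x + b *\<^sub>R y))\<^sup>2 + (norm (b *\<^sub>R x - a *\<^sub>R y))\<^sup>2
        = (a\<^sup>2 + b\<^sup>2) * ((norm x)\<^sup>2 + (norm y)\<^sup>2)"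
      by (simp only: power2_norm_eq_inner inner_add_left inner_add_right inner_diff_left
          inner_diff_right inner_scaleR_left inner_scaleR_right inner_commute[of y x])
        (simp add: algebra_simps power2_eq_square)
    hence "exp (- (norm x)\<^sup>2 / 2) * exp (- (norm y)\<^sup>2 / 2) =
       exp (- (norm (a *\<^sub>R x + b *\<^sub>R y))\<^sup>2 / 2) * exp (- (norm (b *\<^sub>R x - a *\<^sub>R y))\<^sup>2 / 2)"
      using ab by (simp add: exp_add[symmetric] field_simps)
    hence "gauss_dens x * gauss_dens y
      = gauss_dens (a *\<^sub>R x + b *\<^sub>R y) * gauss_dens (b *\<^sub>R x - a *\<^sub>R y)"
      by (simp add: gauss_dens_def)
    thus ?thesis by (simp add: ennreal_mult[symmetric] gauss_dens_nonneg)
  qed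
  have "(\<integral>\<^sup>+x. \<integral>\<^sup>+y. F (a *\<^sub>R x + b *\<^sub>R y, b *\<^sub>R x - a *\<^sub>R y) \<partial>std_gaussian \<partial>std_gaussian)
     = (\<integral>\<^sup>+x. \<integral>\<^sup>+y. ?G (a *\<^sub>R x + b *\<^sub>R y) (b *\<^sub>R x - a *\<^sub>R y) \<partial>lborel \<partial>lborel)"
    by (subst R[of "\<lambda>(x,y). F (a *\<^sub>R x + b *\<^sub>R y, b *\<^sub>R x - a *\<^sub>R y)", simplified]) (simp_all add: rr[symmetric])
  also have "\<dots> = (\<integral>\<^sup>+x. \<integral>\<^sup>+y. ?G x y \<partial>lborel \<partial>lborel)"
  proof (cases "b = 0")
    \<comment> \<open>When \<open>b = 0\<close> the first coordinate does not involve
      \<open>y\<close>, and the substitution used below would divide by zero; the map is then a sign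
      change in each variable.\<close>
    case True
    hence a: "a \<noteq> 0" "\<bar>a\<bar> = 1" using ab by (auto simp: power2_eq_1_iff)
    have "(\<integral>\<^sup>+x. \<integral>\<^sup>+y. ?G x y \<partial>lborel \<partial>lborel)
        = (\<integral>\<^sup>+x. \<integral>\<^sup>+y. ?G x ((- a) *\<^sub>R y) \<partial>lborel \<partial>lborel)"
      using nn_integral_lborel_affine[of "\<lambda>y. ?G x y" "- a" 0 for x] a by simp
    also have "\<dots> = (\<integral>\<^sup>+x. \<integral>\<^sup>+y. ?G (a *\<^sub>R x) ((- a) *\<^sub>R y) \<partial>lborel \<partial>lborel)"
      using nn_integral_lborel_affine[of "\<lambda>x. \<integral>\<^sup>+y. ?G x ((- a) *\<^sub>R y) \<partial>lborel" a 0] a by simp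
    finally show ?thesis using True by simp
  next
    case b: False
    let ?c = "ennreal (\<bar>1 / b\<bar> ^ DIM(real^'n))" and ?d = "ennreal (\<bar>b\<bar> ^ DIM(real^'n))"
    have cd: "?d * ?c = 1" using b by (simp add: ennreal_mult[symmetric] power_mult_distrib[symmetric] del: DIM_cart)
    \<comment> \<open>The second coordinate after \<open>y = (u - a x) / b\<close>: the coefficient
      of \<open>x\<close> is \<open>b + a * a / b\<close>, which equals \<open>1 / b\<close> by
      \<open>ab\<close>.\<close>
    have 1: "b *\<^sub>R x - a *\<^sub>R ((- (a/b)) *\<^sub>R x + (1/b) *\<^sub>R u) = (1/b) *\<^sub>R x - (a/b) *\<^sub>R u" for x u :: "real^'n"
    proof -
      have "b *\<^sub>R x - a *\<^sub>R ((- (a/b)) *\<^sub>R x + (1/b) *\<^sub>R u) = (b + a * a / b) *\<^sub>R x - (a/b) *\<^sub>R u"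
        by (simp add: algebra_simps)
      also have "b + a * a / b = 1 / b" using b ab by (simp add: field_simps power2_eq_square)
      finally show ?thesis .
    qed
    have 2: "a *\<^sub>R x + b *\<^sub>R ((- (a/b)) *\<^sub>R x + (1/b) *\<^sub>R u) = u" for x u :: "real^'n"
      using b by (simp add: algebra_simps)
    have "(\<integral>\<^sup>+x. \<integral>\<^sup>+y. ?G (a *\<^sub>R x + b *\<^sub>R y) (b *\<^sub>R x - a *\<^sub>R y) \<partial>lborel \<partial>lborel)
        = (\<integral>\<^sup>+x. ?c * (\<integral>\<^sup>+u. ?G u ((1/b) *\<^sub>R x - (a/b) *\<^sub>R u) \<partial>lborel) \<partial>lborel)"
      using nn_integral_lborel_affine[of "\<lambda>y. ?G (a *\<^sub>R x + b *\<^sub>R y) (b *\<^sub>R x - a *\<^sub>R y)" "1/b" "(-(a/b)) *\<^sub>R x" for x] b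
      by (simp only: 1 2) simp
    also have "\<dots> = ?c * (\<integral>\<^sup>+x. \<integral>\<^sup>+u. ?G u ((1/b) *\<^sub>R x - (a/b) *\<^sub>R u) \<partial>lborel \<partial>lborel)"
      by (subst nn_integral_cmult) auto
    also have "\<dots> = ?c * (\<integral>\<^sup>+u. \<integral>\<^sup>+x. ?G u ((1/b) *\<^sub>R x - (a/b) *\<^sub>R u) \<partial>lborel \<partial>lborel)"
      by (subst lborel_pair.Fubini') auto
    also have "\<dots> = ?c * (\<integral>\<^sup>+u. ?d * (\<integral>\<^sup>+v. ?G u v \<partial>lborel) \<partial>lborel)"
      using nn_integral_lborel_affine[of "\<lambda>x. ?G u ((1/b) *\<^sub>R x - (a/b) *\<^sub>R u)" b "a *\<^sub>R u" for u] b
      by (simp add: scaleR_add_right)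
    also have "\<dots> = (?d * ?c) * (\<integral>\<^sup>+u. \<integral>\<^sup>+v. ?G u v \<partial>lborel \<partial>lborel)"
      by (subst nn_integral_cmult) (auto simp: mult_ac)
    finally show ?thesis by (simp only: cd) simp
  qed
  also have "\<dots> = (\<integral>\<^sup>+x. \<integral>\<^sup>+y. F (x, y) \<partial>std_gaussian \<partial>std_gaussian)"
    by (rule R[symmetric]) simp
  finally show ?thesis .
qed

lemma distr_gauss_rotate:
  assumes ab: "a\<^sup>2 + b\<^sup>2 = 1"
  shows "distr (std_gaussian \<Otimes>\<^sub>M std_gaussian) (std_gaussian \<Otimes>\<^sub>M std_gaussian)
           (\<lambda>(x, y). (a *\<^sub>R x + b *\<^sub>R y, b *\<^sub>R x - a *\<^sub>R y))
       = (std_gaussian \<Otimes>\<^sub>M std_gaussian :: ((real^'n::finite) \<times> (real^'n)) measure)" (is "?L = ?R")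
proof (rule measure_eqI)
  fix A assume "A \<in> sets ?L"
  hence [measurable]: "A \<in> sets (std_gaussian \<Otimes>\<^sub>M std_gaussian)" by simp
  hence A [measurable]: "A \<in> sets (borel \<Otimes>\<^sub>M borel)" by (simp add: sets_gauss_pair)
  have "emeasure ?L A = (\<integral>\<^sup>+p. indicator A p \<partial>?L)" by simp
  also have "\<dots> = (\<integral>\<^sup>+p. indicator A (case p of (x, y) \<Rightarrow> (a *\<^sub>R x + b *\<^sub>R y, b *\<^sub>R x - a *\<^sub>R y)) \<partial>?R)"
    by (subst nn_integral_distr) auto
  also have "\<dots> = (\<integral>\<^sup>+x. \<integral>\<^sup>+y. indicator A (a *\<^sub>R x + b *\<^sub>R y, b *\<^sub>R x - a *\<^sub>R y) \<partial>std_gaussian \<partial>std_gaussian)"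
    by (subst gauss.nn_integral_fst[symmetric]) auto
  also have "\<dots> = (\<integral>\<^sup>+x. \<integral>\<^sup>+y. indicator A (x, y) \<partial>std_gaussian \<partial>std_gaussian)"
    by (rule nn_integral_gauss_rotate) (use ab in auto)
  also have "\<dots> = (\<integral>\<^sup>+p. indicator A p \<partial>?R)"
    by (subst gauss.nn_integral_fst[symmetric]) auto
  also have "\<dots> = emeasure ?R A" by simp
  finally show "emeasure ?L A = emeasure ?R A" .
qed simp

text \<open>The sum is the first coordinate of the rotated pair, whose law is again the
  product.\<close>

lemma distr_gauss_add:
  assumes ab: "a\<^sup>2 + b\<^sup>2 = 1"
  shows "distr (std_gaussian \<Otimes>\<^sub>M std_gaussian) borel (\<lambda>(x, y). a *\<^sub>R x + b *\<^sub>R y)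
       = (std_gaussian :: (real^'n::finite) measure)"
proof -
  let ?P = "std_gaussian \<Otimes>\<^sub>M std_gaussian :: ((real^'n::finite) \<times> (real^'n)) measure"
  have "distr ?P borel (\<lambda>(x, y). a *\<^sub>R x + b *\<^sub>R y)
      = distr (distr ?P ?P (\<lambda>(x, y). (a *\<^sub>R x + b *\<^sub>R y, b *\<^sub>R x - a *\<^sub>R y))) borel fst"
    by (subst distr_distr) (auto intro!: arg_cong[where f="distr _ _"] simp: o_def)
  also have "\<dots> = distr ?P borel fst" by (simp add: distr_gauss_rotate[OF ab])
  also have "\<dots> = distr ?P std_gaussian fst" by (rule distr_cong) auto
  also have "\<dots> = std_gaussian"
    by (subst gauss.distr_pair_fst) (auto simp: gauss.emeasure_space_1)
  finally show ?thesis .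
qed

section \<open>Smoothing by Mehler averages\<close>

text \<open>The mean value inequality bounds the remainder quotients by \<open>2 * w\<close>, so
  dominated convergence along sequences gives the derivative.\<close>

lemma has_derivative_integral_param:
  fixes f :: "'a::euclidean_space \<Rightarrow> 'b \<Rightarrow> real"
  assumes e: "e > 0"
    and der: "\<And>x z. x \<in> ball x0 e \<Longrightarrow> z \<in> space M \<Longrightarrow> ((\<lambda>x. f x z) has_derivative (\<lambda>v. f' x z \<bullet> v)) (at x)"
    and int: "\<And>x. x \<in> ball x0 e \<Longrightarrow> integrable M (f x)"
    and meas: "f' x0 \<in> borel_measurable M"
    and bd: "\<And>x z. x \<in> ball x0 e \<Longrightarrow> z \<in> space M \<Longrightarrow> norm (f' x z) \<le> w z"
    and w: "integrable M w"
  shows "((\<lambda>x. \<integral>z. f x z \<partial>M) has_derivative (\<lambda>v. (\<integral>z. f' x0 z \<partial>M) \<bullet> v)) (at x0)"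
proof -
  have x0: "x0 \<in> ball x0 e" using e by simp
  have int': "integrable M (f' x0)"
    by (rule Bochner_Integration.integrable_bound[OF w meas]) (use bd x0 in \<open>auto intro!: AE_I2 order_trans[OF bd[OF x0]]\<close>)
  let ?Q = "\<lambda>x z. (f x z - f x0 z - f' x0 z \<bullet> (x - x0)) / norm (x - x0)"
  have lip: "\<bar>f x z - f x0 z\<bar> \<le> w z * norm (x - x0)" if x: "x \<in> ball x0 e" and z: "z \<in> space M" for x z
  proof -
    have "norm (f x z - f x0 z) \<le> w z * norm (x - x0)"
    proof (rule differentiable_bound[OF convex_ball[of x0 e], where f'="\<lambda>y v. f' y z \<bullet> v"])
      show "((\<lambda>x. f x z) has_derivative (\<lambda>v. f' y z \<bullet> v)) (at y within ball x0 e)" if "y \<in> ball x0 e" for y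
        using der[OF that z] by (rule has_derivative_at_withinI)
      show "onorm (\<lambda>v. f' y z \<bullet> v) \<le> w z" if "y \<in> ball x0 e" for y
      proof (rule onorm_le)
        fix v
        have "\<bar>f' y z \<bullet> v\<bar> \<le> norm (f' y z) * norm v" by (rule Cauchy_Schwarz_ineq2)
        also have "\<dots> \<le> w z * norm v" by (intro mult_right_mono bd that z norm_ge_zero)
        finally show "norm (f' y z \<bullet> v) \<le> w z * norm v" by simp
      qed
    qed (use x x0 in auto)
    thus ?thesis by simp
  qed
  have "((\<lambda>x. \<integral>z. ?Q x z \<partial>M) \<longlongrightarrow> 0) (at x0 within ball x0 e)"
    unfolding tendsto_at_iff_sequentially
  proof (intro allI impI)
    fix X assume X: "\<forall>i. X i \<in> ball x0 e - {x0}" "X \<longlonglongrightarrow> x0"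
    have "(\<lambda>i. \<integral>z. ?Q (X i) z \<partial>M) \<longlonglongrightarrow> (\<integral>z. 0 \<partial>M)"
    proof (rule integral_dominated_convergence[where w="\<lambda>z. 2 * w z"])
      show "?Q (X i) \<in> borel_measurable M" for i
      proof -
        have [measurable]: "f (X i) \<in> borel_measurable M" "f x0 \<in> borel_measurable M" "f' x0 \<in> borel_measurable M"
          using int[of "X i"] int[OF x0] X meas by auto
        show ?thesis by measurable
      qed
      show "integrable M (\<lambda>z. 2 * w z)" using w by simp
      show "AE z in M. norm (?Q (X i) z) \<le> 2 * w z" for i
      proof (rule AE_I2)
        fix z assume z: "z \<in> space M"
        have Xi: "X i \<in> ball x0 e" "X i \<noteq> x0" using X by auto
        have "\<bar>f' x0 z \<bullet> (X i - x0)\<bar> \<le> w z * norm (X i - x0)"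
          by (rule order_trans[OF Cauchy_Schwarz_ineq2]) (intro mult_right_mono bd x0 z norm_ge_zero)
        hence "\<bar>f (X i) z - f x0 z - f' x0 z \<bullet> (X i - x0)\<bar> \<le> 2 * w z * norm (X i - x0)"
          using lip[OF Xi(1) z] by linarith
        thus "norm (?Q (X i) z) \<le> 2 * w z" using Xi by (simp add: field_simps)
      qed
      show "AE z in M. (\<lambda>i. ?Q (X i) z) \<longlonglongrightarrow> 0"
      proof (rule AE_I2)
        fix z assume z: "z \<in> space M"
        have "((\<lambda>y. (f y z - f x0 z - f' x0 z \<bullet> (y - x0)) /\<^sub>R norm (y - x0)) \<longlongrightarrow> 0) (at x0 within ball x0 e)"
          using has_derivative_at_withinI[OF der[OF x0 z], of "ball x0 e"] unfolding has_derivative_at_within by blast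
        from this[unfolded tendsto_at_iff_sequentially, rule_format, of X] X
        show "(\<lambda>i. ?Q (X i) z) \<longlonglongrightarrow> 0" by (simp add: o_def divide_inverse mult.commute)
      qed
    qed auto
    thus "((\<lambda>x. \<integral>z. ?Q x z \<partial>M) \<circ> X) \<longlonglongrightarrow> 0" by (simp add: o_def)
  qed
  moreover have "(\<integral>z. ?Q x z \<partial>M) =
      ((\<integral>z. f x z \<partial>M) - (\<integral>z. f x0 z \<partial>M) - (\<integral>z. f' x0 z \<partial>M) \<bullet> (x - x0)) /\<^sub>R norm (x - x0)"
    if "x \<in> ball x0 e" for x
    using int[OF that] int[OF x0] int' by (simp add: divide_inverse mult.commute)
  ultimately have "((\<lambda>x. ((\<integral>z. f x z \<partial>M) - (\<integral>z. f x0 z \<partial>M) - (\<integral>z. f' x0 z \<partial>M) \<bullet> (x - x0)) /\<^sub>R norm (x - x0))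
      \<longlongrightarrow> 0) (at x0 within ball x0 e)"
    by (elim Lim_transform_eventually) (auto simp: eventually_at_filter)
  hence "((\<lambda>x. \<integral>z. f x z \<partial>M) has_derivative (\<lambda>v. (\<integral>z. f' x0 z \<partial>M) \<bullet> v)) (at x0 within ball x0 e)"
    unfolding has_derivative_at_within by (simp add: bounded_linear_inner_right)
  thus ?thesis using e by (simp add: at_within_open[OF x0])
qed

section \<open>Gaussian integrability of polynomials times functions of linear growth\<close>

lemma integrable_exp_norm_sq:
  assumes "c > 0"
  shows "integrable lborel (\<lambda>x::'a::euclidean_space. exp (- c * (norm x)\<^sup>2))"
proof (rule integrableI_nonneg)
  \<comment> \<open>The standard deviation of the normal law with density proportional to exp (- c
    x^2).\<close>
  define s where "s = 1 / sqrt (2 * c)"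
  have s: "s > 0" "2 * s\<^sup>2 = 1 / c" using assms by (auto simp: s_def power_divide)
  have "exp (- c * x\<^sup>2) = sqrt (2 * pi * s\<^sup>2) * normal_density 0 s x" for x :: real
    using s assms by (simp add: normal_density_def)
  hence "integrable lborel (\<lambda>x::real. exp (- c * x\<^sup>2))"
    using integrable_normal_density[OF s(1), of 0] by simp
  hence fin: "(\<integral>\<^sup>+x. ennreal (exp (- c * x\<^sup>2)) \<partial>lborel) < \<infinity>"
    by (simp add: integrable_iff_bounded)
  have "(\<integral>\<^sup>+x. ennreal (exp (- c * (norm (x::'a))\<^sup>2)) \<partial>lborel)
      = (\<integral>\<^sup>+x. (\<Prod>b\<in>Basis. ennreal (exp (- c * ((x::'a) \<bullet> b)\<^sup>2))) \<partial>lborel)"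
    by (simp add: norm_sq_Basis sum_distrib_left sum_negf[symmetric] exp_sum prod_ennreal)
  also have "\<dots> = (\<Prod>b\<in>(Basis::'a set). (\<integral>\<^sup>+x. ennreal (exp (- c * x\<^sup>2)) \<partial>lborel))"
    by (subst nn_integral_lborel_prod) auto
  also have "\<dots> < \<infinity>" using fin by (simp add: power_less_top_ennreal)
  finally show "(\<integral>\<^sup>+x. ennreal (exp (- c * (norm (x::'a))\<^sup>2)) \<partial>lborel) < \<infinity>" .
qed auto

lemma integrable_lborel_shift:
  fixes f :: "'a::euclidean_space \<Rightarrow> 'b::{banach, second_countable_topology}"
  assumes [measurable]: "f \<in> borel_measurable borel"
  shows "integrable lborel (\<lambda>x. f (c + x)) \<longleftrightarrow> integrable lborel f"
  using integrable_distr_eq[of "(+) c" lborel borel f] by (simp add: lborel_distr_plus)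

lemma integral_lborel_shift:
  fixes f :: "'a::euclidean_space \<Rightarrow> 'b::{banach, second_countable_topology}"
  assumes [measurable]: "f \<in> borel_measurable borel"
  shows "(\<integral>x. f (c + x) \<partial>lborel) = (\<integral>x. f x \<partial>lborel)"
  using integral_distr[of "(+) c" lborel borel f] by (simp add: lborel_distr_plus)

lemma real_polynomial_function_continuous:
  "real_polynomial_function q \<Longrightarrow> continuous_on UNIV (q :: 'a::euclidean_space \<Rightarrow> real)"
  by (simp add: continuous_on_polymonial_function real_polynomial_function_eq)

lemma real_polynomial_function_measurable:
  "real_polynomial_function q \<Longrightarrow> (q :: 'a::euclidean_space \<Rightarrow> real) \<in> borel_measurable borel"
  by (simp add: borel_measurable_continuous_onI real_polynomial_function_continuous)

text \<open>Differentiating a Gaussian kernel times a polynomial \<open>q\<close> produces the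
  polynomial \<open>q y * y $ i - dq y $ i\<close>. A gradient with polynomial components keeps this
  recursion inside the class.\<close>

lemma real_polynomial_function_gradient:
  fixes q :: "real ^ 'n::finite \<Rightarrow> real"
  assumes "real_polynomial_function q"
  obtains dq :: "real ^ 'n \<Rightarrow> real ^ 'n"
  where "\<And>i. real_polynomial_function (\<lambda>y. dq y $ i)" "\<And>y. (q has_derivative (\<lambda>v. dq y \<bullet> v)) (at y)"
proof -
  have "\<exists>dq :: real ^ 'n \<Rightarrow> real ^ 'n. (\<forall>i. real_polynomial_function (\<lambda>y. dq y $ i)) \<and>
        (\<forall>y. (q has_derivative (\<lambda>v. dq y \<bullet> v)) (at y))"
    using assms
  proof (induction q rule: real_polynomial_function.induct)
    case (linear f)
    interpret bounded_linear f by fact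
    have "f v = (\<chi> i. f (axis i 1)) \<bullet> v" for v
    proof -
      have "f v = f (\<Sum>i\<in>UNIV. v $ i *\<^sub>R axis i 1)"
        using basis_expansion[of v] by (simp add: scalar_mult_eq_scaleR)
      also have "\<dots> = (\<Sum>i\<in>UNIV. v $ i * f (axis i 1))" by (simp add: sum scaleR)
      finally show ?thesis by (simp add: inner_vec_def mult.commute)
    qed
    hence f: "(\<lambda>v. (\<chi> i. f (axis i 1)) \<bullet> v) = f" by (intro ext) (rule sym)
    have "(f has_derivative (\<lambda>v. (\<chi> i. f (axis i 1)) \<bullet> v)) (at y)" for y
      unfolding f by (rule bounded_linear_imp_has_derivative[OF bounded_linear_axioms])
    thus ?case by (intro exI[of _ "\<lambda>_. \<chi> i. f (axis i 1)"]) auto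
  next
    case (const c)
    show ?case by (intro exI[of _ "\<lambda>_. 0"]) auto
  next
    case (add f g)
    then obtain df dg where
      d: "\<forall>i. real_polynomial_function (\<lambda>y. df y $ i)" "\<forall>y. (f has_derivative (\<lambda>v. df y \<bullet> v)) (at y)"
         "\<forall>i. real_polynomial_function (\<lambda>y. dg y $ i)" "\<forall>y. (g has_derivative (\<lambda>v. dg y \<bullet> v)) (at y)"
      by blast
    have "((\<lambda>x. f x + g x) has_derivative (\<lambda>v. (df y + dg y) \<bullet> v)) (at y)" for y
      using has_derivative_add[OF d(2)[rule_format] d(4)[rule_format], of y] by (simp add: inner_add_left)
    with d show ?case by (intro exI[of _ "\<lambda>y. df y + dg y"]) auto
  next
    case (mult f g)
    then obtain df dg where
      d: "\<forall>i. real_polynomial_function (\<lambda>y. df y $ i)" "\<forall>y. (f has_derivative (\<lambda>v. df y \<bullet> v)) (at y)"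
         "\<forall>i. real_polynomial_function (\<lambda>y. dg y $ i)" "\<forall>y. (g has_derivative (\<lambda>v. dg y \<bullet> v)) (at y)"
      by blast
    have "((\<lambda>x. f x * g x) has_derivative (\<lambda>v. (f y *\<^sub>R dg y + g y *\<^sub>R df y) \<bullet> v)) (at y)" for y
      using has_derivative_mult[OF d(2)[rule_format] d(4)[rule_format], of y]
      by (simp add: inner_add_left mult.commute)
    moreover have "real_polynomial_function (\<lambda>y. (f y *\<^sub>R dg y + g y *\<^sub>R df y) $ i)" for i
      using d(1,3) mult.hyps
      by (auto simp only: vector_add_component vector_scaleR_component real_scaleR_def
          intro!: real_polynomial_function.intros(3,4))
    ultimately show ?case by (intro exI[of _ "\<lambda>y. f y *\<^sub>R dg y + g y *\<^sub>R df y"]) auto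
  qed
  thus ?thesis using that by blast
qed

text \<open>A bound of exponential type is stable under products, where the rates \<open>m\<close>
  add, so the induction over the generators closes; a Gaussian absorbs it easily.\<close>

lemma real_polynomial_function_growth:
  fixes q :: "'a::real_normed_vector \<Rightarrow> real"
  assumes "real_polynomial_function q"
  obtains C m where "C \<ge> 0" "\<And>y. \<bar>q y\<bar> \<le> C * exp (real m * norm y)"
proof -
  have "\<exists>C m. C \<ge> 0 \<and> (\<forall>y. \<bar>q y\<bar> \<le> C * exp (real m * norm y))"
    using assms
  proof (induction q rule: real_polynomial_function.induct)
    case (linear f)
    then obtain K where K: "K > 0" "\<And>y. norm (f y) \<le> norm y * K"
      using bounded_linear.pos_bounded by blast
    have "\<bar>f y\<bar> \<le> K * exp (real 1 * norm y)" for y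
    proof -
      have "norm y \<le> exp (norm y)" using exp_ge_add_one_self[of "norm y"] by linarith
      hence "norm y * K \<le> K * exp (norm y)" using K(1) by simp
      thus ?thesis using K(2)[of y] by simp
    qed
    thus ?case using K(1) less_imp_le by blast
  next
    case (const c)
    have "\<bar>c\<bar> \<le> \<bar>c\<bar> * exp (real 0 * norm y)" for y :: 'a by simp
    thus ?case using abs_ge_zero by blast
  next
    case (add f g)
    then obtain C m D n where C: "C \<ge> 0" "\<And>y. \<bar>f y\<bar> \<le> C * exp (real m * norm y)"
      and D: "D \<ge> 0" "\<And>y. \<bar>g y\<bar> \<le> D * exp (real n * norm y)" by metis
    have "\<bar>f y + g y\<bar> \<le> (C + D) * exp (real (m + n) * norm y)" for y
    proof -
      have "C * exp (real m * norm y) \<le> C * exp (real (m + n) * norm y)"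
        "D * exp (real n * norm y) \<le> D * exp (real (m + n) * norm y)"
        using C(1) D(1) by (auto intro!: mult_left_mono mult_right_mono)
      thus ?thesis using C(2)[of y] D(2)[of y] by (simp add: distrib_right del: of_nat_add)
    qed
    thus ?case using C(1) D(1) by (intro exI[of _ "C + D"] exI[of _ "m + n"]) auto
  next
    case (mult f g)
    then obtain C m D n where C: "C \<ge> 0" "\<And>y. \<bar>f y\<bar> \<le> C * exp (real m * norm y)"
      and D: "D \<ge> 0" "\<And>y. \<bar>g y\<bar> \<le> D * exp (real n * norm y)" by metis
    have "\<bar>f y * g y\<bar> \<le> (C * D) * exp (real (m + n) * norm y)" for y
    proof -
      have "\<bar>f y\<bar> * \<bar>g y\<bar> \<le> (C * exp (real m * norm y)) * (D * exp (real n * norm y))"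
        using C(1) by (intro mult_mono C D) auto
      also have "\<dots> = (C * D) * exp (real (m + n) * norm y)"
        by (simp add: distrib_right exp_add)
      finally show ?thesis by (simp add: abs_mult)
    qed
    thus ?case using C(1) D(1) by (intro exI[of _ "C * D"] exI[of _ "m + n"]) auto
  qed
  thus ?thesis using that by blast
qed

lemma poly_gauss_dens_bound:
  fixes q :: "real ^ 'n::finite \<Rightarrow> real"
  assumes "real_polynomial_function q"
  obtains C where "C \<ge> 0" "\<And>y. \<bar>q y\<bar> * gauss_dens y \<le> C * exp (- (norm y)\<^sup>2 / 4)"
proof -
  obtain C m where C: "C \<ge> 0" "\<And>y. \<bar>q y\<bar> \<le> C * exp (real m * norm y)"
    using real_polynomial_function_growth[OF assms] by blast
  let ?k = "(2 * pi) powr (- real CARD('n) / 2)"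
  have "\<bar>q y\<bar> * gauss_dens y \<le> (?k * C * exp ((real m)\<^sup>2)) * exp (- (norm y)\<^sup>2 / 4)" for y
  proof -
    \<comment> \<open>Half of the Gaussian exponent is spent on the growth of \<open>q\<close>: the
      square of \<open>m - norm y / 2\<close> is nonnegative.\<close>
    have "real m * norm y - (norm y)\<^sup>2 / 2 \<le> (real m)\<^sup>2 - (norm y)\<^sup>2 / 4"
      using zero_le_power2[of "real m - norm y / 2"] by (simp add: power2_eq_square algebra_simps)
    hence "exp (real m * norm y) * exp (- (norm y)\<^sup>2 / 2) \<le> exp ((real m)\<^sup>2) * exp (- (norm y)\<^sup>2 / 4)"
      by (simp add: exp_add[symmetric])
    hence "?k * C * (exp (real m * norm y) * exp (- (norm y)\<^sup>2 / 2)) \<le> ?k * C * (exp ((real m)\<^sup>2) * exp (- (norm y)\<^sup>2 / 4))"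
      using C(1) by (intro mult_left_mono) auto
    moreover have "\<bar>q y\<bar> * gauss_dens y \<le> (C * exp (real m * norm y)) * gauss_dens y"
      by (intro mult_right_mono C gauss_dens_nonneg)
    moreover have "(C * exp (real m * norm y)) * gauss_dens y
        = ?k * C * (exp (real m * norm y) * exp (- (norm y)\<^sup>2 / 2))"
      by (simp add: gauss_dens_def)
    ultimately show ?thesis by (simp only: mult.assoc)
  qed
  thus ?thesis using that[of "?k * C * exp ((real m)\<^sup>2)"] C(1) by auto
qed

text \<open>The rate 1/8 is what remains of 1/4 when the centre of the Gaussian is moved, as in the
  majorant of \<open>mehler_poly_has_derivative\<close>; half of it absorbs the linear
  factor.\<close>

lemma integrable_linear_growth_exp:
  "integrable lborel (\<lambda>w::'a::euclidean_space. (1 + norm w) * exp (- (norm w)\<^sup>2 / 8))"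
proof (rule Bochner_Integration.integrable_bound)
  show "integrable lborel (\<lambda>w::'a. 5 * exp (- (1/16) * (norm w)\<^sup>2))"
    using integrable_exp_norm_sq[of "1/16"] by simp
  have "(1 + s) * exp (- s\<^sup>2 / 8) \<le> 5 * exp (- (1/16) * s\<^sup>2)" if "s \<ge> 0" for s :: real
  proof -
    have "1 + s \<le> 5 * (1 + s\<^sup>2 / 16)"
      using zero_le_power2[of "s - 8/5"] by (simp add: power2_eq_square algebra_simps)
    also have "\<dots> \<le> 5 * exp (s\<^sup>2 / 16)" by (intro mult_left_mono exp_ge_add_one_self) auto
    finally have "(1 + s) * exp (- s\<^sup>2 / 8) \<le> 5 * exp (s\<^sup>2 / 16) * exp (- s\<^sup>2 / 8)"
      by (rule mult_right_mono) simp
    also have "\<dots> = 5 * exp (- (1/16) * s\<^sup>2)"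
      by (simp add: exp_add[symmetric] mult.assoc)
    finally show ?thesis .
  qed
  thus "AE w in lborel. norm ((1 + norm (w::'a)) * exp (- (norm w)\<^sup>2 / 8)) \<le> norm (5 * exp (- (1/16) * (norm w)\<^sup>2))"
    by (auto simp: abs_mult)
qed auto

lemma integrable_vecI:
  fixes f :: "'b \<Rightarrow> real ^ 'n::finite"
  assumes "\<And>i. integrable M (\<lambda>x. f x $ i)"
  shows "integrable M f"
proof -
  have "f = (\<lambda>x. \<Sum>i\<in>UNIV. (f x $ i) *\<^sub>R axis i 1)"
    using basis_expansion[of "f _"] by (simp add: scalar_mult_eq_scaleR)
  moreover have "integrable M (\<lambda>x. \<Sum>i\<in>UNIV. (f x $ i) *\<^sub>R (axis i 1 :: real ^ 'n))"
    using assms by (intro Bochner_Integration.integrable_sum integrable_scaleR_left) auto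
  ultimately show ?thesis by simp
qed

lemma integral_vec_nth:
  fixes f :: "'b \<Rightarrow> real ^ 'n::finite"
  assumes "integrable M f"
  shows "(\<integral>x. f x \<partial>M) $ i = (\<integral>x. f x $ i \<partial>M)"
  by (rule integral_bounded_linear[symmetric, OF bounded_linear_vec_nth assms])

text \<open>With \<open>a = exp (- t)\<close> and \<open>b = sqrt (1 - exp (- 2 * t))\<close> this
  is the Ornstein-Uhlenbeck average. The two coefficients are left independent because integration
  by parts uses \<open>a = 1\<close> with any nonzero \<open>b\<close>, and because the entropy is
  studied with \<open>a = sqrt y\<close> and \<open>b = sqrt (1 - y)\<close>.\<close>

definition mehler :: "real \<Rightarrow> real \<Rightarrow> (real ^ 'n::finite \<Rightarrow> real) \<Rightarrow> real ^ 'n \<Rightarrow> real" where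
  "mehler a b f x = (\<integral>y. f (a *\<^sub>R x + b *\<^sub>R y) \<partial>std_gaussian)"

lemma borel_measurable_vec_nth' [measurable]: "(\<lambda>x. x $ i) \<in> borel_measurable (borel :: (real ^ 'n::finite) measure)"
  by (intro borel_measurable_continuous_onI continuous_intros)

lemma real_polynomial_function_nth: "real_polynomial_function (\<lambda>y::real^'n::finite. y $ i)"
  by (rule real_polynomial_function.intros(1)) (rule bounded_linear_vec_nth)

text \<open>The class contains the bounded functions and the Lipschitz ones, and their Gaussian
  averages converge absolutely at every point.\<close>

locale linear_growth =
  fixes u :: "real ^ 'n::finite \<Rightarrow> real" and C :: real
  assumes meas [measurable]: "u \<in> borel_measurable borel"
    and growth: "\<bar>u x\<bar> \<le> C * (1 + norm x)"
begin

lemma C_nonneg: "C \<ge> 0"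
  using growth[of 0] by simp

lemma growth_affine: "\<bar>u (x0 + b *\<^sub>R y)\<bar> \<le> C * (1 + norm x0) * (1 + \<bar>b\<bar>) * (1 + norm y)"
proof -
  have "1 + norm (x0 + b *\<^sub>R y) \<le> 1 + (norm x0 + \<bar>b\<bar> * norm y)"
    using norm_triangle_ineq[of x0 "b *\<^sub>R y"] by simp
  also have "\<dots> \<le> (1 + norm x0) * ((1 + \<bar>b\<bar>) * (1 + norm y))"
    by (simp add: algebra_simps)
  finally have "C * (1 + norm (x0 + b *\<^sub>R y)) \<le> C * ((1 + norm x0) * ((1 + \<bar>b\<bar>) * (1 + norm y)))"
    by (intro mult_left_mono C_nonneg)
  thus ?thesis using growth[of "x0 + b *\<^sub>R y"] by (simp add: mult.assoc)
qed

lemma integrable_gauss_poly: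
  assumes q: "real_polynomial_function q"
  shows "integrable std_gaussian (\<lambda>y. u (x0 + b *\<^sub>R y) * q y)"
proof -
  have [measurable]: "q \<in> borel_measurable borel" by (rule real_polynomial_function_measurable[OF q])
  obtain D where D: "D \<ge> 0" "\<And>y. \<bar>q y\<bar> * gauss_dens y \<le> D * exp (- (norm y)\<^sup>2 / 4)"
    using poly_gauss_dens_bound[OF q] by blast
  let ?K = "C * (1 + norm x0) * (1 + \<bar>b\<bar>)"
  have "integrable lborel (\<lambda>y. gauss_dens y * (u (x0 + b *\<^sub>R y) * q y))"
  proof (rule Bochner_Integration.integrable_bound)
    show "integrable lborel (\<lambda>y::real^'n. ?K * D * ((1 + norm y) * exp (- (norm y)\<^sup>2 / 8)))"
      by (intro integrable_mult_right integrable_linear_growth_exp)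
    have "\<bar>gauss_dens y * (u (x0 + b *\<^sub>R y) * q y)\<bar> \<le> ?K * D * ((1 + norm y) * exp (- (norm y)\<^sup>2 / 8))" for y
    proof -
      have "\<bar>u (x0 + b *\<^sub>R y)\<bar> * (\<bar>q y\<bar> * gauss_dens y) \<le> (?K * (1 + norm y)) * (D * exp (- (norm y)\<^sup>2 / 4))"
        using D(1) by (intro mult_mono D(2) growth_affine) (auto simp: C_nonneg gauss_dens_nonneg)
      also have "\<dots> \<le> (?K * (1 + norm y)) * (D * exp (- (norm y)\<^sup>2 / 8))"
        using D by (intro mult_left_mono) (auto simp: C_nonneg)
      finally show ?thesis by (simp add: abs_mult gauss_dens_nonneg mult_ac)
    qed
    thus "AE y in lborel. norm (gauss_dens y * (u (x0 + b *\<^sub>R y) * q y))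
        \<le> norm (?K * D * ((1 + norm y) * exp (- (norm y)\<^sup>2 / 8)))"
      by (auto intro!: AE_I2 order_trans[OF _ abs_ge_self])
  qed simp
  thus ?thesis by (subst integrable_std_gaussian) auto
qed

lemma integrable_gauss: "integrable std_gaussian (\<lambda>y. u (x0 + b *\<^sub>R y))"
  using integrable_gauss_poly[OF real_polynomial_function.intros(2)[of 1]] by simp

text \<open>In the variable \<open>w = y + (a / b) x\<close> the point \<open>a x + b y\<close> is
  \<open>b w\<close>, so \<open>x\<close> occurs only in the kernel and \<open>u\<close> is never
  differentiated. The derivative of kernel times \<open>q\<close> has the same form, with the
  Hermite-type polynomial \<open>q y * y $ i - dq y $ i\<close> and the factor
  \<open>a / b\<close>.\<close>

lemma mehler_poly_has_derivative:
  assumes q: "real_polynomial_function q" and b: "b \<noteq> 0"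
    and dq: "\<And>i. real_polynomial_function (\<lambda>y. dq y $ i)" "\<And>y. (q has_derivative (\<lambda>v. dq y \<bullet> v)) (at y)"
  shows "((\<lambda>x. \<integral>y. u (a *\<^sub>R x + b *\<^sub>R y) * q y \<partial>std_gaussian) has_derivative
      (\<lambda>v. (\<chi> i. \<integral>y. u (a *\<^sub>R x0 + b *\<^sub>R y) * (a / b * (q y * y $ i - dq y $ i)) \<partial>std_gaussian) \<bullet> v)) (at x0)"
proof -
  define k where "k = a / b"
  have ka: "b * k = a" using b by (simp add: k_def)
  have [measurable]: "q \<in> borel_measurable borel" by (rule real_polynomial_function_measurable[OF q])
  have [measurable]: "(\<lambda>y. dq y $ i) \<in> borel_measurable borel" for i
    by (rule real_polynomial_function_measurable[OF dq(1)])
  define p where "p i y = q y * y $ i - dq y $ i" for i y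
  have p: "real_polynomial_function (p i)" for i
    unfolding p_def[abs_def]
    by (intro real_polynomial_function_diff real_polynomial_function.intros(4) q dq(1) real_polynomial_function_nth)
  have pm [measurable]: "p i \<in> borel_measurable borel" for i by (rule real_polynomial_function_measurable[OF p])
  define f where "f x w = u (b *\<^sub>R w) * (q (w - k *\<^sub>R x) * gauss_dens (w - k *\<^sub>R x))" for x w :: "real^'n"
  define f' where "f' x w = (u (b *\<^sub>R w) * k * gauss_dens (w - k *\<^sub>R x)) *\<^sub>R (\<chi> i. p i (w - k *\<^sub>R x))"
    for x w :: "real^'n"
  have shift: "(\<integral>y. u (a *\<^sub>R x + b *\<^sub>R y) * r y \<partial>std_gaussian)
      = (\<integral>w. u (b *\<^sub>R w) * (r (w - k *\<^sub>R x) * gauss_dens (w - k *\<^sub>R x)) \<partial>lborel)"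
    and shift_int: "integrable lborel (\<lambda>w. u (b *\<^sub>R w) * (r (w - k *\<^sub>R x) * gauss_dens (w - k *\<^sub>R x)))"
    if r: "real_polynomial_function r" for r x
  proof -
    have [measurable]: "r \<in> borel_measurable borel" by (rule real_polynomial_function_measurable[OF r])
    let ?g = "\<lambda>y. gauss_dens y * (u (a *\<^sub>R x + b *\<^sub>R y) * r y)"
    have g: "?g (- k *\<^sub>R x + w) = u (b *\<^sub>R w) * (r (w - k *\<^sub>R x) * gauss_dens (w - k *\<^sub>R x))" for w
      by (simp add: scaleR_add_right scaleR_diff_right ka algebra_simps)
    show "(\<integral>y. u (a *\<^sub>R x + b *\<^sub>R y) * r y \<partial>std_gaussian)
      = (\<integral>w. u (b *\<^sub>R w) * (r (w - k *\<^sub>R x) * gauss_dens (w - k *\<^sub>R x)) \<partial>lborel)"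
      unfolding g[symmetric] by (subst integral_lborel_shift) (auto simp: integral_std_gaussian)
    show "integrable lborel (\<lambda>w. u (b *\<^sub>R w) * (r (w - k *\<^sub>R x) * gauss_dens (w - k *\<^sub>R x)))"
      unfolding g[symmetric] using integrable_gauss_poly[OF r, of "a *\<^sub>R x" b]
      by (subst integrable_lborel_shift) (auto simp: integrable_std_gaussian)
  qed
  have dens_der: "(gauss_dens has_derivative (\<lambda>v. - gauss_dens y * (y \<bullet> v))) (at y)" for y :: "real^'n"
    unfolding gauss_dens_def[abs_def] power2_norm_eq_inner
    by (auto intro!: derivative_eq_intros simp: inner_commute)
  have der: "((\<lambda>x. f x w) has_derivative (\<lambda>v. f' x w \<bullet> v)) (at x)" for x w
  proof -
    let ?v = "w - k *\<^sub>R x"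
    have sub: "((\<lambda>x. w - k *\<^sub>R x) has_derivative (\<lambda>v. - k *\<^sub>R v)) (at x)"
      by (auto intro!: derivative_eq_intros)
    have "((\<lambda>x. f x w) has_derivative (\<lambda>v. u (b *\<^sub>R w) *
        (q ?v * (- gauss_dens ?v * (?v \<bullet> (- k *\<^sub>R v))) + (dq ?v \<bullet> (- k *\<^sub>R v)) * gauss_dens ?v))) (at x)"
      unfolding f_def
      by (intro has_derivative_mult_right has_derivative_mult
          has_derivative_compose[OF sub dq(2)] has_derivative_compose[OF sub dens_der])
    moreover have "u (b *\<^sub>R w) *
        (q ?v * (- gauss_dens ?v * (?v \<bullet> (- k *\<^sub>R v))) + (dq ?v \<bullet> (- k *\<^sub>R v)) * gauss_dens ?v) = f' x w \<bullet> v" for v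
    proof -
      have "(\<chi> i. p i ?v) = q ?v *\<^sub>R ?v - dq ?v" by (simp add: vec_eq_iff p_def)
      hence "f' x w \<bullet> v = (u (b *\<^sub>R w) * k * gauss_dens ?v) * (q ?v * (?v \<bullet> v) - dq ?v \<bullet> v)"
        by (simp add: f'_def inner_diff_left del: vector_minus_component)
      also have "\<dots> = u (b *\<^sub>R w) *
        (q ?v * (- gauss_dens ?v * (?v \<bullet> (- k *\<^sub>R v))) + (dq ?v \<bullet> (- k *\<^sub>R v)) * gauss_dens ?v)"
        by (simp only: inner_scaleR_right) (simp add: algebra_simps del: inner_diff_left)
      finally show ?thesis by simp
    qed
    ultimately show ?thesis by simp
  qed
  have "\<exists>D. \<forall>i. D i \<ge> 0 \<and> (\<forall>y. \<bar>p i y\<bar> * gauss_dens y \<le> D i * exp (- (norm y)\<^sup>2 / 4))"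
    by (intro choice) (meson p poly_gauss_dens_bound)
  then obtain D where D: "\<And>i. D i \<ge> 0" "\<And>i y. \<bar>p i y\<bar> * gauss_dens y \<le> D i * exp (- (norm y)\<^sup>2 / 4)"
    by blast
  define DD where "DD = sum D UNIV"
  have DD: "DD \<ge> 0" unfolding DD_def by (intro sum_nonneg D)
  define K where "K = C * (1 + norm (a *\<^sub>R x0)) * (1 + \<bar>b\<bar>)"
  have K: "K \<ge> 0" by (simp add: K_def C_nonneg)
  \<comment> \<open>Majorant on the unit ball about \<open>x0\<close>: moving the centre of the
    Gaussian from \<open>x\<close> to \<open>x0\<close> halves the exponent and costs the factor
    \<open>exp (k\<^sup>2 / 4)\<close>.\<close>
  define W where "W w = \<bar>k\<bar> * K * DD * exp (k\<^sup>2 / 4) * ((1 + norm (w - k *\<^sub>R x0)) * exp (- (norm (w - k *\<^sub>R x0))\<^sup>2 / 8))"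
    for w :: "real^'n"
  have bd: "norm (f' x w) \<le> W w" if x: "x \<in> ball x0 1" for x w
  proof -
    let ?v = "w - k *\<^sub>R x" and ?z = "w - k *\<^sub>R x0"
    have v: "norm ?z \<le> norm ?v + \<bar>k\<bar>"
    proof -
      have "?z = ?v + k *\<^sub>R (x - x0)" by (simp add: scaleR_diff_right)
      hence "norm ?z \<le> norm ?v + \<bar>k\<bar> * norm (x - x0)"
        using norm_triangle_ineq[of ?v "k *\<^sub>R (x - x0)"] by (simp only: norm_scaleR)
      moreover have "\<bar>k\<bar> * norm (x - x0) \<le> \<bar>k\<bar> * 1"
        using x by (intro mult_left_mono) (auto simp: dist_norm norm_minus_commute)
      ultimately show ?thesis by simp
    qed
    hence "(norm ?z)\<^sup>2 \<le> (norm ?v + \<bar>k\<bar>)\<^sup>2" by (intro power_mono) auto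
    also have "\<dots> \<le> 2 * (norm ?v)\<^sup>2 + 2 * k\<^sup>2"
      using zero_le_power2[of "norm ?v - \<bar>k\<bar>"] by (simp add: power2_sum power2_diff)
    finally have "exp (- (norm ?v)\<^sup>2 / 4) \<le> exp (k\<^sup>2 / 4 + - (norm ?z)\<^sup>2 / 8)"
      by simp
    hence ex: "exp (- (norm ?v)\<^sup>2 / 4) \<le> exp (k\<^sup>2 / 4) * exp (- (norm ?z)\<^sup>2 / 8)"
      by (simp only: exp_add)
    have "norm (\<chi> i. p i ?v) * gauss_dens ?v \<le> (\<Sum>i\<in>UNIV. \<bar>p i ?v\<bar>) * gauss_dens ?v"
      using norm_le_l1_cart[of "\<chi> i. p i ?v"] by (intro mult_right_mono) (auto simp: gauss_dens_nonneg)
    also have "\<dots> \<le> DD * exp (- (norm ?v)\<^sup>2 / 4)"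
      unfolding DD_def sum_distrib_right by (intro sum_mono D)
    also have "\<dots> \<le> DD * (exp (k\<^sup>2 / 4) * exp (- (norm ?z)\<^sup>2 / 8))"
      by (intro mult_left_mono ex DD)
    finally have 1: "norm (\<chi> i. p i ?v) * gauss_dens ?v \<le> DD * (exp (k\<^sup>2 / 4) * exp (- (norm ?z)\<^sup>2 / 8))" .
    have "b *\<^sub>R w = a *\<^sub>R x0 + b *\<^sub>R ?z" by (simp add: scaleR_diff_right ka)
    hence 2: "\<bar>u (b *\<^sub>R w)\<bar> \<le> K * (1 + norm ?z)"
      using growth_affine[of "a *\<^sub>R x0" b ?z] by (simp add: K_def)
    have "norm (f' x w) = \<bar>k\<bar> * (\<bar>u (b *\<^sub>R w)\<bar> * (norm (\<chi> i. p i ?v) * gauss_dens ?v))"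
      by (simp add: f'_def abs_mult gauss_dens_nonneg)
    also have "\<dots> \<le> \<bar>k\<bar> * ((K * (1 + norm ?z)) * (DD * (exp (k\<^sup>2 / 4) * exp (- (norm ?z)\<^sup>2 / 8))))"
      using K by (intro mult_left_mono mult_mono 1 2) (auto simp: gauss_dens_nonneg)
    also have "\<dots> = W w" by (simp add: W_def)
    finally show ?thesis .
  qed
  have W: "integrable lborel W"
  proof -
    have "integrable lborel (\<lambda>w. (1 + norm (- k *\<^sub>R x0 + w)) * exp (- (norm (- k *\<^sub>R x0 + w))\<^sup>2 / 8))"
      using integrable_linear_growth_exp by (subst integrable_lborel_shift) auto
    thus ?thesis unfolding W_def by (intro integrable_mult_right) simp
  qed
  have f'nth: "f' x0 w $ i = u (b *\<^sub>R w) * ((k * p i (w - k *\<^sub>R x0)) * gauss_dens (w - k *\<^sub>R x0))" for w i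
    by (simp add: f'_def)
  have kp: "real_polynomial_function (\<lambda>y. k * p i y)" for i using p by auto
  have f'int: "integrable lborel (f' x0)"
    unfolding integrable_vecI f'nth by (rule integrable_vecI) (simp only: f'nth shift_int[OF kp])
  have "((\<lambda>x. \<integral>w. f x w \<partial>lborel) has_derivative (\<lambda>v. (\<integral>w. f' x0 w \<partial>lborel) \<bullet> v)) (at x0)"
  proof (rule has_derivative_integral_param[where e=1 and w=W])
    show "integrable lborel (f x)" for x using shift_int[OF q] by (simp add: f_def[abs_def])
    show "f' x0 \<in> borel_measurable lborel" using f'int by auto
  qed (use der bd W in auto)
  moreover have "(\<lambda>x. \<integral>w. f x w \<partial>lborel) = (\<lambda>x. \<integral>y. u (a *\<^sub>R x + b *\<^sub>R y) * q y \<partial>std_gaussian)"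
    unfolding shift[OF q] f_def ..
  moreover have "(\<integral>w. f' x0 w \<partial>lborel) =
      (\<chi> i. \<integral>y. u (a *\<^sub>R x0 + b *\<^sub>R y) * (a / b * (q y * y $ i - dq y $ i)) \<partial>std_gaussian)"
  proof -
    have "(\<integral>w. f' x0 w \<partial>lborel) $ i
        = (\<integral>y. u (a *\<^sub>R x0 + b *\<^sub>R y) * (k * p i y) \<partial>std_gaussian)" for i
      unfolding integral_vec_nth[OF f'int] f'nth shift[OF kp] ..
    thus ?thesis by (simp add: vec_eq_iff p_def k_def)
  qed
  ultimately show ?thesis by simp
qed

end

section \<open>Smoothness of Mehler averages and Gaussian integration by parts\<close>

lemma has_derivative_partial:
  assumes "(f has_derivative (\<lambda>v. g \<bullet> v)) (at x)"
  shows "partial i f x = g $ i"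
  unfolding partial_def frechet_derivative_at[OF assms, symmetric] by (simp add: inner_axis)

lemma has_derivative_grad:
  assumes "(f has_derivative (\<lambda>v. g \<bullet> v)) (at x)"
  shows "grad f x = g"
  by (simp add: grad_def vec_eq_iff has_derivative_partial[OF assms])

lemma linear_growth_bounded:
  fixes u :: "real ^ 'n::finite \<Rightarrow> real"
  assumes "u \<in> borel_measurable borel" and K: "\<And>x. \<bar>u x\<bar> \<le> K"
  shows "linear_growth u K"
proof
  fix x :: "real ^ 'n"
  have "K * 1 \<le> K * (1 + norm x)" using K[of 0] by (intro mult_left_mono) auto
  thus "\<bar>u x\<bar> \<le> K * (1 + norm x)" using K[of x] by simp
qed fact

context linear_growth
begin

text \<open>The polynomial varies in the induction, since each partial derivative is again an
  average of \<open>u\<close> against some polynomial.\<close>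

lemma mehler_poly_Ck:
  assumes q: "real_polynomial_function q" and b: "b \<noteq> 0"
  shows "Ck k (\<lambda>x. \<integral>y. u (a *\<^sub>R x + b *\<^sub>R y) * q y \<partial>std_gaussian)"
  using q
proof (induction k arbitrary: q)
  case 0
  obtain dq where dq: "\<And>i. real_polynomial_function (\<lambda>y. dq y $ i)" "\<And>y. (q has_derivative (\<lambda>v. dq y \<bullet> v)) (at y)"
    using real_polynomial_function_gradient[OF 0] by blast
  show ?case
    using mehler_poly_has_derivative[OF 0 b dq] has_derivative_continuous
    by (simp add: continuous_on_eq_continuous_at) blast
next
  case (Suc k)
  obtain dq where dq: "\<And>i. real_polynomial_function (\<lambda>y. dq y $ i)" "\<And>y. (q has_derivative (\<lambda>v. dq y \<bullet> v)) (at y)"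
    using real_polynomial_function_gradient[OF Suc.prems] by blast
  note d = mehler_poly_has_derivative[OF Suc.prems b dq]
  have "partial i (\<lambda>x. \<integral>y. u (a *\<^sub>R x + b *\<^sub>R y) * q y \<partial>std_gaussian)
     = (\<lambda>x. \<integral>y. u (a *\<^sub>R x + b *\<^sub>R y) * (a / b * (q y * y $ i - dq y $ i)) \<partial>std_gaussian)" for i
    by (rule ext) (simp add: has_derivative_partial[OF d])
  moreover have "real_polynomial_function (\<lambda>y. a / b * (q y * y $ i - dq y $ i))" for i
    by (intro real_polynomial_function_diff real_polynomial_function.intros(2,4) Suc.prems dq(1)
        real_polynomial_function_nth)
  ultimately have "\<forall>i. Ck k (partial i (\<lambda>x. \<integral>y. u (a *\<^sub>R x + b *\<^sub>R y) * q y \<partial>std_gaussian))"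
    by (intro allI) (simp only: Suc.IH)
  moreover have "(\<lambda>x. \<integral>y. u (a *\<^sub>R x + b *\<^sub>R y) * q y \<partial>std_gaussian) differentiable_on UNIV"
    unfolding differentiable_on_def differentiable_def using d by blast
  ultimately show ?case by simp
qed

lemma smooth_mehler: "b \<noteq> 0 \<Longrightarrow> smooth (mehler a b u)"
  using mehler_poly_Ck[OF real_polynomial_function.intros(2)[of 1]]
  by (simp add: smooth_def mehler_def[abs_def])

lemma mehler_has_derivative_kernel:
  assumes b: "b \<noteq> 0"
  shows "(mehler a b u has_derivative
      (\<lambda>v. (\<chi> i. a / b * (\<integral>y. u (a *\<^sub>R x + b *\<^sub>R y) * y $ i \<partial>std_gaussian)) \<bullet> v)) (at x)"
proof -
  have "((\<lambda>y. 1) has_derivative (\<lambda>v. 0 \<bullet> v)) (at y)" for y :: "real^'n" by simp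
  from mehler_poly_has_derivative[OF real_polynomial_function.intros(2)[of 1] b, of "\<lambda>_. 0", OF _ this]
  show ?thesis by (simp add: mehler_def[abs_def] real_polynomial_function.intros(2) mult.left_commute)
qed

end

text \<open>The gradient is carried as an explicit measurable field so that it can be averaged. Only
  first-order information is recorded; second derivatives of averages are produced by the
  kernel.\<close>

locale bounded_gradient =
  fixes u :: "real ^ 'n::finite \<Rightarrow> real" and du :: "real ^ 'n \<Rightarrow> real ^ 'n" and K :: real
  assumes der: "(u has_derivative (\<lambda>v. du x \<bullet> v)) (at x)"
    and du_meas [measurable]: "du \<in> borel_measurable borel"
    and du_bound: "norm (du x) \<le> K"
begin

lemma K_nonneg: "K \<ge> 0"
  using du_bound[of 0] norm_ge_zero[of "du 0"] by linarith

lemma cont: "continuous_on S u"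
  using der has_derivative_continuous continuous_at_imp_continuous_on by blast

sublocale linear_growth u "\<bar>u 0\<bar> + K"
proof
  show "u \<in> borel_measurable borel" by (rule borel_measurable_continuous_onI[OF cont])
  fix x
  have "norm (u x - u 0) \<le> K * norm (x - 0)"
  proof (rule differentiable_bound[OF convex_UNIV, where f'="\<lambda>y v. du y \<bullet> v"])
    show "onorm (\<lambda>v. du y \<bullet> v) \<le> K" for y
    proof (rule onorm_le)
      fix v
      have "\<bar>du y \<bullet> v\<bar> \<le> norm (du y) * norm v" by (rule Cauchy_Schwarz_ineq2)
      also have "\<dots> \<le> K * norm v" by (intro mult_right_mono du_bound norm_ge_zero)
      finally show "norm (du y \<bullet> v) \<le> K * norm v" by simp
    qed
  qed (use der in auto)
  hence "\<bar>u x\<bar> \<le> \<bar>u 0\<bar> + K * norm x" by simp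
  also have "\<dots> \<le> (\<bar>u 0\<bar> + K) * (1 + norm x)"
    using K_nonneg by (simp add: algebra_simps)
  finally show "\<bar>u x\<bar> \<le> (\<bar>u 0\<bar> + K) * (1 + norm x)" .
qed

lemma du_nth_bound: "\<bar>du x $ i\<bar> \<le> K"
  using component_le_norm_cart[of "du x" i] du_bound[of x] by linarith

lemma du_nth_linear_growth: "linear_growth (\<lambda>x. du x $ i) K"
  by (rule linear_growth_bounded[OF _ du_nth_bound]) measurable

lemma integrable_du: "integrable std_gaussian (\<lambda>y. du (x0 + b *\<^sub>R y))"
  by (intro integrable_vecI linear_growth.integrable_gauss[OF du_nth_linear_growth])

text \<open>Here the derivative passes through the average onto \<open>u\<close>, with factor
  \<open>a\<close>; in \<open>mehler_has_derivative_kernel\<close> it falls on the Gaussian, with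
  factor \<open>a / b\<close>.\<close>

lemma mehler_has_derivative:
  "(mehler a b u has_derivative (\<lambda>v. (\<chi> i. a * mehler a b (\<lambda>z. du z $ i) x) \<bullet> v)) (at x)"
proof -
  have "((\<lambda>x. \<integral>y. u (a *\<^sub>R x + b *\<^sub>R y) \<partial>std_gaussian) has_derivative
      (\<lambda>v. (\<integral>y. a *\<^sub>R du (a *\<^sub>R x + b *\<^sub>R y) \<partial>std_gaussian) \<bullet> v)) (at x)"
  proof (rule has_derivative_integral_param[where e=1 and w="\<lambda>_. \<bar>a\<bar> * K"])
    fix x y :: "real ^ 'n"
    have "((\<lambda>x. a *\<^sub>R x + b *\<^sub>R y) has_derivative (\<lambda>v. a *\<^sub>R v)) (at x)"
      by (auto intro!: derivative_eq_intros)
    from has_derivative_compose[OF this der]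
    show "((\<lambda>x. u (a *\<^sub>R x + b *\<^sub>R y)) has_derivative (\<lambda>v. (a *\<^sub>R du (a *\<^sub>R x + b *\<^sub>R y)) \<bullet> v)) (at x)"
      by simp
    show "norm (a *\<^sub>R du (a *\<^sub>R x + b *\<^sub>R y)) \<le> \<bar>a\<bar> * K"
      using du_bound by (auto intro!: mult_left_mono)
  qed (auto intro: integrable_gauss)
  moreover have "(\<integral>y. a *\<^sub>R du (a *\<^sub>R x + b *\<^sub>R y) \<partial>std_gaussian)
      = (\<chi> i. a * mehler a b (\<lambda>z. du z $ i) x)" (is "?L = ?R")
    using integral_vec_nth[OF integrable_du[of "a *\<^sub>R x" b]] by (simp add: vec_eq_iff mehler_def)
  ultimately show ?thesis unfolding mehler_def[of a b u, abs_def] by (simp only:)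
qed

text \<open>The two formulas for the derivative of \<open>mehler 1 b u\<close> must agree. This
  yields the integration by parts with no boundary term to discuss.\<close>

lemma gauss_ibp:
  assumes "b \<noteq> 0"
  shows "(\<integral>y. u (x + b *\<^sub>R y) * y $ i \<partial>std_gaussian) = b * (\<integral>y. du (x + b *\<^sub>R y) $ i \<partial>std_gaussian)"
  using has_derivative_partial[OF mehler_has_derivative[of 1 b x], of i]
    has_derivative_partial[OF mehler_has_derivative_kernel[OF assms, of 1 x], of i] assms
  by (simp add: mehler_def field_simps)

end

section \<open>Gaussian moments and Bessel's inequality\<close>

lemma integrable_gauss_poly_fun:
  "real_polynomial_function q \<Longrightarrow> integrable std_gaussian (q :: real^'n::finite \<Rightarrow> real)"
  using linear_growth.integrable_gauss_poly[where u="\<lambda>_. 1" and C=1 and q=q and b=0]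
  by (simp add: linear_growth_def)

lemma integrable_gauss_nth: "integrable std_gaussian (\<lambda>y. y $ i)"
  by (rule integrable_gauss_poly_fun[OF real_polynomial_function_nth])

lemma integrable_gauss_nth2: "integrable std_gaussian (\<lambda>y. y $ i * y $ j)"
  by (intro integrable_gauss_poly_fun real_polynomial_function.intros(4) real_polynomial_function_nth)

text \<open>Integration by parts for a coordinate function, whose gradient is a constant unit
  vector.\<close>

lemma gauss_cov:
  fixes i j :: "'n::finite"
  shows "(\<integral>y. y $ i * y $ j \<partial>std_gaussian) = (if i = j then 1 else 0)"
proof -
  interpret bounded_gradient "\<lambda>x::real^'n. x $ i" "\<lambda>_. axis i 1" 1
  proof
    show "((\<lambda>x. x $ i) has_derivative (\<lambda>v. axis i 1 \<bullet> v)) (at x)" for x :: "real^'n"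
      using bounded_linear_imp_has_derivative[OF bounded_linear_vec_nth, of i "at x"]
      by (simp add: inner_commute[of "axis i 1"] inner_axis)
  qed (auto simp: norm_axis_1)
  show ?thesis using gauss_ibp[where b=1 and i=j and x=0] by (auto simp: axis_def)
qed

lemma integrable_norm_std_gaussian: "integrable (std_gaussian :: (real^'n::finite) measure) norm"
  using integrable_norm[OF integrable_vecI[of std_gaussian "\<lambda>x. x"]] integrable_gauss_nth by auto

text \<open>By \<open>gauss_cov\<close> the coordinates are orthonormal in the Gaussian L2 space,
  and the square of \<open>v\<close> minus its projection has nonnegative integral. This is what
  keeps the Hessian bound free of dimensional constants.\<close>

lemma gauss_bessel:
  fixes v :: "real ^ 'n::finite \<Rightarrow> real"
  assumes [measurable]: "v \<in> borel_measurable borel" and K: "\<And>x. \<bar>v x\<bar> \<le> K"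
  shows "(\<Sum>i\<in>UNIV. (\<integral>y. v y * y $ i \<partial>std_gaussian)\<^sup>2) \<le> (\<integral>y. (v y)\<^sup>2 \<partial>std_gaussian)"
proof -
  let ?g = "std_gaussian :: (real^'n) measure"
  define w where "w i = (\<integral>y. v y * y $ i \<partial>?g)" for i
  have "linear_growth v K" by (rule linear_growth_bounded) fact+
  then have iv: "integrable ?g (\<lambda>y. v y * y $ i)" for i
    using linear_growth.integrable_gauss_poly[OF _ real_polynomial_function_nth[of i], of v K 0 1] by simp
  have iv2: "integrable ?g (\<lambda>y. (v y)\<^sup>2)"
    by (rule gauss.integrable_const_bound[where B="K\<^sup>2"])
      (use K in \<open>auto intro!: AE_I2 simp: abs_le_square_iff[symmetric] intro: order_trans[OF _ abs_ge_self]\<close>)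
  have "0 \<le> (\<integral>y. (v y - (\<Sum>i\<in>UNIV. w i * y $ i))\<^sup>2 \<partial>?g)" by simp
  also have "(\<lambda>y::real^'n. (v y - (\<Sum>i\<in>UNIV. w i * y $ i))\<^sup>2)
      = (\<lambda>y. (v y)\<^sup>2 - 2 * (\<Sum>i\<in>UNIV. w i * (v y * y $ i))
          + (\<Sum>i\<in>UNIV. \<Sum>j\<in>UNIV. w i * w j * (y $ i * y $ j)))"
    by (rule ext)
       (simp add: power2_diff power2_eq_square[of "sum _ _"] sum_product sum_distrib_left mult_ac)
  also have "(\<integral>y. \<dots> y \<partial>?g) = (\<integral>y. (v y)\<^sup>2 \<partial>?g) - 2 * (\<Sum>i\<in>UNIV. w i * w i)
      + (\<Sum>i\<in>UNIV. \<Sum>j\<in>UNIV. w i * w j * (if i = j then 1 else 0))"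
    by (simp add: iv iv2 integrable_gauss_nth2 Bochner_Integration.integral_sum gauss_cov w_def)
  also have "\<dots> = (\<integral>y. (v y)\<^sup>2 \<partial>?g) - (\<Sum>i\<in>UNIV. (w i)\<^sup>2)"
  proof -
    have "w i * w j * (if i = j then 1 else 0) = (if j = i then w i * w i else 0)" for i j by simp
    thus ?thesis by (simp only:) (simp add: power2_eq_square)
  qed
  finally show ?thesis by (simp add: w_def)
qed

section \<open>The Stein identity along the heat flow\<close>

lemma borel_measurable_vecI:
  fixes f :: "'b \<Rightarrow> real ^ 'n::finite"
  assumes "\<And>i. (\<lambda>x. f x $ i) \<in> borel_measurable M"
  shows "f \<in> borel_measurable M"
proof -
  have "f = (\<lambda>x. \<Sum>i\<in>UNIV. (f x $ i) *\<^sub>R axis i 1)"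
    using basis_expansion[of "f _"] by (simp add: scalar_mult_eq_scaleR)
  moreover have "(\<lambda>x. \<Sum>i\<in>UNIV. (f x $ i) *\<^sub>R (axis i 1 :: real ^ 'n)) \<in> borel_measurable M"
    using assms by measurable
  ultimately show ?thesis by simp
qed

lemma borel_measurable_mat_nth [measurable]:
  "(\<lambda>A::real^'n::finite^'n. A $ i $ j) \<in> borel_measurable borel"
  by (intro borel_measurable_continuous_onI continuous_intros)

lemma norm_vec_sq: "(norm (x::real^'n::finite))\<^sup>2 = (\<Sum>i\<in>UNIV. (x $ i)\<^sup>2)"
  unfolding power2_norm_eq_inner by (simp add: inner_vec_def power2_eq_square)

lemma norm_mat_sq: "(norm (A::real^'n::finite^'n))\<^sup>2 = (\<Sum>i\<in>UNIV. \<Sum>j\<in>UNIV. (A $ i $ j)\<^sup>2)"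
  unfolding power2_norm_eq_inner by (simp add: inner_vec_def power2_eq_square)

lemma inner_mat: "(A::real^'n::finite^'n) \<bullet> B = (\<Sum>i\<in>UNIV. \<Sum>j\<in>UNIV. A $ i $ j * B $ i $ j)"
  by (simp add: inner_vec_def)

lemma inner_vec: "(x::real^'n::finite) \<bullet> y = (\<Sum>i\<in>UNIV. x $ i * y $ i)"
  by (simp add: inner_vec_def)

section \<open>Gradient and Hessian of a Mehler average, and their pairing with the Stein
  kernel\<close>

context bounded_gradient
begin

lemma integrable_du_poly:
  assumes "real_polynomial_function q"
  shows "integrable std_gaussian (\<lambda>y. du (x0 + b *\<^sub>R y) $ i * q y)"
  by (rule linear_growth.integrable_gauss_poly[OF du_nth_linear_growth assms])

lemma integrable_du_inner: "integrable std_gaussian (\<lambda>y. du (x0 + b *\<^sub>R y) \<bullet> y)"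
  unfolding inner_vec by (intro Bochner_Integration.integrable_sum integrable_du_poly real_polynomial_function_nth)

lemma integrable_du_sq: "integrable std_gaussian (\<lambda>y. (norm (du (x0 + b *\<^sub>R y)))\<^sup>2)"
  by (rule gauss.integrable_const_bound[where B="K\<^sup>2"]) (auto intro!: AE_I2 power_mono du_bound)

lemma grad_mehler: "grad (mehler a b u) x = (\<integral>y. a *\<^sub>R du (a *\<^sub>R x + b *\<^sub>R y) \<partial>std_gaussian)"
  using integral_vec_nth[OF integrable_du[of "a *\<^sub>R x" b]]
  by (simp add: has_derivative_grad[OF mehler_has_derivative] vec_eq_iff mehler_def)

text \<open>One derivative goes to \<open>u\<close> with factor \<open>a\<close>, the other to the
  kernel with factor \<open>a / b\<close>.\<close>

lemma
  assumes b: "b \<noteq> 0"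
  shows hess_mehler: "hess (mehler a b u) x $ i $ j
      = a\<^sup>2 / b * (\<integral>y. du (a *\<^sub>R x + b *\<^sub>R y) $ j * y $ i \<partial>std_gaussian)"
    and grad_mehler_has_derivative: "((\<lambda>x. grad (mehler a b u) x $ j) has_derivative
      (\<lambda>v. (\<chi> i. hess (mehler a b u) x $ i $ j) \<bullet> v)) (at x)"
proof -
  have 1: "partial j (mehler a b u) = (\<lambda>x. a * mehler a b (\<lambda>z. du z $ j) x)" for j
    by (rule ext) (simp add: has_derivative_partial[OF mehler_has_derivative])
  have d: "((\<lambda>x. a * mehler a b (\<lambda>z. du z $ j) x) has_derivative
      (\<lambda>v. (a *\<^sub>R (\<chi> i. a / b * (\<integral>y. du (a *\<^sub>R x + b *\<^sub>R y) $ j * y $ i \<partial>std_gaussian))) \<bullet> v)) (at x)" for j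
    unfolding inner_scaleR_left
    by (intro has_derivative_mult_right linear_growth.mehler_has_derivative_kernel[OF du_nth_linear_growth b])
  show h: "hess (mehler a b u) x $ i $ j
      = a\<^sup>2 / b * (\<integral>y. du (a *\<^sub>R x + b *\<^sub>R y) $ j * y $ i \<partial>std_gaussian)" for i j
    using has_derivative_partial[OF d, of i j] by (simp add: hess_def 1 power2_eq_square)
  have "(a *\<^sub>R (\<chi> i. a / b * (\<integral>y. du (a *\<^sub>R x + b *\<^sub>R y) $ j * y $ i \<partial>std_gaussian)))
      = (\<chi> i. hess (mehler a b u) x $ i $ j)"
    by (simp add: vec_eq_iff h power2_eq_square)
  thus "((\<lambda>x. grad (mehler a b u) x $ j) has_derivative
      (\<lambda>v. (\<chi> i. hess (mehler a b u) x $ i $ j) \<bullet> v)) (at x)"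
    using d[of j] by (simp add: grad_def 1)
qed

lemma mehler_has_derivative_grad:
  "(mehler a b u has_derivative (\<lambda>v. grad (mehler a b u) x \<bullet> v)) (at x)"
  using mehler_has_derivative[of a b x] by (simp add: has_derivative_grad[OF mehler_has_derivative])

lemma grad_mehler_bound: "norm (grad (mehler a b u) x) \<le> \<bar>a\<bar> * K"
proof -
  have "norm (grad (mehler a b u) x) \<le> (\<integral>y. norm (a *\<^sub>R du (a *\<^sub>R x + b *\<^sub>R y)) \<partial>std_gaussian)"
    unfolding grad_mehler by (rule integral_norm_bound)
  also have "\<dots> \<le> (\<integral>y. \<bar>a\<bar> * K \<partial>(std_gaussian :: (real^'n) measure))"
    by (intro integral_mono integrable_norm integrable_scaleR_right integrable_du)
       (auto intro!: mult_left_mono du_bound)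
  finally show ?thesis by simp
qed

text \<open>A column of the Hessian consists of the first-order Gaussian coefficients of one
  component of \<open>du\<close>, to which \<open>gauss_bessel\<close> applies. For the semigroup at
  time s the factor in front is exp (- 4 s) / (1 - exp (- 2 s)).\<close>

lemma hess_mehler_bound:
  assumes b: "b \<noteq> 0"
  shows "(norm (hess (mehler a b u) x))\<^sup>2
      \<le> (a\<^sup>2 / b)\<^sup>2 * (\<integral>y. (norm (du (a *\<^sub>R x + b *\<^sub>R y)))\<^sup>2 \<partial>std_gaussian)"
proof -
  let ?d = "\<lambda>j y. du (a *\<^sub>R x + b *\<^sub>R y) $ j"
  have sq: "integrable std_gaussian (\<lambda>y. (?d j y)\<^sup>2)" for j
    by (rule gauss.integrable_const_bound[where B="K\<^sup>2"])
       (auto intro!: AE_I2 power_mono[OF du_nth_bound, of _ _ 2, simplified])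
  have "(norm (hess (mehler a b u) x))\<^sup>2
      = (a\<^sup>2 / b)\<^sup>2 * (\<Sum>j\<in>UNIV. \<Sum>i\<in>UNIV. (\<integral>y. ?d j y * y $ i \<partial>std_gaussian)\<^sup>2)"
    unfolding norm_mat_sq hess_mehler[OF b] power_mult_distrib sum_distrib_left by (rule sum.swap)
  also have "\<dots> \<le> (a\<^sup>2 / b)\<^sup>2 * (\<Sum>j\<in>UNIV. \<integral>y. (?d j y)\<^sup>2 \<partial>std_gaussian)"
    by (intro mult_left_mono sum_mono gauss_bessel[where K=K]) (auto simp: du_nth_bound)
  also have "(\<Sum>j\<in>UNIV. \<integral>y. (?d j y)\<^sup>2 \<partial>std_gaussian) = (\<integral>y. (norm (du (a *\<^sub>R x + b *\<^sub>R y)))\<^sup>2 \<partial>std_gaussian)"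
    unfolding norm_vec_sq using sq by (subst Bochner_Integration.integral_sum) auto
  finally show ?thesis .
qed

lemma hess_mehler_norm_le:
  assumes b: "b \<noteq> 0"
  shows "norm (hess (mehler a b u) x) \<le> a\<^sup>2 / \<bar>b\<bar> * K"
proof -
  have "(\<integral>y. (norm (du (a *\<^sub>R x + b *\<^sub>R y)))\<^sup>2 \<partial>std_gaussian) \<le> (\<integral>y. K\<^sup>2 \<partial>(std_gaussian :: (real^'n) measure))"
    by (intro integral_mono integrable_du_sq) (auto intro!: power_mono du_bound)
  hence "(norm (hess (mehler a b u) x))\<^sup>2 \<le> (a\<^sup>2 / b)\<^sup>2 * K\<^sup>2"
    using hess_mehler_bound[OF b, of a x]
    by simp (meson mult_left_mono order_trans zero_le_power2)
  hence "(norm (hess (mehler a b u) x))\<^sup>2 \<le> (a\<^sup>2 / \<bar>b\<bar> * K)\<^sup>2"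
    by (simp add: power_mult_distrib power_divide)
  moreover have "0 \<le> a\<^sup>2 / \<bar>b\<bar> * K" using K_nonneg by simp
  ultimately show ?thesis by (rule power2_le_imp_le)
qed

lemma hess_mehler_nth_le:
  assumes b: "b \<noteq> 0"
  shows "\<bar>hess (mehler a b u) x $ i $ j\<bar> \<le> a\<^sup>2 / \<bar>b\<bar> * K"
  using Finite_Cartesian_Product.norm_nth_le[of "hess (mehler a b u) x" i] component_le_norm_cart[of "hess (mehler a b u) x $ i" j]
    hess_mehler_norm_le[OF b, of a x] by linarith

lemma borel_measurable_hess_mehler [measurable]:
  "b \<noteq> 0 \<Longrightarrow> (\<lambda>x. hess (mehler a b u) x $ i $ j) \<in> borel_measurable borel"
  unfolding hess_mehler by measurable

text \<open>The Stein identity enters only here, through the test function \<open>mehler a b u\<close>: its Hessian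
  costs one derivative of \<open>u\<close> only, the other one being moved to the Gaussian kernel.\<close>

lemma stein_bound:
  fixes \<nu> :: "(real^'n) measure" and \<tau> :: "real^'n \<Rightarrow> real^'n^'n"
  assumes prob: "prob_space \<nu>" and sets [measurable_cong]: "sets \<nu> = sets borel"
    and stein: "stein_kernel \<nu> \<tau>" and fin: "finite_stein_discrepancy \<nu> \<tau>"
    and a: "a > 0" and b: "b > 0"
  shows "- ((a\<^sup>2 / b)\<^sup>2 * (\<integral>x. (norm (\<tau> x - mat 1))\<^sup>2 \<partial>\<nu>))
      \<le> (\<integral>x. (\<integral>y. 2 * ((- a *\<^sub>R x + (a\<^sup>2 / b) *\<^sub>R y) \<bullet> du (a *\<^sub>R x + b *\<^sub>R y))
              + (norm (du (a *\<^sub>R x + b *\<^sub>R y)))\<^sup>2 \<partial>std_gaussian) \<partial>\<nu>)"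
proof -
  interpret nu: prob_space \<nu> by fact
  define c where "c = a\<^sup>2 / b"
  have c: "c > 0" using a b by (simp add: c_def)
  have b0: "b \<noteq> 0" using b by simp
  let ?F = "mehler a b u"
  let ?G = "\<lambda>x. \<integral>y. (norm (du (a *\<^sub>R x + b *\<^sub>R y)))\<^sup>2 \<partial>std_gaussian"
  have \<tau> [measurable]: "\<tau> \<in> borel_measurable borel" and \<tau>_int: "\<And>i j. integrable \<nu> (\<lambda>x. \<tau> x $ i $ j)"
    using stein by (auto simp: stein_kernel_def)
  have G_le: "?G x \<le> K\<^sup>2" for x
  proof -
    have "?G x \<le> (\<integral>y. K\<^sup>2 \<partial>(std_gaussian :: (real^'n) measure))"
      by (intro integral_mono integrable_du_sq) (auto intro!: power_mono du_bound)
    thus ?thesis by simp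
  qed
  have G_nonneg: "?G x \<ge> 0" for x by simp
  have Hn: "(norm (hess ?F x))\<^sup>2 \<le> c\<^sup>2 * ?G x" for x
    unfolding c_def by (rule hess_mehler_bound[OF b0])
  have Hb: "norm (hess ?F x) \<le> c * K" for x
    using hess_mehler_norm_le[OF b0, of a x] b by (simp add: c_def)
  have Hij: "\<bar>hess ?F x $ i $ j\<bar> \<le> c * K" for x i j
    using hess_mehler_nth_le[OF b0, of a x] b by (simp add: c_def)
  have Hm [measurable]: "(\<lambda>x. hess ?F x $ i $ j) \<in> borel_measurable borel" for i j
    by (rule borel_measurable_hess_mehler[OF b0])
  have Gm [measurable]: "?G \<in> borel_measurable borel" by measurable
  \<comment> \<open>With \<open>smooth_mehler\<close>, which needs \<open>b\<close> nonzero, this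
    makes the average an admissible test function.\<close>
  have bdH: "bounded (range (hess ?F))"
    unfolding bounded_iff using Hb by auto
  have st: "integrable \<nu> (\<lambda>x. x \<bullet> grad ?F x)"
    "(\<integral>x. x \<bullet> grad ?F x \<partial>\<nu>) = (\<integral>x. \<tau> x \<bullet> hess ?F x \<partial>\<nu>)"
    using stein bdH smooth_mehler[OF b0] by (auto simp: stein_kernel_def)
  have Hint: "integrable \<nu> (\<lambda>x. hess ?F x $ i $ j)" for i j
    by (rule nu.integrable_const_bound[where B="c * K"]) (auto intro!: AE_I2 Hij)
  have \<tau>H: "integrable \<nu> (\<lambda>x. \<tau> x \<bullet> hess ?F x)"
    unfolding inner_mat
  proof (intro Bochner_Integration.integrable_sum)
    fix i j
    show "integrable \<nu> (\<lambda>x. \<tau> x $ i $ j * hess ?F x $ i $ j)"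
    proof (rule Bochner_Integration.integrable_bound)
      show "integrable \<nu> (\<lambda>x. (c * K) * \<bar>\<tau> x $ i $ j\<bar>)" using \<tau>_int by auto
      show "AE x in \<nu>. norm (\<tau> x $ i $ j * hess ?F x $ i $ j) \<le> norm ((c * K) * \<bar>\<tau> x $ i $ j\<bar>)"
      proof (rule AE_I2)
        fix x
        have "\<bar>\<tau> x $ i $ j\<bar> * \<bar>hess ?F x $ i $ j\<bar> \<le> \<bar>\<tau> x $ i $ j\<bar> * (c * K)"
          by (intro mult_left_mono Hij) auto
        thus "norm (\<tau> x $ i $ j * hess ?F x $ i $ j) \<le> norm ((c * K) * \<bar>\<tau> x $ i $ j\<bar>)"
          using c K_nonneg by (simp add: abs_mult mult_ac)
      qed
    qed measurable
  qed
  \<comment> \<open>Pairing with the identity is the Laplacian, and the kernel form of the Hessian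
    turns it into the \<open>y\<close>-term of the statement.\<close>
  have tr: "mat 1 \<bullet> hess ?F x = c * (\<integral>y. du (a *\<^sub>R x + b *\<^sub>R y) \<bullet> y \<partial>std_gaussian)" for x
  proof -
    have "mat 1 \<bullet> hess ?F x = (\<Sum>i\<in>UNIV. hess ?F x $ i $ i)"
    proof -
      have "mat 1 $ i $ j * hess ?F x $ i $ j = (if j = i then hess ?F x $ i $ i else 0)" for i j
        by (auto simp: mat_def)
      thus ?thesis unfolding inner_mat by (simp only:) simp
    qed
    also have "\<dots> = c * (\<integral>y. du (a *\<^sub>R x + b *\<^sub>R y) \<bullet> y \<partial>std_gaussian)"
      unfolding inner_vec hess_mehler[OF b0] c_def
      by (subst Bochner_Integration.integral_sum)
         (auto intro!: integrable_du_poly real_polynomial_function_nth simp: sum_distrib_left)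
    finally show ?thesis .
  qed
  have mH: "integrable \<nu> (\<lambda>x. mat 1 \<bullet> hess ?F x)"
    unfolding inner_mat by (intro Bochner_Integration.integrable_sum integrable_mult_right Hint)
  have Gi: "integrable \<nu> ?G"
    by (rule nu.integrable_const_bound[where B="K\<^sup>2"]) (use G_le G_nonneg in \<open>auto intro!: AE_I2\<close>)
  have inner: "(\<integral>y. 2 * ((- a *\<^sub>R x + (a\<^sup>2 / b) *\<^sub>R y) \<bullet> du (a *\<^sub>R x + b *\<^sub>R y))
              + (norm (du (a *\<^sub>R x + b *\<^sub>R y)))\<^sup>2 \<partial>std_gaussian)
      = - 2 * (x \<bullet> grad ?F x) + 2 * (mat 1 \<bullet> hess ?F x) + ?G x" for x
  proof -
    define A where "A y = x \<bullet> (a *\<^sub>R du (a *\<^sub>R x + b *\<^sub>R y))" for y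
    define B where "B y = du (a *\<^sub>R x + b *\<^sub>R y) \<bullet> y" for y
    define C where "C y = (norm (du (a *\<^sub>R x + b *\<^sub>R y)))\<^sup>2" for y
    have int: "integrable std_gaussian A" "integrable std_gaussian B" "integrable std_gaussian C"
      unfolding A_def[abs_def] B_def[abs_def] C_def[abs_def]
      by (intro integrable_inner_right integrable_scaleR_right integrable_du
          integrable_du_inner integrable_du_sq)+
    have A: "integral\<^sup>L std_gaussian A = x \<bullet> grad ?F x"
      unfolding grad_mehler A_def by (intro integral_inner_right integrable_scaleR_right integrable_du)
    have "2 * ((- a *\<^sub>R x + (a\<^sup>2 / b) *\<^sub>R y) \<bullet> du (a *\<^sub>R x + b *\<^sub>R y)) + (norm (du (a *\<^sub>R x + b *\<^sub>R y)))\<^sup>2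
       = (- 2 * A y + 2 * (c * B y)) + C y" for y
      by (simp add: inner_diff_left inner_commute[of y] A_def B_def C_def c_def)
    hence "(\<integral>y. 2 * ((- a *\<^sub>R x + (a\<^sup>2 / b) *\<^sub>R y) \<bullet> du (a *\<^sub>R x + b *\<^sub>R y))
              + (norm (du (a *\<^sub>R x + b *\<^sub>R y)))\<^sup>2 \<partial>std_gaussian)
        = (\<integral>y. (- 2 * A y + 2 * (c * B y)) + C y \<partial>std_gaussian)" by (simp only:)
    also have "\<dots> = - 2 * (x \<bullet> grad ?F x) + 2 * (c * integral\<^sup>L std_gaussian B) + integral\<^sup>L std_gaussian C"
      using int by (simp add: A)
    finally show ?thesis unfolding tr B_def C_def .
  qed
  have sd: "integrable \<nu> (\<lambda>x. (norm (\<tau> x - mat 1))\<^sup>2)"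
    using fin by (simp add: finite_stein_discrepancy_def)
  have ptw: "- (c\<^sup>2 * (norm (\<tau> x - mat 1))\<^sup>2) \<le> - 2 * (\<tau> x \<bullet> hess ?F x) + 2 * (mat 1 \<bullet> hess ?F x) + ?G x" for x
  proof -
    let ?n = "norm (\<tau> x - mat 1)" and ?h = "norm (hess ?F x)"
    have "(\<tau> x - mat 1) \<bullet> hess ?F x \<le> ?n * ?h" by (rule norm_cauchy_schwarz)
    \<comment> \<open>Young's inequality with weight \<open>c\<close>, chosen so that
      \<open>?h\<^sup>2 / c\<^sup>2\<close> is at most \<open>?G x\<close>: the squared gradient in
      the statement pays for the Hessian.\<close>
    moreover have "2 * (?n * ?h) \<le> c\<^sup>2 * ?n\<^sup>2 + ?h\<^sup>2 / c\<^sup>2"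
    proof -
      have "0 \<le> (c * ?n - ?h / c)\<^sup>2" by simp
      thus ?thesis using c by (simp add: power2_diff power_mult_distrib power_divide)
    qed
    moreover have "?h\<^sup>2 / c\<^sup>2 \<le> ?G x" using Hn[of x] c by (simp add: divide_le_eq mult.commute)
    ultimately show ?thesis by (simp add: inner_diff_left)
  qed
  have "- (c\<^sup>2 * (\<integral>x. (norm (\<tau> x - mat 1))\<^sup>2 \<partial>\<nu>)) = (\<integral>x. - (c\<^sup>2 * (norm (\<tau> x - mat 1))\<^sup>2) \<partial>\<nu>)"
    by simp
  also have "\<dots> \<le> (\<integral>x. - 2 * (\<tau> x \<bullet> hess ?F x) + 2 * (mat 1 \<bullet> hess ?F x) + ?G x \<partial>\<nu>)"
    using sd \<tau>H mH Gi by (intro integral_mono ptw) auto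
  also have "\<dots> = - 2 * (\<integral>x. \<tau> x \<bullet> hess ?F x \<partial>\<nu>) + 2 * (\<integral>x. mat 1 \<bullet> hess ?F x \<partial>\<nu>) + (\<integral>x. ?G x \<partial>\<nu>)"
    using \<tau>H mH Gi by simp
  \<comment> \<open>The Stein identity replaces the pairing with \<open>\<tau>\<close> by
    \<open>x \<bullet> grad ?F x\<close>, which is the term that the flow produces.\<close>
  also have "\<dots> = (\<integral>x. - 2 * (x \<bullet> grad ?F x) + 2 * (mat 1 \<bullet> hess ?F x) + ?G x \<partial>\<nu>)"
    using st mH Gi by simp
  finally show ?thesis unfolding inner c_def .
qed

end

lemma borel_measurable_mehler [measurable]:
  assumes [measurable]: "u \<in> borel_measurable borel"
  shows "mehler a b u \<in> borel_measurable borel"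
  unfolding mehler_def[abs_def] by measurable

lemma (in bounded_gradient) borel_measurable_grad_mehler [measurable]:
  "grad (mehler a b u) \<in> borel_measurable borel"
  unfolding grad_mehler[abs_def] by measurable

section \<open>Logarithms of positive heat flows\<close>

lemma abs_ln_le:
  fixes z :: real
  assumes "0 < m" "m \<le> z" "z \<le> M"
  shows "\<bar>ln z\<bar> \<le> \<bar>ln m\<bar> + \<bar>ln M\<bar>"
proof -
  have "ln m \<le> ln z" "ln z \<le> ln M" using assms by (auto intro!: ln_mono)
  thus ?thesis by linarith
qed

text \<open>The functions \<open>k\<close> are the positive test functions of the dual formula for
  the entropy. The bounds \<open>m\<close> and \<open>M\<close> keep all logarithms bounded and
  allow division by averages of \<open>k\<close>.\<close>

locale heat_flow = bounded_gradient k dk K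
  for k :: "real ^ 'n::finite \<Rightarrow> real" and dk K +
  fixes m M :: real
  assumes m_pos: "m > 0" and lower: "m \<le> k x" and upper: "k x \<le> M"
begin

lemma mehler_lower: "m \<le> mehler a b k x" and mehler_upper: "mehler a b k x \<le> M"
proof -
  show "m \<le> mehler a b k x" "mehler a b k x \<le> M"
    unfolding mehler_def using lower upper
    using integral_mono[of std_gaussian "\<lambda>y. m" "\<lambda>y. k (a *\<^sub>R x + b *\<^sub>R y)"]
      integral_mono[of std_gaussian "\<lambda>y. k (a *\<^sub>R x + b *\<^sub>R y)" "\<lambda>y. M"] integrable_gauss
    by auto
qed

lemma mehler_pos: "mehler a b k x > 0"
  using mehler_lower m_pos by (rule less_le_trans[rotated])

lemma ln_bound: "\<bar>ln (k x)\<bar> \<le> \<bar>ln m\<bar> + \<bar>ln M\<bar>"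
  by (rule abs_ln_le[OF m_pos lower upper])

lemma ln_mehler_bound: "\<bar>ln (mehler a b k x)\<bar> \<le> \<bar>ln m\<bar> + \<bar>ln M\<bar>"
  by (rule abs_ln_le[OF m_pos mehler_lower mehler_upper])

lemma ln_mehler_bounded_gradient:
  "bounded_gradient (\<lambda>x. ln (mehler a b k x)) (\<lambda>x. (1 / mehler a b k x) *\<^sub>R grad (mehler a b k) x) (\<bar>a\<bar> * K / m)"
proof
  fix x
  show "((\<lambda>x. ln (mehler a b k x)) has_derivative
      (\<lambda>v. ((1 / mehler a b k x) *\<^sub>R grad (mehler a b k) x) \<bullet> v)) (at x)"
    using has_derivative_ln[OF mehler_pos mehler_has_derivative_grad, of a b x]
    by (simp add: divide_inverse mult.commute)
  show "norm ((1 / mehler a b k x) *\<^sub>R grad (mehler a b k) x) \<le> \<bar>a\<bar> * K / m"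
    using frac_le[OF _ grad_mehler_bound[of a b x] m_pos mehler_lower[of a b x]] K_nonneg mehler_pos[of a b x]
    by simp
qed measurable

lemma
  assumes b: "b \<noteq> 0"
  shows hess_ratio_bound: "\<bar>hess (mehler a b k) x $ j $ i\<bar> / mehler a b k x \<le> a\<^sup>2 / \<bar>b\<bar> * K / m"
    and integrable_hess_ratio:
      "integrable std_gaussian (\<lambda>y. hess (mehler a b k) (x + c *\<^sub>R y) $ j $ i / mehler a b k (x + c *\<^sub>R y))"
proof -
  show bound: "\<bar>hess (mehler a b k) x $ j $ i\<bar> / mehler a b k x \<le> a\<^sup>2 / \<bar>b\<bar> * K / m" for x
    by (rule frac_le[OF _ hess_mehler_nth_le[OF b] m_pos mehler_lower]) (simp add: K_nonneg)
  note [measurable] = borel_measurable_hess_mehler[OF b]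
  show "integrable std_gaussian (\<lambda>y. hess (mehler a b k) (x + c *\<^sub>R y) $ j $ i / mehler a b k (x + c *\<^sub>R y))"
    by (rule gauss.integrable_const_bound[where B="a\<^sup>2 / \<bar>b\<bar> * K / m"])
       (use bound mehler_pos in \<open>auto intro!: AE_I2 simp: abs_of_pos\<close>)
qed

text \<open>The field is a column of the Hessian of the logarithm. This makes the components of the
  logarithmic gradient eligible for \<open>gauss_ibp\<close>; only the existence of a bound
  matters.\<close>

lemma log_gradient_bounded_gradient:
  assumes b: "b \<noteq> 0"
  shows "\<exists>B. bounded_gradient (\<lambda>x. grad (mehler a b k) x $ i / mehler a b k x)
    (\<lambda>x. \<chi> j. hess (mehler a b k) x $ j $ i / mehler a b k x
       - grad (mehler a b k) x $ i * grad (mehler a b k) x $ j / (mehler a b k x)\<^sup>2) B"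
proof -
  let ?G = "mehler a b k"
  let ?d = "\<lambda>x. \<chi> j. hess ?G x $ j $ i / ?G x - grad ?G x $ i * grad ?G x $ j / (?G x)\<^sup>2"
  let ?B = "a\<^sup>2 / \<bar>b\<bar> * K / m + (\<bar>a\<bar> * K) * (\<bar>a\<bar> * K) / m\<^sup>2"
  have "bounded_gradient (\<lambda>x. grad ?G x $ i / ?G x) ?d (real CARD('n) * ?B)"
  proof
    fix x
    have p: "?G x \<noteq> 0" using mehler_pos[of a b x] by simp
    have "((\<lambda>x. grad ?G x $ i / ?G x) has_derivative
        (\<lambda>v. - (grad ?G x $ i) * (inverse (?G x) * (grad ?G x \<bullet> v) * inverse (?G x))
          + ((\<chi> j. hess ?G x $ j $ i) \<bullet> v) / ?G x)) (at x)"
      by (rule has_derivative_divide[OF grad_mehler_has_derivative[OF b] mehler_has_derivative_grad p])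
    moreover have "?d x \<bullet> v = - (grad ?G x $ i) * (inverse (?G x) * (grad ?G x \<bullet> v) * inverse (?G x))
          + ((\<chi> j. hess ?G x $ j $ i) \<bullet> v) / ?G x" for v
    proof -
      have "?d x = (1 / ?G x) *\<^sub>R (\<chi> j. hess ?G x $ j $ i) - (grad ?G x $ i / (?G x)\<^sup>2) *\<^sub>R grad ?G x"
        by (simp add: vec_eq_iff)
      thus ?thesis
        by (simp add: inner_diff_left power2_eq_square divide_inverse mult_ac del: vector_minus_component)
    qed
    ultimately show "((\<lambda>x. grad ?G x $ i / ?G x) has_derivative (\<lambda>v. ?d x \<bullet> v)) (at x)"
      by (simp only:)
    have g: "\<bar>grad ?G x $ j\<bar> \<le> \<bar>a\<bar> * K" for j
      using component_le_norm_cart[of "grad ?G x" j] grad_mehler_bound[of a b x] by linarith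
    have "\<bar>?d x $ j\<bar> \<le> ?B" for j
    proof -
      note hess_ratio_bound[OF b, of a x j i]
      moreover have "\<bar>grad ?G x $ i\<bar> * \<bar>grad ?G x $ j\<bar> / (?G x)\<^sup>2 \<le> (\<bar>a\<bar> * K) * (\<bar>a\<bar> * K) / m\<^sup>2"
        by (intro frac_le mult_mono g power_mono mehler_lower) (use m_pos K_nonneg in auto)
      moreover have "\<bar>?d x $ j\<bar> \<le> \<bar>hess ?G x $ j $ i\<bar> / ?G x + \<bar>grad ?G x $ i\<bar> * \<bar>grad ?G x $ j\<bar> / (?G x)\<^sup>2"
        using abs_triangle_ineq4[of "hess ?G x $ j $ i / ?G x" "grad ?G x $ i * grad ?G x $ j / (?G x)\<^sup>2"]
          mehler_pos[of a b x] by (simp add: abs_mult)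
      ultimately show ?thesis by linarith
    qed
    hence "(\<Sum>j\<in>UNIV. \<bar>?d x $ j\<bar>) \<le> real CARD('n) * ?B"
      using sum_bounded_above[of UNIV "\<lambda>j. \<bar>?d x $ j\<bar>" ?B] by simp
    thus "norm (?d x) \<le> real CARD('n) * ?B"
      by (rule order_trans[OF norm_le_l1_cart])
  next
    show "?d \<in> borel_measurable borel"
      by (rule borel_measurable_vecI) (use b in simp)
  qed
  thus ?thesis by blast
qed

text \<open>The Laplacian of G divided by G is the Laplacian of ln G plus the squared gradient of ln
  G; the Laplacian of ln G is then integrated by parts.\<close>

lemma integral_laplacian_log:
  assumes b: "b \<noteq> 0" and c: "c \<noteq> 0"
  shows "(\<integral>y. (\<Sum>i\<in>UNIV. hess (mehler a b k) (x + c *\<^sub>R y) $ i $ i) / mehler a b k (x + c *\<^sub>R y) \<partial>std_gaussian)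
    = (1 / c) * (\<integral>y. ((1 / mehler a b k (x + c *\<^sub>R y)) *\<^sub>R grad (mehler a b k) (x + c *\<^sub>R y)) \<bullet> y \<partial>std_gaussian)
    + (\<integral>y. (norm ((1 / mehler a b k (x + c *\<^sub>R y)) *\<^sub>R grad (mehler a b k) (x + c *\<^sub>R y)))\<^sup>2 \<partial>std_gaussian)"
proof -
  let ?G = "mehler a b k"
  let ?u = "\<lambda>i x. grad ?G x $ i / ?G x"
  let ?X = "\<lambda>y. x + c *\<^sub>R y"
  interpret v: bounded_gradient "\<lambda>x. ln (?G x)" "\<lambda>x. (1 / ?G x) *\<^sub>R grad ?G x" "\<bar>a\<bar> * K / m"
    by (rule ln_mehler_bounded_gradient)
  have uy: "integrable std_gaussian (\<lambda>y. ?u i (?X y) * y $ i)" for i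
    using v.integrable_du_poly[OF real_polynomial_function_nth[of i], of x c i] by simp
  have u2: "integrable std_gaussian (\<lambda>y. (?u i (?X y))\<^sup>2)" for i
  proof (rule gauss.integrable_const_bound[where B="(\<bar>a\<bar> * K / m)\<^sup>2"])
    have "\<bar>?u i z\<bar> \<le> \<bar>\<bar>a\<bar> * K / m\<bar>" for z
    proof -
      have "\<bar>?u i z\<bar> \<le> \<bar>a\<bar> * K / m" using v.du_nth_bound[of z i] by simp
      thus ?thesis by linarith
    qed
    hence "(?u i z)\<^sup>2 \<le> (\<bar>a\<bar> * K / m)\<^sup>2" for z by (simp only: abs_le_square_iff)
    thus "AE y in std_gaussian. norm ((?u i (?X y))\<^sup>2) \<le> (\<bar>a\<bar> * K / m)\<^sup>2" by simp
  qed measurable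
  note hb = integrable_hess_ratio[OF b, of a x c]
  have ibp: "(\<integral>y. ?u i (?X y) * y $ i \<partial>std_gaussian)
      = c * ((\<integral>y. hess ?G (?X y) $ i $ i / ?G (?X y) \<partial>std_gaussian) - (\<integral>y. (?u i (?X y))\<^sup>2 \<partial>std_gaussian))" for i
  proof -
    obtain B where "bounded_gradient (\<lambda>x. ?u i x)
       (\<lambda>x. \<chi> j. hess ?G x $ j $ i / ?G x - grad ?G x $ i * grad ?G x $ j / (?G x)\<^sup>2) B"
      using log_gradient_bounded_gradient[OF b] by blast
    from bounded_gradient.gauss_ibp[OF this c, of x i]
    have "(\<integral>y. ?u i (?X y) * y $ i \<partial>std_gaussian)
        = c * (\<integral>y. hess ?G (?X y) $ i $ i / ?G (?X y) - (?u i (?X y))\<^sup>2 \<partial>std_gaussian)"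
      by (simp add: power2_eq_square)
    also have "(\<integral>y. hess ?G (?X y) $ i $ i / ?G (?X y) - (?u i (?X y))\<^sup>2 \<partial>std_gaussian)
       = (\<integral>y. hess ?G (?X y) $ i $ i / ?G (?X y) \<partial>std_gaussian) - (\<integral>y. (?u i (?X y))\<^sup>2 \<partial>std_gaussian)"
      by (rule Bochner_Integration.integral_diff[OF hb u2])
    finally show ?thesis .
  qed
  have 1: "(\<integral>y. (\<Sum>i\<in>UNIV. hess ?G (?X y) $ i $ i) / ?G (?X y) \<partial>std_gaussian)
      = (\<Sum>i\<in>UNIV. \<integral>y. hess ?G (?X y) $ i $ i / ?G (?X y) \<partial>std_gaussian)"
    unfolding sum_divide_distrib by (rule Bochner_Integration.integral_sum[OF hb])
  have 2: "(\<integral>y. ((1 / ?G (?X y)) *\<^sub>R grad ?G (?X y)) \<bullet> y \<partial>std_gaussian)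
      = (\<Sum>i\<in>UNIV. \<integral>y. ?u i (?X y) * y $ i \<partial>std_gaussian)"
    unfolding inner_vec using uy by (subst Bochner_Integration.integral_sum[symmetric]) auto
  have 3: "(\<integral>y. (norm ((1 / ?G (?X y)) *\<^sub>R grad ?G (?X y)))\<^sup>2 \<partial>std_gaussian)
      = (\<Sum>i\<in>UNIV. \<integral>y. (?u i (?X y))\<^sup>2 \<partial>std_gaussian)"
    unfolding norm_vec_sq using u2 by (subst Bochner_Integration.integral_sum[symmetric]) auto
  show ?thesis
    unfolding 1 2 3 ibp using c by (simp add: sum_distrib_left[symmetric] sum_subtractf)
qed

end

text \<open>The coefficient of the Gaussian variable at time \<open>r\<close>. For negative
  \<open>r\<close> the radicand is negative and the odd function \<open>sqrt\<close> gives a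
  negative value, so that \<open>noise\<close> is continuous and increasing on the whole
  line.\<close>

definition noise :: "real \<Rightarrow> real" where
  "noise r = sqrt (1 - exp (- 2 * r))"

lemma isCont_noise: "isCont noise r"
  unfolding noise_def[abs_def] by (intro continuous_intros)

lemma noise_pos: "r > 0 \<Longrightarrow> noise r > 0"
  by (simp add: noise_def)

lemma noise_le_1: "noise r \<le> 1"
  by (simp add: noise_def)

lemma noise_mono: "r \<le> s \<Longrightarrow> noise r \<le> noise s"
  by (simp add: noise_def)

lemma noise_sq: "r \<ge> 0 \<Longrightarrow> (noise r)\<^sup>2 = 1 - (exp (- r))\<^sup>2"
  by (simp add: noise_def exp_double[symmetric])

lemma exp_noise_sq: "r \<ge> 0 \<Longrightarrow> (exp (- r))\<^sup>2 + (noise r)\<^sup>2 = 1"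
  by (simp add: noise_sq)

lemma noise_has_derivative:
  assumes "r > 0"
  shows "(noise has_real_derivative (exp (- r))\<^sup>2 / noise r) (at r)"
proof -
  have p: "1 - exp (- 2 * r) > 0" using assms by simp
  have "((\<lambda>r. sqrt (1 - exp (- 2 * r))) has_real_derivative
      (2 * exp (- 2 * r)) * (inverse (sqrt (1 - exp (- 2 * r))) / 2)) (at r)"
    using p by (auto intro!: derivative_eq_intros)
  hence "(noise has_real_derivative (2 * exp (- 2 * r)) * (inverse (noise r) / 2)) (at r)"
    by (simp only: noise_def[symmetric])
  moreover have "exp (- 2 * r) = (exp (- r))\<^sup>2" using exp_double[of "- r"] by simp
  hence "(2 * exp (- 2 * r)) * (inverse (noise r) / 2) = (exp (- r))\<^sup>2 / noise r"
    by (simp only: divide_inverse) simp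
  ultimately show ?thesis by (simp only:)
qed

section \<open>The time derivative along the flow at a fixed pair of points\<close>

context heat_flow
begin

definition ou_path :: "real \<Rightarrow> real ^ 'n \<Rightarrow> real ^ 'n \<Rightarrow> real \<Rightarrow> real ^ 'n" where
  "ou_path t x y r = exp (- (t + r)) *\<^sub>R x + noise (t + r) *\<^sub>R y"

text \<open>Averaging \<open>ln (flow t x y r)\<close> over \<open>y\<close> gives the value at
  \<open>x\<close> of the semigroup at time \<open>t + r\<close> applied to the logarithm of the
  heat flow of \<open>k\<close> at time \<open>r\<close>. With \<open>x\<close> and \<open>y\<close>
  fixed, only a function of the real variable \<open>r\<close> has to be differentiated.\<close>

definition flow :: "real \<Rightarrow> real ^ 'n \<Rightarrow> real ^ 'n \<Rightarrow> real \<Rightarrow> real" where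
  "flow t x y r = mehler (exp (- r)) (noise r) k (ou_path t x y r)"

text \<open>The velocity of \<open>ou_path\<close> is combined with the drift
  \<open>- z \<bullet> grad\<close> of the Ornstein-Uhlenbeck generator at the path point
  \<open>z\<close>. Both contribute \<open>- exp (- (t + r)) x\<close>, hence the factor 2; the
  drift also contributes \<open>- noise (t + r) y\<close>. The last sum is the Laplacian of the
  generator.\<close>

definition flow_deriv :: "real \<Rightarrow> real ^ 'n \<Rightarrow> real ^ 'n \<Rightarrow> real \<Rightarrow> real" where
  "flow_deriv t x y r = grad (mehler (exp (- r)) (noise r) k) (ou_path t x y r) \<bullet>
      ((- 2 * exp (- (t + r))) *\<^sub>R x + ((exp (- (t + r)))\<^sup>2 / noise (t + r) - noise (t + r)) *\<^sub>R y)
    + (\<Sum>i\<in>UNIV. hess (mehler (exp (- r)) (noise r) k) (ou_path t x y r) $ i $ i)"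

text \<open>The chain rule is applied inside the Gaussian integral that defines the average, where
  only \<open>k\<close> is differentiated. The bound is uniform for \<open>r\<close> above
  \<open>r1\<close> and linear in the norms of the two points, so first moments make it
  integrable.\<close>

lemma
  assumes t: "t > 0" and r: "r > 0"
  shows flow_has_derivative: "(flow t x y has_real_derivative flow_deriv t x y r) (at r)"
    and flow_deriv_bound: "\<lbrakk>r1 > 0; r1 \<le> r\<rbrakk> \<Longrightarrow> \<bar>flow_deriv t x y r\<bar> \<le> K * (2 * norm x + (1 + 1 / noise r1) * norm y
          + (1 / noise r1) * (\<integral>z. norm z \<partial>(std_gaussian :: (real^'n) measure)))"
proof -
  define V where "V r = (- 2 * exp (- (t + r))) *\<^sub>R x
      + ((exp (- (t + r)))\<^sup>2 / noise (t + r) - noise (t + r)) *\<^sub>R y" for r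
  define W where "W r z = exp (- r) *\<^sub>R ou_path t x y r + noise r *\<^sub>R z" for r z
  define W' where "W' r z = exp (- r) *\<^sub>R V r + ((exp (- r))\<^sup>2 / noise r) *\<^sub>R z" for r z
  define f' where "f' r z = dk (W r z) \<bullet> W' r z" for r z
  have W_alt: "W r z = (exp (- r) * exp (- (t + r))) *\<^sub>R x + (exp (- r) * noise (t + r)) *\<^sub>R y + noise r *\<^sub>R z" for r z
    by (simp add: W_def ou_path_def scaleR_add_right)
  have W'_alt: "v *\<^sub>R W' r z = ((- 2 * (exp (- r) * exp (- (t + r)))) * v) *\<^sub>R x
      + ((exp (- r) * ((exp (- (t + r)))\<^sup>2 / noise (t + r) - noise (t + r))) * v) *\<^sub>R y
      + (((exp (- r))\<^sup>2 / noise r) * v) *\<^sub>R z" for r z v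
    by (simp add: W'_def V_def scaleR_add_right scaleR_diff_right mult_ac del: scaleR_left_diff_distrib)
  have dW: "((\<lambda>r. W r z) has_derivative (\<lambda>v. v *\<^sub>R W' s z)) (at s)" if s: "s > 0" for s z
  proof -
    have "((\<lambda>r. t + r) has_real_derivative 1) (at s)" by (auto intro!: derivative_eq_intros)
    hence n: "((\<lambda>r. noise (t + r)) has_real_derivative (exp (- (t + s)))\<^sup>2 / noise (t + s)) (at s)"
      using DERIV_chain2[OF noise_has_derivative, of "\<lambda>r. t + r" s 1 UNIV] s t by simp
    have 1: "((\<lambda>r. exp (- r) * exp (- (t + r))) has_real_derivative - 2 * (exp (- s) * exp (- (t + s)))) (at s)"
      by (auto intro!: derivative_eq_intros)
    have 2: "((\<lambda>r. exp (- r) * noise (t + r)) has_real_derivative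
        exp (- s) * ((exp (- (t + s)))\<^sup>2 / noise (t + s) - noise (t + s))) (at s)"
    proof -
      have "((\<lambda>r. exp (- r)) has_real_derivative - exp (- s)) (at s)"
        by (auto intro!: derivative_eq_intros)
      from DERIV_mult[OF this n] show ?thesis by (simp add: algebra_simps)
    qed
    show ?thesis
      unfolding W_alt W'_alt
      by (intro has_derivative_add has_derivative_scaleR_left
          1[unfolded has_field_derivative_def] 2[unfolded has_field_derivative_def]
          noise_has_derivative[OF s, unfolded has_field_derivative_def])
  qed
  have W'_bound: "norm (W' s z) \<le> 2 * norm x + (1 + 1 / noise r1) * norm y + (1 / noise r1) * norm z"
    if r1: "r1 > 0" "r1 \<le> s" for r1 s z
  proof -
    have s: "s > 0" using r1 by linarith
    have n1: "noise r1 > 0" "noise r1 \<le> noise s" "noise r1 \<le> noise (t + s)"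
      using r1 t by (auto intro!: noise_pos noise_mono)
    have e: "(exp (- s))\<^sup>2 \<le> 1" "(exp (- (t + s)))\<^sup>2 \<le> 1" "exp (- s) \<le> 1" "exp (- (t + s)) \<le> 1"
      using s t by (auto intro!: power_le_one)
    have q: "(exp (- s))\<^sup>2 / noise s \<le> 1 / noise r1" "(exp (- (t + s)))\<^sup>2 / noise (t + s) \<le> 1 / noise r1"
      using e n1 by (auto intro!: frac_le)
    have q0: "(exp (- (t + s)))\<^sup>2 / noise (t + s) \<ge> 0" "(exp (- s))\<^sup>2 / noise s \<ge> 0" using n1 by auto
    have "\<bar>(exp (- (t + s)))\<^sup>2 / noise (t + s) - noise (t + s)\<bar> \<le> 1 + 1 / noise r1"
      using q q0 noise_le_1[of "t + s"] n1 by linarith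
    hence "\<bar>(exp (- (t + s)))\<^sup>2 / noise (t + s) - noise (t + s)\<bar> * norm y \<le> (1 + 1 / noise r1) * norm y"
      by (rule mult_right_mono) simp
    moreover have "2 * exp (- (t + s)) * norm x \<le> 2 * norm x"
      using e(4) by (simp add: mult_left_le_one_le del: minus_add_distrib)
    moreover have "norm (V s) \<le> 2 * exp (- (t + s)) * norm x
        + \<bar>(exp (- (t + s)))\<^sup>2 / noise (t + s) - noise (t + s)\<bar> * norm y"
      unfolding V_def by (rule order_trans[OF norm_triangle_ineq]) (simp del: minus_add_distrib)
    ultimately have "norm (V s) \<le> 2 * norm x + (1 + 1 / noise r1) * norm y" by linarith
    moreover have "exp (- s) * norm (V s) \<le> 1 * norm (V s)" by (intro mult_right_mono e) simp
    moreover have "(exp (- s))\<^sup>2 / noise s * norm z \<le> 1 / noise r1 * norm z" by (intro mult_right_mono q) simp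
    moreover have "norm (W' s z) \<le> exp (- s) * norm (V s) + (exp (- s))\<^sup>2 / noise s * norm z"
      unfolding W'_def using norm_triangle_ineq[of "exp (- s) *\<^sub>R V s" "((exp (- s))\<^sup>2 / noise s) *\<^sub>R z"] n1 by simp
    ultimately show ?thesis by linarith
  qed
  have f'_bound: "\<bar>f' s z\<bar> \<le> K * (2 * norm x + (1 + 1 / noise r1) * norm y + (1 / noise r1) * norm z)"
    if r1: "r1 > 0" "r1 \<le> s" for r1 s z
    unfolding f'_def
    by (rule order_trans[OF Cauchy_Schwarz_ineq2 mult_mono[OF du_bound W'_bound[OF r1] K_nonneg norm_ge_zero]])
  have bound_int: "integrable (std_gaussian :: (real^'n) measure)
      (\<lambda>z. K * (2 * norm x + (1 + 1 / noise r1) * norm y + (1 / noise r1) * norm z))" for r1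
    by (intro integrable_mult_right Bochner_Integration.integrable_add integrable_norm_std_gaussian) auto
  have f'm: "f' r \<in> borel_measurable borel" for r
    unfolding f'_def[abs_def] W_def W'_def by measurable
  have f'_int: "(\<integral>z. f' r z \<partial>std_gaussian) = flow_deriv t x y r"
  proof -
    let ?D = "\<lambda>z. dk (exp (- r) *\<^sub>R ou_path t x y r + noise r *\<^sub>R z)"
    have nr: "noise r \<noteq> 0" using noise_pos[OF r] by simp
    have "f' r z = (exp (- r) *\<^sub>R ?D z) \<bullet> V r + (exp (- r))\<^sup>2 / noise r * (?D z \<bullet> z)" for z
      by (simp add: f'_def W'_def W_def inner_add_right)
    hence "(\<integral>z. f' r z \<partial>std_gaussian)
        = (\<integral>z. (exp (- r) *\<^sub>R ?D z) \<bullet> V r + (exp (- r))\<^sup>2 / noise r * (?D z \<bullet> z) \<partial>std_gaussian)"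
      by (simp only:)
    also have "\<dots> = (\<integral>z. (exp (- r) *\<^sub>R ?D z) \<bullet> V r \<partial>std_gaussian)
        + (exp (- r))\<^sup>2 / noise r * (\<integral>z. ?D z \<bullet> z \<partial>std_gaussian)"
      by (subst Bochner_Integration.integral_add)
         (auto intro!: integrable_inner_left integrable_scaleR_right integrable_du integrable_du_inner
            simp del: inner_scaleR_left)
    also have "(\<integral>z. (exp (- r) *\<^sub>R ?D z) \<bullet> V r \<partial>std_gaussian)
        = grad (mehler (exp (- r)) (noise r) k) (ou_path t x y r) \<bullet> V r"
      unfolding grad_mehler by (intro integral_inner_left integrable_scaleR_right integrable_du)
    \<comment> \<open>The derivative of \<open>noise\<close>, which multiplies the Gaussian
      variable, produces the Laplacian through the kernel form of the Hessian.\<close>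
    also have "(exp (- r))\<^sup>2 / noise r * (\<integral>z. ?D z \<bullet> z \<partial>std_gaussian)
        = (\<Sum>i\<in>UNIV. hess (mehler (exp (- r)) (noise r) k) (ou_path t x y r) $ i $ i)"
      unfolding inner_vec hess_mehler[OF nr]
      by (subst Bochner_Integration.integral_sum)
         (auto intro!: integrable_du_poly real_polynomial_function_nth simp: sum_distrib_left)
    finally show ?thesis by (simp add: flow_deriv_def V_def)
  qed
  have "((\<lambda>r. \<integral>z. k (W r z) \<partial>std_gaussian) has_derivative (\<lambda>v. (\<integral>z. f' r z \<partial>std_gaussian) \<bullet> v)) (at r)"
  \<comment> \<open>The radius keeps times above \<open>r/2\<close>, because the derivative of
    \<open>noise\<close> blows up at 0.\<close>
  proof (rule has_derivative_integral_param[where e="r/2"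
        and w="\<lambda>z. K * (2 * norm x + (1 + 1 / noise (r/2)) * norm y + (1 / noise (r/2)) * norm z)"])
    fix s z assume s: "s \<in> ball r (r/2)"
    hence s2: "r/2 \<le> s" "s > 0" using r by (auto simp: dist_real_def abs_if split: if_splits)
    show "((\<lambda>r. k (W r z)) has_derivative (\<lambda>v. f' s z \<bullet> v)) (at s)"
      using has_derivative_compose[OF dW[OF s2(2)] der] by (simp add: f'_def mult.commute)
    show "norm (f' s z) \<le> K * (2 * norm x + (1 + 1 / noise (r/2)) * norm y + (1 / noise (r/2)) * norm z)"
      using f'_bound[OF _ s2(1)] r by simp
  next
    show "integrable std_gaussian (\<lambda>z. k (W s z))" for s
      unfolding W_def by (rule integrable_gauss)
    show "f' r \<in> borel_measurable std_gaussian" using f'm by simp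
  qed (use r bound_int in auto)
  moreover have "(\<lambda>r. \<integral>z. k (W r z) \<partial>std_gaussian) = flow t x y"
    by (rule ext) (simp add: flow_def mehler_def W_def)
  ultimately show "(flow t x y has_real_derivative flow_deriv t x y r) (at r)"
    unfolding f'_int has_field_derivative_def by simp
  show "\<bar>flow_deriv t x y r\<bar> \<le> K * (2 * norm x + (1 + 1 / noise r1) * norm y
          + (1 / noise r1) * (\<integral>z. norm z \<partial>(std_gaussian :: (real^'n) measure)))"
    if r1: "r1 > 0" "r1 \<le> r"
  proof -
    have "\<bar>\<integral>z. f' r z \<partial>std_gaussian\<bar> \<le> (\<integral>z. norm (f' r z) \<partial>std_gaussian)"
      using integral_norm_bound[of std_gaussian "f' r"] by simp
    also have "\<dots> \<le> (\<integral>z. K * (2 * norm x + (1 + 1 / noise r1) * norm y + (1 / noise r1) * norm z)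
        \<partial>(std_gaussian :: (real^'n) measure))"
    proof (rule integral_mono[OF _ bound_int])
      show "integrable std_gaussian (\<lambda>z. norm (f' r z))"
      proof (rule Bochner_Integration.integrable_bound[OF bound_int[of r1]])
        show "(\<lambda>z. norm (f' r z)) \<in> borel_measurable std_gaussian" using f'm by simp
        have "norm (norm (f' r z)) \<le> norm (K * (2 * norm x + (1 + 1 / noise r1) * norm y + (1 / noise r1) * norm z))" for z
          using f'_bound[OF r1, of z] unfolding real_norm_def by linarith
        thus "AE z in std_gaussian. norm (norm (f' r z))
          \<le> norm (K * (2 * norm x + (1 + 1 / noise r1) * norm y + (1 / noise r1) * norm z))" by (rule AE_I2)
      qed
    qed (use f'_bound[OF r1] in simp)
    also have "\<dots> = K * (2 * norm x + (1 + 1 / noise r1) * norm y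
          + (1 / noise r1) * (\<integral>z. norm z \<partial>(std_gaussian :: (real^'n) measure)))"
    proof -
      have "(\<integral>z. c + d * norm z \<partial>(std_gaussian :: (real^'n) measure))
          = c + d * (\<integral>z. norm z \<partial>(std_gaussian :: (real^'n) measure))" for c d
        by (subst Bochner_Integration.integral_add)
           (auto simp: integrable_norm_std_gaussian)
      from this[of "2 * norm x + (1 + 1 / noise r1) * norm y" "1 / noise r1"] show ?thesis
        by (simp only: integral_mult_right_zero)
    qed
    finally show ?thesis unfolding f'_int .
  qed
qed

lemma flow_bounds: "m \<le> flow t x y r" "flow t x y r \<le> M" "flow t x y r > 0"
  unfolding flow_def by (rule mehler_lower mehler_upper mehler_pos)+

lemma ou_path_measurable [measurable]:
  "(\<lambda>p. ou_path t (fst p) (snd p) r) \<in> borel_measurable (borel \<Otimes>\<^sub>M borel)"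
  unfolding ou_path_def by measurable

lemma flow_measurable [measurable]:
  "(\<lambda>p. flow t (fst p) (snd p) r) \<in> borel_measurable (borel \<Otimes>\<^sub>M borel)"
  unfolding flow_def by measurable

lemma flow_deriv_measurable:
  assumes r: "r > 0"
  shows "(\<lambda>p. flow_deriv t (fst p) (snd p) r) \<in> borel_measurable (borel \<Otimes>\<^sub>M borel)"
proof -
  have nr: "noise r \<noteq> 0" using noise_pos[OF r] by simp
  note [measurable] = borel_measurable_hess_mehler[OF nr]
  show ?thesis unfolding flow_deriv_def by measurable
qed

end

text \<open>The antiderivative of z / (2 (1 - z)) that vanishes at 0. With z = exp (- 2 s), its
  value at exp (- 2 t) is the integral of the rate exp (- 4 s) / (1 - exp (- 2 s)) over all times s
  after t.\<close>

definition decay_bound :: "real \<Rightarrow> real" where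
  "decay_bound y = (- y - ln (1 - y)) / 2"

lemma decay_bound_nonneg: "y < 1 \<Longrightarrow> decay_bound y \<ge> 0"
  using ln_le_minus_one[of "1 - y"] by (simp add: decay_bound_def)

lemma decay_bound_has_derivative:
  assumes s: "t + r > 0"
  shows "((\<lambda>r. decay_bound (exp (- 2 * (t + r)))) has_real_derivative
      - ((exp (- (t + r)))\<^sup>2 / noise (t + r))\<^sup>2) (at r)"
proof -
  let ?y = "exp (- 2 * (t + r))"
  have y: "1 - ?y > 0" using s by simp
  have sq: "(exp (- (t + r)))\<^sup>2 = ?y" using exp_double[of "- (t + r)"] by (simp add: algebra_simps)
  have n: "(noise (t + r))\<^sup>2 = 1 - ?y" using noise_sq[of "t + r"] s by (simp only: sq)
  have d: "(decay_bound has_real_derivative z / (2 * (1 - z))) (at z)" if "z < 1" for z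
  proof -
    have "((\<lambda>z. (- z - ln (1 - z)) / 2) has_real_derivative (- 1 - (- 1) / (1 - z)) / 2) (at z)"
      using that by (auto intro!: derivative_eq_intros)
    moreover have "(- 1 - (- 1) / (1 - z)) / 2 = z / (2 * (1 - z))"
      using that by (simp add: field_simps)
    ultimately show ?thesis by (simp only: decay_bound_def[abs_def])
  qed
  have e: "((\<lambda>r. exp (- 2 * (t + r))) has_real_derivative ?y * (- 2)) (at r)"
    by (rule DERIV_fun_exp) (auto intro!: derivative_eq_intros)
  have "((\<lambda>r. decay_bound (exp (- 2 * (t + r)))) has_real_derivative ?y / (2 * (1 - ?y)) * (?y * (- 2))) (at r)"
    by (rule DERIV_chain2[OF d e]) (use y in simp)
  moreover have "z / (2 * w) * (z * (- 2)) = - (z\<^sup>2 / w)" for z w :: real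
    by (simp add: power2_eq_square)
  note this[of ?y "1 - ?y"]
  ultimately show ?thesis unfolding power_divide sq n by (simp only:)
qed

context heat_flow
begin

text \<open>The Laplacian in \<open>flow_deriv\<close> is traded for first-order terms by
  \<open>integral_laplacian_log\<close>; what results is the expression bounded from below in
  \<open>stein_bound\<close>.\<close>

lemma integral_flow_deriv:
  assumes s: "t + r > 0" and r: "r > 0"
  defines "a \<equiv> exp (- (t + r))" and "b \<equiv> noise (t + r)"
  defines "du \<equiv> \<lambda>z. (1 / mehler (exp (- r)) (noise r) k z) *\<^sub>R grad (mehler (exp (- r)) (noise r) k) z"
  shows "(\<integral>y. flow_deriv t x y r / flow t x y r \<partial>std_gaussian)
      = (\<integral>y. 2 * ((- a *\<^sub>R x + (a\<^sup>2 / b) *\<^sub>R y) \<bullet> du (a *\<^sub>R x + b *\<^sub>R y))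
              + (norm (du (a *\<^sub>R x + b *\<^sub>R y)))\<^sup>2 \<partial>std_gaussian)"
proof -
  let ?G = "mehler (exp (- r)) (noise r) k"
  let ?X = "\<lambda>y. a *\<^sub>R x + b *\<^sub>R y"
  let ?c = "a\<^sup>2 / b - b"
  have b0: "b \<noteq> 0" unfolding b_def using noise_pos[OF s] by simp
  have nr: "noise r \<noteq> 0" using noise_pos[OF r] by simp
  have ab: "a\<^sup>2 + b\<^sup>2 = 1" unfolding a_def b_def using exp_noise_sq[of "t + r"] s by simp
  interpret v: bounded_gradient "\<lambda>x. ln (?G x)" du "\<bar>exp (- r)\<bar> * K / m"
    unfolding du_def by (rule ln_mehler_bounded_gradient)
  define A where "A y = du (?X y) \<bullet> x" for y
  define B where "B y = du (?X y) \<bullet> y" for y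
  define C where "C y = (norm (du (?X y)))\<^sup>2" for y
  define H where "H y = (\<Sum>i\<in>UNIV. hess ?G (?X y) $ i $ i) / ?G (?X y)" for y
  have int: "integrable std_gaussian A" "integrable std_gaussian B" "integrable std_gaussian C"
    unfolding A_def[abs_def] B_def[abs_def] C_def[abs_def]
    by (intro integrable_inner_left v.integrable_du v.integrable_du_inner v.integrable_du_sq)+
  have hb: "integrable std_gaussian H"
    unfolding H_def sum_divide_distrib by (intro Bochner_Integration.integrable_sum integrable_hess_ratio nr)
  have HBC: "integral\<^sup>L std_gaussian H = (1 / b) * integral\<^sup>L std_gaussian B + integral\<^sup>L std_gaussian C"
    using integral_laplacian_log[OF nr b0, of "exp (- r)" "a *\<^sub>R x"]
    by (simp only: H_def[abs_def] B_def[abs_def] C_def[abs_def] du_def)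
  have "flow_deriv t x y r / flow t x y r = (- 2 * a * A y + ?c * B y) + H y" for y
  proof -
    have p: "ou_path t x y r = ?X y" by (simp add: ou_path_def a_def b_def)
    have "flow_deriv t x y r = grad ?G (?X y) \<bullet> ((- 2 * a) *\<^sub>R x + ?c *\<^sub>R y) + (\<Sum>i\<in>UNIV. hess ?G (?X y) $ i $ i)"
      by (simp only: flow_deriv_def p) (simp only: a_def b_def)
    moreover have "flow t x y r = ?G (?X y)" by (simp only: flow_def p)
    ultimately show ?thesis
      by (simp add: A_def B_def H_def du_def inner_add_right inner_diff_right add_divide_distrib diff_divide_distrib)
  qed
  hence "(\<integral>y. flow_deriv t x y r / flow t x y r \<partial>std_gaussian)
      = (\<integral>y. (- 2 * a * A y + ?c * B y) + H y \<partial>std_gaussian)" by (simp only:)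
  also have "\<dots> = - 2 * a * integral\<^sup>L std_gaussian A + ?c * integral\<^sup>L std_gaussian B + integral\<^sup>L std_gaussian H"
    using int hb by (simp del: mult_minus_left)
  also have "\<dots> = - 2 * a * integral\<^sup>L std_gaussian A + (?c + 1 / b) * integral\<^sup>L std_gaussian B + integral\<^sup>L std_gaussian C"
    unfolding HBC by (simp add: algebra_simps)
  \<comment> \<open>By \<open>ab\<close> the difference \<open>1 / b - b\<close> is another
    \<open>a\<^sup>2 / b\<close>, so the coefficient becomes twice the one in the Hessian of the
    average.\<close>
  also have "?c + 1 / b = 2 * (a\<^sup>2 / b)"
  proof -
    have "?c + 1 / b = (a\<^sup>2 - b\<^sup>2 + (a\<^sup>2 + b\<^sup>2)) / b"
      unfolding ab using b0 by (simp add: field_simps power2_eq_square)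
    thus ?thesis by simp
  qed
  also have "- 2 * a * integral\<^sup>L std_gaussian A + 2 * (a\<^sup>2 / b) * integral\<^sup>L std_gaussian B + integral\<^sup>L std_gaussian C
     = (\<integral>y. (- 2 * a * A y + 2 * (a\<^sup>2 / b) * B y) + C y \<partial>std_gaussian)"
    using int by (simp del: mult_minus_left)
  also have "(\<lambda>y. (- 2 * a * A y + 2 * (a\<^sup>2 / b) * B y) + C y)
     = (\<lambda>y. 2 * ((- a *\<^sub>R x + (a\<^sup>2 / b) *\<^sub>R y) \<bullet> du (?X y)) + (norm (du (?X y)))\<^sup>2)"
    by (rule ext) (simp add: A_def B_def C_def inner_diff_left inner_commute[of "du _"])
  finally show ?thesis .
qed

lemma flow_tendsto:
  assumes "\<And>z. (\<lambda>n. exp (- R n) *\<^sub>R ou_path t x y (R n) + noise (R n) *\<^sub>R z) \<longlonglongrightarrow> g z"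
    and [measurable]: "g \<in> borel_measurable borel"
  shows "(\<lambda>n. flow t x y (R n)) \<longlonglongrightarrow> (\<integral>z. k (g z) \<partial>std_gaussian)"
  unfolding flow_def mehler_def
proof (rule integral_dominated_convergence[where w="\<lambda>_. M"])
  show "AE z in std_gaussian. (\<lambda>n. k (exp (- R n) *\<^sub>R ou_path t x y (R n) + noise (R n) *\<^sub>R z)) \<longlonglongrightarrow> k (g z)"
    using assms(1) cont[of UNIV] by (auto intro!: AE_I2 continuous_on_tendsto_compose[of UNIV k])
  show "AE z in std_gaussian. norm (k (exp (- R n) *\<^sub>R ou_path t x y (R n) + noise (R n) *\<^sub>R z)) \<le> M" for n
    using lower upper m_pos by (auto intro!: AE_I2 simp: abs_of_nonneg order_trans[OF less_imp_le[OF m_pos]])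
qed (auto simp: gauss.integrable_const)

lemma flow_tendsto_0:
  assumes R: "R \<longlonglongrightarrow> 0"
  shows "(\<lambda>n. flow t x y (R n)) \<longlonglongrightarrow> k (exp (- t) *\<^sub>R x + noise t *\<^sub>R y)"
proof -
  have "(\<lambda>n. exp (- R n) *\<^sub>R (exp (- (t + R n)) *\<^sub>R x + noise (t + R n) *\<^sub>R y) + noise (R n) *\<^sub>R z)
     \<longlonglongrightarrow> exp (- 0) *\<^sub>R (exp (- (t + 0)) *\<^sub>R x + noise (t + 0) *\<^sub>R y) + noise 0 *\<^sub>R z" for z :: "real^'n"
    by (intro tendsto_intros isCont_tendsto_compose[OF isCont_noise] R)
  hence "(\<lambda>n. exp (- R n) *\<^sub>R ou_path t x y (R n) + noise (R n) *\<^sub>R z) \<longlonglongrightarrow> exp (- t) *\<^sub>R x + noise t *\<^sub>R y" for z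
    by (simp add: ou_path_def noise_def)
  from flow_tendsto[OF this] show ?thesis
    by simp
qed

text \<open>The starting point is forgotten: the coefficient of the path tends to 0 and the added
  noise to a full standard Gaussian.\<close>

lemma flow_tendsto_inf: "(\<lambda>n. flow t x y (real n)) \<longlonglongrightarrow> (\<integral>z. k z \<partial>std_gaussian)"
proof (rule flow_tendsto)
  fix z
  have e0: "(\<lambda>n. exp (- real n)) \<longlonglongrightarrow> 0"
    by (rule filterlim_compose[OF exp_at_bot]) (simp add: filterlim_uminus_at_bot filterlim_real_sequentially)
  have e1: "(\<lambda>n. exp (- 2 * (s + real n))) \<longlonglongrightarrow> 0" for s
  proof -
    have "(\<lambda>n. exp (- 2 * s) * (exp (- real n) * exp (- real n))) \<longlonglongrightarrow> exp (- 2 * s) * (0 * 0)"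
      by (intro tendsto_intros e0)
    thus ?thesis by (simp add: exp_add[symmetric] algebra_simps)
  qed
  have n1: "(\<lambda>n. noise (s + real n)) \<longlonglongrightarrow> 1" for s
  proof -
    have "(\<lambda>n. sqrt (1 - exp (- 2 * (s + real n)))) \<longlonglongrightarrow> sqrt (1 - 0)"
      by (intro tendsto_intros e1)
    thus ?thesis by (simp add: noise_def)
  qed
  have "(\<lambda>n. exp (- real n) *\<^sub>R ((exp (- t) * exp (- real n)) *\<^sub>R x + noise (t + real n) *\<^sub>R y) + noise (0 + real n) *\<^sub>R z)
      \<longlonglongrightarrow> 0 *\<^sub>R ((exp (- t) * 0) *\<^sub>R x + 1 *\<^sub>R y) + 1 *\<^sub>R z"
    by (intro tendsto_intros e0 n1)
  thus "(\<lambda>n. exp (- real n) *\<^sub>R ou_path t x y (real n) + noise (real n) *\<^sub>R z) \<longlonglongrightarrow> z"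
    by (simp add: ou_path_def exp_add[symmetric])
qed simp

end

lemma integrable_pair_const_fst:
  fixes f :: "'a \<Rightarrow> real"
  assumes "prob_space N" "prob_space M" and f: "integrable N f"
  shows "integrable (N \<Otimes>\<^sub>M M) (\<lambda>p. f (fst p))"
proof -
  interpret N: prob_space N by fact
  interpret M: prob_space M by fact
  interpret P: pair_prob_space N M ..
  have [measurable]: "f \<in> borel_measurable N" using f by auto
  show ?thesis
    by (rule P.Fubini_integrable) (use f in \<open>auto simp: M.prob_space\<close>)
qed

lemma integrable_pair_const_snd:
  fixes f :: "'a \<Rightarrow> real"
  assumes "prob_space N" "prob_space M" and f: "integrable M f"
  shows "integrable (N \<Otimes>\<^sub>M M) (\<lambda>p. f (snd p))"
proof -
  interpret N: prob_space N by fact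
  interpret M: prob_space M by fact
  interpret P: pair_prob_space N M ..
  have [measurable]: "f \<in> borel_measurable M" using f by auto
  show ?thesis
    by (rule P.Fubini_integrable) (use f in auto)
qed

context heat_flow
begin

text \<open>For the heat flow \<open>\<phi>\<^sub>r = ln (P\<^sub>r k)\<close> the derivative of \<open>\<integral> P\<^bsub>t+r\<^esub> \<phi>\<^sub>r d\<nu>\<close> is
  \<open>2 T + A\<^sup>2\<close>, where \<open>A\<^sup>2\<close> is the mean of the squared gradient and \<open>\<bar>T\<bar> \<le> c S A\<close> by the
  Stein identity; so it is at least \<open>- c\<^sup>2 S\<^sup>2\<close>.\<close>

lemma integral_ln_mehler_le:
  fixes \<nu> :: "(real^'n) measure" and \<tau> :: "real^'n \<Rightarrow> real^'n^'n"
  assumes prob: "prob_space \<nu>" and sets [measurable_cong]: "sets \<nu> = sets borel"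
    and mom: "\<And>j. integrable \<nu> (\<lambda>x. x $ j)"
    and stein: "stein_kernel \<nu> \<tau>" and fin: "finite_stein_discrepancy \<nu> \<tau>"
    and t: "t > 0"
  shows "(\<integral>x. mehler (exp (- t)) (noise t) (\<lambda>z. ln (k z)) x \<partial>\<nu>)
      \<le> ln (\<integral>z. k z \<partial>std_gaussian)
        + (\<integral>x. (norm (\<tau> x - mat 1))\<^sup>2 \<partial>\<nu>) * decay_bound (exp (- 2 * t))"
proof -
  interpret nu: prob_space \<nu> by fact
  let ?g = "std_gaussian :: (real^'n) measure"
  let ?P = "\<nu> \<Otimes>\<^sub>M ?g"
  let ?S = "\<integral>x. (norm (\<tau> x - mat 1))\<^sup>2 \<partial>\<nu>"
  interpret P: pair_prob_space \<nu> ?g ..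
  have S0: "?S \<ge> 0" by simp
  have setsP: "sets ?P = sets (borel \<Otimes>\<^sub>M borel)"
    by (intro sets_pair_measure_cong sets sets_std_gaussian)
  have mP: "f \<in> borel_measurable ?P" if "f \<in> borel_measurable (borel \<Otimes>\<^sub>M borel)" for f :: "_ \<Rightarrow> real"
    using that by (simp add: measurable_cong_sets[OF setsP refl])
  define L where "L r = (\<integral>p. ln (flow t (fst p) (snd p) r) \<partial>?P)" for r
  define f' where "f' r p = flow_deriv t (fst p) (snd p) r / flow t (fst p) (snd p) r" for r p
  have lnb: "\<bar>ln (flow t x y r)\<bar> \<le> \<bar>ln m\<bar> + \<bar>ln M\<bar>" for x y r
    unfolding flow_def by (rule ln_mehler_bound)
  have ln_int: "integrable ?P (\<lambda>p. ln (flow t (fst p) (snd p) r))" for r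
    by (rule P.integrable_const_bound[where B="\<bar>ln m\<bar> + \<bar>ln M\<bar>"]) (auto intro!: AE_I2 lnb mP)
  have nnorm: "integrable \<nu> norm"
    using integrable_norm[OF integrable_vecI[of \<nu> "\<lambda>x. x"]] mom by auto
  \<comment> \<open>A majorant linear in the norms of both points, so its integrability rests on the
    first moments of \<open>\<nu>\<close> and of the Gaussian.\<close>
  define w where "w r p = K * (2 * norm (fst p) + (1 + 1 / noise r) * norm (snd p)
          + (1 / noise r) * (\<integral>z. norm z \<partial>?g)) / m" for r and p :: "(real^'n) \<times> (real^'n)"
  have w_int: "integrable ?P (w r)" for r
    unfolding w_def
    by (intro integrable_divide integrable_mult_right Bochner_Integration.integrable_add
        integrable_pair_const_fst integrable_pair_const_snd prob prob_space_std_gaussian nnorm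
        integrable_norm_std_gaussian P.integrable_const)
  have f'_bound: "norm (f' r p) \<le> w r1 p" if "r1 > 0" "r1 \<le> r" for r r1 p
  proof -
    have "\<bar>flow_deriv t (fst p) (snd p) r\<bar> / flow t (fst p) (snd p) r \<le> w r1 p"
      unfolding w_def
    proof (rule frac_le[OF _ flow_deriv_bound[OF t _ that] m_pos flow_bounds(1)])
      show "0 \<le> K * (2 * norm (fst p) + (1 + 1 / noise r1) * norm (snd p) + 1 / noise r1 * (\<integral>z. norm z \<partial>?g))"
        using noise_pos[OF that(1)] K_nonneg by (intro mult_nonneg_nonneg add_nonneg_nonneg) auto
    qed (use that in simp)
    thus ?thesis using flow_bounds(3) by (simp add: f'_def abs_of_pos)
  qed
  have f'_meas: "f' r \<in> borel_measurable ?P" if "r > 0" for r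
  proof -
    note [measurable] = flow_deriv_measurable[OF that]
    show ?thesis unfolding f'_def by (rule mP) measurable
  qed
  have f'_int: "integrable ?P (f' r)" if "r > 0" for r
    by (rule Bochner_Integration.integrable_bound[OF w_int[of r] f'_meas[OF that]])
       (use f'_bound[OF that order_refl] in \<open>auto intro!: AE_I2 order_trans[OF _ abs_ge_self]\<close>)
  have L_der: "(L has_real_derivative (\<integral>p. f' r p \<partial>?P)) (at r)" if r: "r > 0" for r
  proof -
    have "(L has_derivative (\<lambda>v. (\<integral>p. f' r p \<partial>?P) \<bullet> v)) (at r)"
      unfolding L_def[abs_def]
    proof (rule has_derivative_integral_param[where e="r/2" and w="w (r/2)"])
      fix s p assume s: "s \<in> ball r (r/2)"
      hence s2: "r/2 \<le> s" "s > 0" using r by (auto simp: dist_real_def abs_if split: if_splits)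
      have "((\<lambda>r. ln (flow t (fst p) (snd p) r)) has_real_derivative
          1 / flow t (fst p) (snd p) s * flow_deriv t (fst p) (snd p) s) (at s)"
        by (rule DERIV_chain2[OF DERIV_ln_divide[OF flow_bounds(3)] flow_has_derivative[OF t s2(2)]])
      moreover have "(*) (1 / flow t (fst p) (snd p) s * flow_deriv t (fst p) (snd p) s) = (\<lambda>v. f' s p \<bullet> v)"
        by (rule ext) (simp add: f'_def)
      ultimately show "((\<lambda>r. ln (flow t (fst p) (snd p) r)) has_derivative (\<lambda>v. f' s p \<bullet> v)) (at s)"
        by (simp only: has_field_derivative_def)
      show "norm (f' s p) \<le> w (r/2) p" using f'_bound[OF _ s2(1)] r by simp
    qed (use r ln_int w_int f'_meas in auto)
    thus ?thesis by (simp add: has_field_derivative_def)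
  qed
  have D_lower: "- ((exp (- (t + r)))\<^sup>2 / noise (t + r))\<^sup>2 * ?S \<le> (\<integral>p. f' r p \<partial>?P)" if r: "r > 0" for r
  proof -
    have s: "t + r > 0" using r t by simp
    let ?G = "mehler (exp (- r)) (noise r) k"
    interpret v: bounded_gradient "\<lambda>x. ln (?G x)" "\<lambda>z. (1 / ?G z) *\<^sub>R grad ?G z" "\<bar>exp (- r)\<bar> * K / m"
      by (rule ln_mehler_bounded_gradient)
    have "(\<integral>p. f' r p \<partial>?P) = (\<integral>x. \<integral>y. flow_deriv t x y r / flow t x y r \<partial>?g \<partial>\<nu>)"
      using P.integral_fst'[OF f'_int[OF r]] by (simp add: f'_def[abs_def])
    thus ?thesis
      unfolding integral_flow_deriv[OF s r]
      using v.stein_bound[OF prob sets stein fin, of "exp (- (t + r))" "noise (t + r)"] noise_pos[OF s]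
      by simp
  qed
  \<comment> \<open>The subtracted term offsets exactly the largest rate at which
    \<open>D_lower\<close> lets \<open>L\<close> decrease, so \<open>\<Psi>\<close> is
    nondecreasing.\<close>
  define \<Psi> where "\<Psi> r = L r - ?S * decay_bound (exp (- 2 * (t + r)))" for r
  have \<Psi>_mono: "\<Psi> r \<le> \<Psi> s" if rs: "0 < r" "r \<le> s" for r s
  proof (rule DERIV_nonneg_imp_nondecreasing[OF rs(2)])
    fix q assume q: "r \<le> q" "q \<le> s"
    have q0: "q > 0" "t + q > 0" using q rs t by auto
    have "(\<Psi> has_real_derivative (\<integral>p. f' q p \<partial>?P) - ?S * (- ((exp (- (t + q)))\<^sup>2 / noise (t + q))\<^sup>2)) (at q)"
      unfolding \<Psi>_def by (intro DERIV_diff DERIV_cmult L_der decay_bound_has_derivative q0)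
    moreover have "0 \<le> (\<integral>p. f' q p \<partial>?P) - ?S * (- ((exp (- (t + q)))\<^sup>2 / noise (t + q))\<^sup>2)"
      using D_lower[OF q0(1)] by (simp add: mult.commute)
    ultimately show "\<exists>y. (\<Psi> has_real_derivative y) (at q) \<and> 0 \<le> y" by blast
  qed
  \<comment> \<open>The sign of \<open>decay_bound\<close> is enough here: at infinity the limit of
    \<open>L\<close> alone bounds \<open>\<Psi>\<close>.\<close>
  have \<Psi>_le_L: "\<Psi> r \<le> L r" if "r > 0" for r
    using decay_bound_nonneg[of "exp (- 2 * (t + r))"] S0 t that by (simp add: \<Psi>_def)
  have L_lim: "(\<lambda>n. L (R n)) \<longlonglongrightarrow> (\<integral>p. ln (f p) \<partial>?P)"
    if "\<And>x y. (\<lambda>n. flow t x y (R n)) \<longlonglongrightarrow> f (x, y)" "\<And>p. f p > 0" and f: "f \<in> borel_measurable (borel \<Otimes>\<^sub>M borel)" for R f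
    unfolding L_def
  proof (rule integral_dominated_convergence[where w="\<lambda>_. \<bar>ln m\<bar> + \<bar>ln M\<bar>"])
    note [measurable] = f
    show "(\<lambda>p. ln (f p)) \<in> borel_measurable ?P" by (rule mP) measurable
    show "(\<lambda>p. ln (flow t (fst p) (snd p) (R n))) \<in> borel_measurable ?P" for n by (rule mP) measurable
    show "AE p in ?P. (\<lambda>n. ln (flow t (fst p) (snd p) (R n))) \<longlonglongrightarrow> ln (f p)"
    proof (rule AE_I2)
      fix p
      have "f p \<noteq> 0" using that(2)[of p] by simp
      thus "(\<lambda>n. ln (flow t (fst p) (snd p) (R n))) \<longlonglongrightarrow> ln (f p)"
        using that(1)[of "fst p" "snd p"] by (intro tendsto_ln) auto
    qed
  qed (auto intro!: AE_I2 lnb P.integrable_const)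
  have Linf: "(\<lambda>n. L (real n)) \<longlonglongrightarrow> ln (\<integral>z. k z \<partial>?g)"
  proof -
    have "0 < (\<integral>z. k z \<partial>?g)"
      using mehler_pos[of 0 1 0] by (simp add: mehler_def)
    hence "(\<lambda>n. L (real n)) \<longlonglongrightarrow> (\<integral>p. ln (\<integral>z. k z \<partial>?g) \<partial>?P)"
      by (intro L_lim[of real "\<lambda>_. \<integral>z. k z \<partial>?g"] flow_tendsto_inf) auto
    thus ?thesis by (simp add: P.prob_space)
  qed
  have \<Psi>_le: "\<Psi> r \<le> ln (\<integral>z. k z \<partial>?g)" if r: "r > 0" for r
  proof (rule LIMSEQ_le_const[OF Linf])
    obtain N :: nat where N: "r \<le> real N" using real_arch_simple by blast
    have "\<Psi> r \<le> L (real n)" if "n \<ge> N" for n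
    proof -
      have "r \<le> real n" using N that by linarith
      thus ?thesis using \<Psi>_mono[OF r, of "real n"] \<Psi>_le_L[of "real n"] r by linarith
    qed
    thus "\<exists>N. \<forall>n\<ge>N. \<Psi> r \<le> L (real n)" by blast
  qed
  let ?X = "\<lambda>x y. exp (- t) *\<^sub>R x + noise t *\<^sub>R y"
  have kpos: "k z > 0" for z using lower[of z] m_pos by linarith
  \<comment> \<open>The monotonicity is available for positive \<open>r\<close>, so the value at 0
    is reached along a sequence.\<close>
  have R0: "(\<lambda>n. 1 / real (Suc n)) \<longlonglongrightarrow> 0"
    using LIMSEQ_inverse_real_of_nat by (simp add: divide_inverse)
  have "(\<lambda>n. L (1 / real (Suc n))) \<longlonglongrightarrow> (\<integral>p. ln (k (?X (fst p) (snd p))) \<partial>?P)"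
    by (rule L_lim[of "\<lambda>n. 1 / real (Suc n)" "\<lambda>p. k (?X (fst p) (snd p))"]) (use flow_tendsto_0[OF R0] kpos in simp_all)
  moreover have "(\<lambda>n. decay_bound (exp (- 2 * (t + 1 / real (Suc n))))) \<longlonglongrightarrow> decay_bound (exp (- 2 * (t + 0)))"
    using t unfolding decay_bound_def by (intro tendsto_intros R0) auto
  ultimately have "(\<lambda>n. \<Psi> (1 / real (Suc n))) \<longlonglongrightarrow> (\<integral>p. ln (k (?X (fst p) (snd p))) \<partial>?P)
      - ?S * decay_bound (exp (- 2 * (t + 0)))"
    unfolding \<Psi>_def by (intro tendsto_intros)
  hence "(\<integral>p. ln (k (?X (fst p) (snd p))) \<partial>?P) - ?S * decay_bound (exp (- 2 * (t + 0))) \<le> ln (\<integral>z. k z \<partial>?g)"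
    by (rule LIMSEQ_le_const2) (auto intro!: exI[of _ 0] \<Psi>_le)
  moreover have "integrable ?P (\<lambda>p. ln (k (?X (fst p) (snd p))))"
    by (rule P.integrable_const_bound[where B="\<bar>ln m\<bar> + \<bar>ln M\<bar>"]) (auto intro!: AE_I2 ln_bound mP)
  from P.integral_fst'[OF this]
  have "(\<integral>p. ln (k (?X (fst p) (snd p))) \<partial>?P) = (\<integral>x. mehler (exp (- t)) (noise t) (\<lambda>z. ln (k z)) x \<partial>\<nu>)"
    by (simp add: mehler_def)
  ultimately show ?thesis by simp
qed

end

section \<open>Convexity of the entropy\<close>

text \<open>The tangent line at \<open>u\<close> of the convex function \<open>v * ln v\<close>.
  Jensen's inequality and superadditivity both come from integrating it.\<close>

lemma xlnx_tangent:
  fixes u v :: real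
  assumes "v \<ge> 0" "u > 0"
  shows "v * ln u + v - u \<le> v * ln v"
proof (cases "v = 0")
  case False
  hence v: "v > 0" using assms by simp
  have "ln (u / v) \<le> u / v - 1" using v assms by (intro ln_le_minus_one) simp
  hence "v * (ln u - ln v) \<le> v * (u / v - 1)" using v assms by (intro mult_left_mono) (auto simp: ln_div)
  thus ?thesis using v by (simp add: algebra_simps)
qed (use assms in simp)

lemma xlnx_lower: "v \<ge> 0 \<Longrightarrow> v - 1 \<le> v * ln v" for v :: real
  using xlnx_tangent[of v 1] by simp

text \<open>The tangent is taken at the mean, which must be positive; a zero mean forces
  \<open>p = 0\<close> almost everywhere.\<close>

lemma (in prob_space) xlnx_jensen:
  fixes p :: "'a \<Rightarrow> real"
  assumes p: "integrable M p" "AE x in M. p x \<ge> 0" and pl: "integrable M (\<lambda>x. p x * ln (p x))"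
  shows "(\<integral>x. p x \<partial>M) * ln (\<integral>x. p x \<partial>M) \<le> (\<integral>x. p x * ln (p x) \<partial>M)"
proof (cases "(\<integral>x. p x \<partial>M) = 0")
  case True
  hence "AE x in M. p x = 0" using p by (simp add: integral_nonneg_eq_0_iff_AE)
  hence "(\<integral>x. p x * ln (p x) \<partial>M) = (\<integral>x. 0 \<partial>M)"
    using p pl by (intro integral_cong_AE) auto
  thus ?thesis using True by simp
next
  case False
  let ?u = "\<integral>x. p x \<partial>M"
  have u: "?u > 0" using False integral_nonneg_AE[OF p(2)] by simp
  have "(\<integral>x. p x * ln ?u + p x - ?u \<partial>M) \<le> (\<integral>x. p x * ln (p x) \<partial>M)"
    using p pl u by (intro integral_mono_AE) (auto intro!: xlnx_tangent)
  moreover have "(\<integral>x. p x * ln ?u + p x - ?u \<partial>M) = ?u * ln ?u"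
    using p by (simp add: prob_space)
  ultimately show ?thesis by simp
qed

text \<open>The density is not normalised: conditioning on a third variable in
  \<open>gauss_ent_midpoint\<close> leaves densities of varying, possibly zero, mass.\<close>

locale density_pair = M1: prob_space M1 + M2: prob_space M2
  for M1 :: "'a measure" and M2 :: "'b measure" +
  fixes p :: "'a \<times> 'b \<Rightarrow> real"
  assumes p_nonneg: "\<And>x. p x \<ge> 0"
    and p_int: "integrable (M1 \<Otimes>\<^sub>M M2) p"
    and pl_int: "integrable (M1 \<Otimes>\<^sub>M M2) (\<lambda>x. p x * ln (p x))"
begin

sublocale P: pair_prob_space M1 M2 ..

definition fst_marginal :: "'a \<Rightarrow> real" where "fst_marginal x = (\<integral>y. p (x, y) \<partial>M2)"

lemma p_measurable [measurable]: "p \<in> borel_measurable (M1 \<Otimes>\<^sub>M M2)"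
  using p_int by auto

lemma fst_marginal_measurable [measurable]: "fst_marginal \<in> borel_measurable M1"
  unfolding fst_marginal_def[abs_def] by measurable

lemma fst_marginal_nonneg: "fst_marginal x \<ge> 0"
  unfolding fst_marginal_def by (intro integral_nonneg_AE) (auto simp: p_nonneg)

lemma fst_marginal_integrable: "integrable M1 fst_marginal"
  and fst_marginal_integral: "(\<integral>x. fst_marginal x \<partial>M1) = (\<integral>z. p z \<partial>(M1 \<Otimes>\<^sub>M M2))"
  unfolding fst_marginal_def[abs_def] using P.integrable_fst'[OF p_int] P.integral_fst'[OF p_int] by auto

lemma AE_integrable_p: "AE x in M1. integrable M2 (\<lambda>y. p (x, y))"
  by (rule P.AE_integrable_fst'[OF p_int])

text \<open>Jensen on almost every fibre bounds the marginal integrand from above and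
  \<open>xlnx_lower\<close> bounds it from below, so integrability passes to the marginal.\<close>

lemma
  shows fst_marginal_xlnx_integrable: "integrable M1 (\<lambda>x. fst_marginal x * ln (fst_marginal x))"
    and fst_marginal_xlnx_le: "(\<integral>x. fst_marginal x * ln (fst_marginal x) \<partial>M1)
      \<le> (\<integral>z. p z * ln (p z) \<partial>(M1 \<Otimes>\<^sub>M M2))"
proof -
  let ?R = "\<lambda>x. \<integral>y. p (x, y) * ln (p (x, y)) \<partial>M2"
  have R: "integrable M1 ?R" using P.integrable_fst'[OF pl_int] by simp
  have le: "AE x in M1. fst_marginal x * ln (fst_marginal x) \<le> ?R x"
    using AE_integrable_p P.AE_integrable_fst'[OF pl_int]
    by eventually_elim (auto simp: fst_marginal_def p_nonneg intro!: M2.xlnx_jensen)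
  show int: "integrable M1 (\<lambda>x. fst_marginal x * ln (fst_marginal x))"
  proof (rule Bochner_Integration.integrable_bound)
    show "integrable M1 (\<lambda>x. \<bar>?R x\<bar> + fst_marginal x + 1)" using R fst_marginal_integrable by simp
    show "AE x in M1. norm (fst_marginal x * ln (fst_marginal x)) \<le> norm (\<bar>?R x\<bar> + fst_marginal x + 1)"
      using le
    proof eventually_elim
      case (elim x)
      thus ?case using xlnx_lower[OF fst_marginal_nonneg[of x]] fst_marginal_nonneg[of x]
        unfolding real_norm_def by linarith
    qed
  qed measurable
  have "(\<integral>x. fst_marginal x * ln (fst_marginal x) \<partial>M1) \<le> (\<integral>x. ?R x \<partial>M1)"
    by (rule integral_mono_AE[OF int R le])
  also have "\<dots> = (\<integral>z. p z * ln (p z) \<partial>(M1 \<Otimes>\<^sub>M M2))"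
    using P.integral_fst'[OF pl_int] by simp
  finally show "(\<integral>x. fst_marginal x * ln (fst_marginal x) \<partial>M1) \<le> (\<integral>z. p z * ln (p z) \<partial>(M1 \<Otimes>\<^sub>M M2))" .
qed

lemma
  shows p_ln_marginal_integrable: "integrable (M1 \<Otimes>\<^sub>M M2) (\<lambda>z. p z * ln (fst_marginal (fst z)))"
    and p_ln_marginal_integral: "(\<integral>z. p z * ln (fst_marginal (fst z)) \<partial>(M1 \<Otimes>\<^sub>M M2))
      = (\<integral>x. fst_marginal x * ln (fst_marginal x) \<partial>M1)"
proof -
  \<comment> \<open>The logarithm is constant on a fibre, so the absolute values integrate to those
    of the marginal integrand and Fubini applies.\<close>
  have n: "(\<integral>y. norm (p (x, y) * ln (fst_marginal x)) \<partial>M2) = \<bar>fst_marginal x * ln (fst_marginal x)\<bar>" for x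
    using fst_marginal_nonneg[of x] by (simp add: abs_mult p_nonneg fst_marginal_def[symmetric])
  show int: "integrable (M1 \<Otimes>\<^sub>M M2) (\<lambda>z. p z * ln (fst_marginal (fst z)))"
  proof (rule P.Fubini_integrable)
    show "integrable M1 (\<lambda>x. \<integral>y. norm (p (x, y) * ln (fst_marginal (fst (x, y)))) \<partial>M2)"
      unfolding fst_conv n by (intro integrable_abs fst_marginal_xlnx_integrable)
    show "AE x in M1. integrable M2 (\<lambda>y. p (x, y) * ln (fst_marginal (fst (x, y))))"
      using AE_integrable_p by eventually_elim simp
  qed measurable
  show "(\<integral>z. p z * ln (fst_marginal (fst z)) \<partial>(M1 \<Otimes>\<^sub>M M2)) = (\<integral>x. fst_marginal x * ln (fst_marginal x) \<partial>M1)"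
    using P.integral_fst'[OF int] by (simp add: fst_marginal_def[symmetric])
qed

text \<open>If the marginal is 0 at a point, \<open>p\<close> vanishes almost everywhere on that
  fibre. This is what allows logarithms of the marginal to be taken wherever \<open>p\<close> is
  positive.\<close>

lemma AE_fst_marginal_pos: "AE z in M1 \<Otimes>\<^sub>M M2. p z > 0 \<longrightarrow> fst_marginal (fst z) > 0"
proof (rule P.AE_pair_measure)
  show "{z \<in> space (M1 \<Otimes>\<^sub>M M2). p z > 0 \<longrightarrow> fst_marginal (fst z) > 0} \<in> sets (M1 \<Otimes>\<^sub>M M2)" by measurable
  show "AE x in M1. AE y in M2. p (x, y) > 0 \<longrightarrow> fst_marginal (fst (x, y)) > 0"
    using AE_integrable_p
  proof eventually_elim
    case (elim x)
    show ?case
    proof (cases "fst_marginal x = 0")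
      case True
      hence "AE y in M2. p (x, y) = 0"
        using elim by (simp add: fst_marginal_def integral_nonneg_eq_0_iff_AE p_nonneg)
      thus ?thesis by eventually_elim simp
    next
      case False
      thus ?thesis using fst_marginal_nonneg[of x] by simp
    qed
  qed
qed

end

text \<open>Gives access to the second marginal through the facts proved for the first one.\<close>

lemma density_pair_swap:
  assumes "density_pair M1 M2 p"
  shows "density_pair M2 M1 (\<lambda>(y, x). p (x, y))"
proof -
  interpret density_pair M1 M2 p by fact
  interpret Q: pair_prob_space M2 M1 ..
  show ?thesis
  proof
    show "integrable (M2 \<Otimes>\<^sub>M M1) (\<lambda>(y, x). p (x, y))"
      using P.integrable_product_swap[OF p_int] by (simp add: case_prod_beta')
    show "integrable (M2 \<Otimes>\<^sub>M M1) (\<lambda>z. (case z of (y, x) \<Rightarrow> p (x, y)) * ln (case z of (y, x) \<Rightarrow> p (x, y)))"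
      using P.integrable_product_swap[OF pl_int] by (simp add: case_prod_beta')
  qed (auto simp: p_nonneg)
qed

text \<open>The relative entropy of \<open>p\<close> with respect to \<open>q * r / s\<close> is
  nonnegative. Both have mass \<open>s\<close>, so the linear terms of the tangent inequality cancel
  in the integral, and the logarithm of the product splits. The term \<open>s * ln s\<close>
  accounts for the mass.\<close>

lemma (in density_pair) xlnx_superadditive:
  defines "q \<equiv> \<lambda>x. \<integral>y. p (x, y) \<partial>M2" and "r \<equiv> \<lambda>y. \<integral>x. p (x, y) \<partial>M1"
    and "s \<equiv> \<integral>z. p z \<partial>(M1 \<Otimes>\<^sub>M M2)"
  shows "(\<integral>x. q x * ln (q x) \<partial>M1) + (\<integral>y. r y * ln (r y) \<partial>M2)
    \<le> (\<integral>z. p z * ln (p z) \<partial>(M1 \<Otimes>\<^sub>M M2)) + s * ln s"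
proof -
  let ?P = "M1 \<Otimes>\<^sub>M M2"
  interpret S: density_pair M2 M1 "\<lambda>(y, x). p (x, y)"
    by (rule density_pair_swap) unfold_locales
  have q: "fst_marginal = q" by (rule ext) (simp add: fst_marginal_def q_def)
  have r: "S.fst_marginal = r" by (rule ext) (simp add: S.fst_marginal_def r_def)
  have swap: "(\<integral>z. f (snd z, fst z) \<partial>(M2 \<Otimes>\<^sub>M M1)) = (\<integral>z. f z \<partial>?P)"
    if [measurable]: "f \<in> borel_measurable ?P" for f :: "_ \<Rightarrow> real"
    using P.integral_product_swap[of f] by (simp add: case_prod_beta')
  have s0: "s \<ge> 0" unfolding s_def by (intro integral_nonneg_AE) (auto simp: p_nonneg)
  have plp: "(\<integral>z. (case z of (y, x) \<Rightarrow> p (x, y)) * ln (case z of (y, x) \<Rightarrow> p (x, y)) \<partial>(M2 \<Otimes>\<^sub>M M1))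
      = (\<integral>z. p z * ln (p z) \<partial>?P)"
    using swap[of "\<lambda>z. p z * ln (p z)"] by (simp add: case_prod_beta')
  show ?thesis
  proof (cases "s = 0")
    \<comment> \<open>Without mass \<open>q * r / s\<close> is not a usable reference density; the
      joint integral is 0, and Jensen makes both marginal integrals nonpositive.\<close>
    case True
    hence "AE z in ?P. p z = 0"
      using p_int by (simp add: s_def integral_nonneg_eq_0_iff_AE p_nonneg)
    hence "(\<integral>z. p z * ln (p z) \<partial>?P) = (\<integral>z. 0 \<partial>?P)"
      using p_int pl_int by (intro integral_cong_AE) auto
    moreover note fst_marginal_xlnx_le[unfolded q] S.fst_marginal_xlnx_le[unfolded r plp]
    ultimately show ?thesis using True by simp
  next
    case False
    hence s: "s > 0" using s0 by simp
    have r_ae: "AE z in ?P. p z > 0 \<longrightarrow> r (snd z) > 0"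
    proof -
      have "AE z in M2 \<Otimes>\<^sub>M M1. p (snd z, fst z) > 0 \<longrightarrow> r (fst z) > 0"
        using S.AE_fst_marginal_pos unfolding r by (simp add: case_prod_beta')
      thus ?thesis
        by (subst P.distr_pair_swap, subst AE_distr_iff)
           (use S.fst_marginal_measurable[unfolded r] in \<open>auto simp: case_prod_beta'\<close>)
    qed
    have [measurable]: "q \<in> borel_measurable M1" "r \<in> borel_measurable M2"
      using fst_marginal_measurable S.fst_marginal_measurable by (simp_all add: q r)
    have qr_nonneg: "q x \<ge> 0" "r y \<ge> 0" for x y
      using fst_marginal_nonneg[of x] S.fst_marginal_nonneg[of y] by (simp_all add: q r)
    have r_int: "integrable M2 r" "integrable M1 q"
      using fst_marginal_integrable S.fst_marginal_integrable by (simp_all add: q r)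
    have pr_int: "integrable ?P (\<lambda>z. p z * ln (r (snd z)))"
      using S.P.integrable_product_swap[OF S.p_ln_marginal_integrable] unfolding r
      by (simp add: case_prod_beta')
    have pr: "(\<integral>z. p z * ln (r (snd z)) \<partial>?P) = (\<integral>y. r y * ln (r y) \<partial>M2)"
      using S.p_ln_marginal_integral swap[of "\<lambda>z. p z * ln (r (snd z))"] unfolding r
      by (simp add: case_prod_beta')
    have qr_int: "integrable ?P (\<lambda>z. q (fst z) * r (snd z))"
      by (rule P.Fubini_integrable) (use r_int qr_nonneg in \<open>auto simp: abs_mult\<close>)
    have qr: "(\<integral>z. q (fst z) * r (snd z) \<partial>?P) = s * s"
    proof -
      have "(\<integral>y. r y \<partial>M2) = s"
        using S.fst_marginal_integral[unfolded r] swap[of p] by (simp add: s_def case_prod_beta')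
      moreover have "(\<integral>x. q x \<partial>M1) = s" using fst_marginal_integral by (simp add: q s_def)
      ultimately show ?thesis using P.integral_fst'[OF qr_int] by simp
    qed
    have "AE z in ?P. p z - q (fst z) * r (snd z) / s
        \<le> p z * ln (p z) + p z * ln s - p z * ln (q (fst z)) - p z * ln (r (snd z))"
      using AE_fst_marginal_pos[unfolded q] r_ae
    proof eventually_elim
      case (elim z)
      show ?case
      proof (cases "p z = 0")
        case True
        thus ?thesis using qr_nonneg s by simp
      next
        case False
        hence pos: "p z > 0" "q (fst z) > 0" "r (snd z) > 0" using elim p_nonneg[of z] by auto
        let ?u = "q (fst z) * r (snd z) / s"
        have "p z * ln ?u + p z - ?u \<le> p z * ln (p z)"
          using pos s by (intro xlnx_tangent) auto
        moreover have "ln ?u = ln (q (fst z)) + ln (r (snd z)) - ln s"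
          using pos s by (simp add: ln_div ln_mult)
        ultimately show ?thesis by (simp add: algebra_simps)
      qed
    qed
    hence "(\<integral>z. p z - q (fst z) * r (snd z) / s \<partial>?P)
       \<le> (\<integral>z. p z * ln (p z) + p z * ln s - p z * ln (q (fst z)) - p z * ln (r (snd z)) \<partial>?P)"
      using p_int pl_int p_ln_marginal_integrable[unfolded q] pr_int qr_int
      by (intro integral_mono_AE) auto
    moreover have "(\<integral>z. p z - q (fst z) * r (snd z) / s \<partial>?P) = 0"
      using p_int qr_int s by (simp add: qr s_def[symmetric])
    moreover have "(\<integral>z. p z * ln (p z) + p z * ln s - p z * ln (q (fst z)) - p z * ln (r (snd z)) \<partial>?P)
       = (\<integral>z. p z * ln (p z) \<partial>?P) + s * ln s - (\<integral>x. q x * ln (q x) \<partial>M1) - (\<integral>y. r y * ln (r y) \<partial>M2)"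
      using p_int pl_int p_ln_marginal_integrable[unfolded q] pr_int p_ln_marginal_integral[unfolded q] pr
      by (simp add: s_def)
    ultimately show ?thesis by simp
  qed
qed

section \<open>Sums of Gaussian vectors and the semigroup law\<close>

lemma integrable_gauss_add_iff:
  fixes f :: "real^'n::finite \<Rightarrow> real"
  assumes ab: "a\<^sup>2 + b\<^sup>2 = 1" and [measurable]: "f \<in> borel_measurable borel"
  shows "integrable (std_gaussian \<Otimes>\<^sub>M std_gaussian) (\<lambda>(x, y). f (a *\<^sub>R x + b *\<^sub>R y)) \<longleftrightarrow> integrable std_gaussian f"
proof -
  have "integrable std_gaussian f \<longleftrightarrow>
      integrable (distr (std_gaussian \<Otimes>\<^sub>M std_gaussian) borel (\<lambda>(x, y). a *\<^sub>R x + b *\<^sub>R y)) f"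
    by (simp add: distr_gauss_add[OF ab])
  also have "\<dots> \<longleftrightarrow> integrable (std_gaussian \<Otimes>\<^sub>M std_gaussian) (\<lambda>(x, y). f (a *\<^sub>R x + b *\<^sub>R y))"
    by (subst integrable_distr_eq) (auto simp: case_prod_beta')
  finally show ?thesis by simp
qed

lemma integral_gauss_add:
  fixes f :: "real^'n::finite \<Rightarrow> real"
  assumes ab: "a\<^sup>2 + b\<^sup>2 = 1" and [measurable]: "f \<in> borel_measurable borel"
  shows "(\<integral>(x, y). f (a *\<^sub>R x + b *\<^sub>R y) \<partial>(std_gaussian \<Otimes>\<^sub>M std_gaussian)) = (\<integral>x. f x \<partial>std_gaussian)"
proof -
  have "(\<integral>x. f x \<partial>std_gaussian)
      = (\<integral>x. f x \<partial>distr (std_gaussian \<Otimes>\<^sub>M std_gaussian) borel (\<lambda>(x, y). a *\<^sub>R x + b *\<^sub>R y))"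
    by (simp add: distr_gauss_add[OF ab])
  also have "\<dots> = (\<integral>(x, y). f (a *\<^sub>R x + b *\<^sub>R y) \<partial>(std_gaussian \<Otimes>\<^sub>M std_gaussian))"
    by (subst integral_distr) (auto simp: case_prod_beta')
  finally show ?thesis by simp
qed

lemma AE_integrable_gauss_add:
  fixes f :: "real^'n::finite \<Rightarrow> real"
  assumes ab: "a\<^sup>2 + b\<^sup>2 = 1" and f: "integrable std_gaussian f"
  shows "AE x in std_gaussian. integrable std_gaussian (\<lambda>y. f (a *\<^sub>R x + b *\<^sub>R y))"
proof -
  have m: "f \<in> borel_measurable borel" using f by (auto dest: borel_measurable_integrable)
  show ?thesis
    using gauss2.AE_integrable_fst'[of "\<lambda>(x, y). f (a *\<^sub>R x + b *\<^sub>R y)"] f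
    by (simp add: integrable_gauss_add_iff[OF ab m])
qed

lemma
  fixes f :: "real^'n::finite \<Rightarrow> real"
  assumes c: "a\<^sup>2 + b\<^sup>2 = c\<^sup>2" "c > 0" and [measurable]: "f \<in> borel_measurable borel"
  shows integrable_gauss_add_scaled: "integrable (std_gaussian \<Otimes>\<^sub>M std_gaussian) (\<lambda>(y, z). f (x + (a *\<^sub>R y + b *\<^sub>R z)))
      \<longleftrightarrow> integrable std_gaussian (\<lambda>v. f (x + c *\<^sub>R v))"
    and integral_gauss_add_scaled: "(\<integral>(y, z). f (x + (a *\<^sub>R y + b *\<^sub>R z)) \<partial>(std_gaussian \<Otimes>\<^sub>M std_gaussian))
      = (\<integral>v. f (x + c *\<^sub>R v) \<partial>std_gaussian)"
proof -
  have 1: "(a / c)\<^sup>2 + (b / c)\<^sup>2 = 1"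
    using c by (simp add: power_divide add_divide_distrib[symmetric])
  have 2: "c *\<^sub>R ((a / c) *\<^sub>R y + (b / c) *\<^sub>R z) = a *\<^sub>R y + b *\<^sub>R z" for y z :: "real^'n"
    using c by (simp add: scaleR_add_right)
  have m: "(\<lambda>v. f (x + c *\<^sub>R v)) \<in> borel_measurable borel" by measurable
  show "integrable (std_gaussian \<Otimes>\<^sub>M std_gaussian) (\<lambda>(y, z). f (x + (a *\<^sub>R y + b *\<^sub>R z)))
      \<longleftrightarrow> integrable std_gaussian (\<lambda>v. f (x + c *\<^sub>R v))"
    using integrable_gauss_add_iff[OF 1 m] by (simp only: 2)
  show "(\<integral>(y, z). f (x + (a *\<^sub>R y + b *\<^sub>R z)) \<partial>(std_gaussian \<Otimes>\<^sub>M std_gaussian))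
      = (\<integral>v. f (x + c *\<^sub>R v) \<partial>std_gaussian)"
    using integral_gauss_add[OF 1 m] by (simp only: 2)
qed

text \<open>The two independent Gaussian variables merge into one of standard deviation
  \<open>c\<close>. This holds almost everywhere: for a merely integrable \<open>g\<close> the
  defining integral may diverge at exceptional points, where it takes the default value 0.\<close>

lemma mehler_semigroup_AE:
  fixes g :: "real^'n::finite \<Rightarrow> real"
  assumes ab: "a\<^sup>2 + b\<^sup>2 = 1" and ab': "a'\<^sup>2 + b'\<^sup>2 = 1" and c: "(a * a')\<^sup>2 + c\<^sup>2 = 1" "c > 0"
    and g: "integrable std_gaussian g"
  shows "AE x in std_gaussian. mehler a b (mehler a' b' g) x = mehler (a * a') c g x"
  using AE_integrable_gauss_add[OF c(1) g]
proof eventually_elim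
  case (elim x)
  have m: "g \<in> borel_measurable borel" using g by (auto dest: borel_measurable_integrable)
  have sq: "(a' * b)\<^sup>2 + b'\<^sup>2 = c\<^sup>2"
  proof -
    have "b\<^sup>2 = 1 - a\<^sup>2" using ab by simp
    hence "(a' * b)\<^sup>2 + b'\<^sup>2 = a'\<^sup>2 * (1 - a\<^sup>2) + b'\<^sup>2" by (simp add: power_mult_distrib)
    also have "\<dots> = 1 - (a * a')\<^sup>2" using ab' by (simp add: power_mult_distrib algebra_simps)
    also have "\<dots> = c\<^sup>2" using c by simp
    finally show ?thesis .
  qed
  have arg: "a' *\<^sub>R (a *\<^sub>R x + b *\<^sub>R y) + b' *\<^sub>R z = (a * a') *\<^sub>R x + ((a' * b) *\<^sub>R y + b' *\<^sub>R z)" for y z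
    by (simp add: scaleR_add_right mult.commute)
  have "integrable (std_gaussian \<Otimes>\<^sub>M std_gaussian) (\<lambda>(y, z). g ((a * a') *\<^sub>R x + ((a' * b) *\<^sub>R y + b' *\<^sub>R z)))"
    using elim by (simp add: integrable_gauss_add_scaled[OF sq c(2) m])
  from gauss2.integral_fst'[OF this] show ?case
    unfolding mehler_def arg using integral_gauss_add_scaled[OF sq c(2) m, of "(a * a') *\<^sub>R x"] by simp
qed

text \<open>As a Bochner integral it defaults to 0 when \<open>f x * ln (f x)\<close> is not
  integrable; it is the entropy under \<open>finite_entropy\<close>, by
  \<open>gaussian_entropy_eq\<close>.\<close>

definition gauss_ent :: "(real^'n::finite \<Rightarrow> real) \<Rightarrow> real" where
  "gauss_ent f = (\<integral>x. f x * ln (f x) \<partial>std_gaussian)"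

locale finite_entropy =
  fixes g :: "real^'n::finite \<Rightarrow> real"
  assumes g_nonneg: "\<And>x. g x \<ge> 0"
    and g_int: "integrable std_gaussian g"
    and gl_int: "integrable std_gaussian (\<lambda>x. g x * ln (g x))"
begin

lemma g_meas [measurable]: "g \<in> borel_measurable borel"
  using g_int by (auto dest: borel_measurable_integrable)

lemma gl_meas [measurable]: "(\<lambda>x. g x * ln (g x)) \<in> borel_measurable borel"
  by measurable

context
  fixes a b :: real
  assumes ab: "a\<^sup>2 + b\<^sup>2 = 1"
begin

text \<open>As a density on pairs, \<open>g (a x + b y)\<close> has \<open>mehler a b g\<close> as
  its first marginal, so facts about marginals become facts about the semigroup.\<close>

lemma density_pair_gauss: "density_pair std_gaussian std_gaussian (\<lambda>(x, y). g (a *\<^sub>R x + b *\<^sub>R y))"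
proof
  show "integrable (std_gaussian \<Otimes>\<^sub>M std_gaussian) (\<lambda>(x, y). g (a *\<^sub>R x + b *\<^sub>R y))"
    using g_int by (simp add: integrable_gauss_add_iff[OF ab])
  show "integrable (std_gaussian \<Otimes>\<^sub>M std_gaussian) (\<lambda>z. (case z of (x, y) \<Rightarrow> g (a *\<^sub>R x + b *\<^sub>R y))
      * ln (case z of (x, y) \<Rightarrow> g (a *\<^sub>R x + b *\<^sub>R y)))"
    using integrable_gauss_add_iff[OF ab gl_meas] gl_int by (simp add: case_prod_beta')
qed (auto simp: g_nonneg)

interpretation D: density_pair std_gaussian std_gaussian "\<lambda>(x, y). g (a *\<^sub>R x + b *\<^sub>R y)"
  by (rule density_pair_gauss)

lemma fst_marginal_mehler: "D.fst_marginal = mehler a b g"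
  by (rule ext) (simp add: D.fst_marginal_def mehler_def)

lemma mehler_finite_entropy: "finite_entropy (mehler a b g)"
proof
  show "mehler a b g x \<ge> 0" for x
    using D.fst_marginal_nonneg[of x] by (simp add: fst_marginal_mehler)
  show "integrable std_gaussian (mehler a b g)"
    using D.fst_marginal_integrable by (simp add: fst_marginal_mehler)
  show "integrable std_gaussian (\<lambda>x. mehler a b g x * ln (mehler a b g x))"
    using D.fst_marginal_xlnx_integrable by (simp add: fst_marginal_mehler)
qed

lemma gauss_ent_mehler_le: "gauss_ent (mehler a b g) \<le> gauss_ent g"
  using D.fst_marginal_xlnx_le[unfolded fst_marginal_mehler] integral_gauss_add[OF ab gl_meas]
  by (simp add: gauss_ent_def case_prod_beta')

end

text \<open>In rotated coordinates \<open>g\<close> becomes a density on three independent Gaussians, two of them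
  of weight \<open>\<eta>\<close>; superadditivity of the entropy, conditionally on the third one, is midpoint
  convexity of the entropy along \<open>y = e\<^bsup>-2t\<^esup>\<close>.\<close>

lemma gauss_ent_midpoint:
  assumes eta: "\<eta> > 0" "2 * \<eta> \<le> 1"
  shows "2 * gauss_ent (mehler (sqrt (1 - \<eta>)) (sqrt \<eta>) g)
      \<le> gauss_ent g + gauss_ent (mehler (sqrt (1 - 2 * \<eta>)) (sqrt (2 * \<eta>)) g)"
proof -
  define c0 where "c0 = sqrt (1 - 2 * \<eta>)"
  define e where "e = sqrt \<eta>"
  define a1 where "a1 = sqrt (1 - \<eta>)"
  define e2 where "e2 = sqrt (2 * \<eta>)"
  let ?g = "std_gaussian :: (real^'n) measure"
  have sq: "c0\<^sup>2 = 1 - 2 * \<eta>" "e\<^sup>2 = \<eta>" "a1\<^sup>2 = 1 - \<eta>" "e2\<^sup>2 = 2 * \<eta>"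
    using eta by (auto simp: c0_def e_def a1_def e2_def)
  have pos: "a1 > 0" "e2 > 0" using eta by (auto simp: a1_def e2_def)
  have ab0: "c0\<^sup>2 + e2\<^sup>2 = 1" and ab1: "a1\<^sup>2 + e\<^sup>2 = 1" and ee: "e\<^sup>2 + e\<^sup>2 = e2\<^sup>2"
    by (auto simp: sq)
  have ab2: "(c0 / a1)\<^sup>2 + (e / a1)\<^sup>2 = 1"
    using eta by (simp add: power_divide sq add_divide_distrib[symmetric])
  define G1 where "G1 = mehler a1 e g"
  define G2 where "G2 = mehler c0 e2 g"
  interpret E1: finite_entropy G1 unfolding G1_def by (rule mehler_finite_entropy[OF ab1])
  interpret E2: finite_entropy G2 unfolding G2_def by (rule mehler_finite_entropy[OF ab0])
  \<comment> \<open>The vector \<open>c0 c + e x + e y\<close> is standard Gaussian because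
    \<open>c0\<^sup>2 + 2 e\<^sup>2 = 1\<close>. For fixed \<open>c\<close>, \<open>F\<close> is the
    joint entropy integral in \<open>x\<close> and \<open>y\<close>, and \<open>q\<close> is the
    marginal in \<open>x\<close>: averaging over \<open>y\<close> leaves a vector of variance
    \<open>1 - \<eta>\<close> per coordinate, whence the division by \<open>a1\<close>.\<close>
  define F where "F c = (\<integral>v. g (c0 *\<^sub>R c + e2 *\<^sub>R v) * ln (g (c0 *\<^sub>R c + e2 *\<^sub>R v)) \<partial>?g)" for c
  define q where "q c x = G1 ((c0 / a1) *\<^sub>R c + (e / a1) *\<^sub>R x)" for c x
  define Q where "Q c = (\<integral>x. q c x * ln (q c x) \<partial>?g)" for c
  have q_eq: "q c x = (\<integral>y. g (c0 *\<^sub>R c + (e *\<^sub>R x + e *\<^sub>R y)) \<partial>?g)" for c x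
  proof -
    have "a1 *\<^sub>R ((c0 / a1) *\<^sub>R c + (e / a1) *\<^sub>R x) + e *\<^sub>R y = c0 *\<^sub>R c + (e *\<^sub>R x + e *\<^sub>R y)" for y
      using pos by (simp add: scaleR_add_right)
    thus ?thesis by (simp only: q_def G1_def mehler_def)
  qed
  have F_int: "integrable ?g F" and F_integral: "integral\<^sup>L ?g F = gauss_ent g"
  proof -
    have i: "integrable (?g \<Otimes>\<^sub>M ?g) (\<lambda>(c, v). g (c0 *\<^sub>R c + e2 *\<^sub>R v) * ln (g (c0 *\<^sub>R c + e2 *\<^sub>R v)))"
      using gl_int by (simp add: integrable_gauss_add_iff[OF ab0 gl_meas])
    show "integrable ?g F" "integral\<^sup>L ?g F = gauss_ent g"
      unfolding F_def using gauss2.integrable_fst'[OF i] gauss2.integral_fst'[OF i]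
      by (simp_all add: gauss_ent_def integral_gauss_add[OF ab0 gl_meas])
  qed
  have Q_int: "integrable ?g Q" and Q_integral: "integral\<^sup>L ?g Q = gauss_ent G1"
  proof -
    have i: "integrable (?g \<Otimes>\<^sub>M ?g) (\<lambda>(c, x). q c x * ln (q c x))"
      unfolding q_def using E1.gl_int by (simp add: integrable_gauss_add_iff[OF ab2 E1.gl_meas])
    show "integrable ?g Q" "integral\<^sup>L ?g Q = gauss_ent G1"
      unfolding Q_def using gauss2.integrable_fst'[OF i] gauss2.integral_fst'[OF i]
        integral_gauss_add[OF ab2 E1.gl_meas]
      by (simp_all add: gauss_ent_def q_def)
  qed
  \<comment> \<open>Both marginals equal \<open>q c\<close> by symmetry, hence the factor 2; the
    mass of the pair density is \<open>G2 c\<close>, and its term becomes the entropy of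
    \<open>G2\<close> once integrated in \<open>c\<close>.\<close>
  have "AE c in ?g. 2 * Q c \<le> F c + G2 c * ln (G2 c)"
    using AE_integrable_gauss_add[OF ab0 g_int] AE_integrable_gauss_add[OF ab0 gl_int]
  proof eventually_elim
    case (elim c)
    interpret D: density_pair ?g ?g "\<lambda>(x, y). g (c0 *\<^sub>R c + (e *\<^sub>R x + e *\<^sub>R y))"
    proof
      show "integrable (?g \<Otimes>\<^sub>M ?g) (\<lambda>(x, y). g (c0 *\<^sub>R c + (e *\<^sub>R x + e *\<^sub>R y)))"
        using elim(1) by (simp add: integrable_gauss_add_scaled[OF ee pos(2)])
      show "integrable (?g \<Otimes>\<^sub>M ?g) (\<lambda>z. (case z of (x, y) \<Rightarrow> g (c0 *\<^sub>R c + (e *\<^sub>R x + e *\<^sub>R y)))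
          * ln (case z of (x, y) \<Rightarrow> g (c0 *\<^sub>R c + (e *\<^sub>R x + e *\<^sub>R y))))"
        using integrable_gauss_add_scaled[OF ee pos(2) gl_meas, of "c0 *\<^sub>R c"] elim(2)
        by (simp add: case_prod_beta')
    qed (auto simp: g_nonneg)
    have "(\<integral>z. (case z of (x, y) \<Rightarrow> g (c0 *\<^sub>R c + (e *\<^sub>R x + e *\<^sub>R y)))
          * ln (case z of (x, y) \<Rightarrow> g (c0 *\<^sub>R c + (e *\<^sub>R x + e *\<^sub>R y))) \<partial>(?g \<Otimes>\<^sub>M ?g)) = F c"
      using integral_gauss_add_scaled[OF ee pos(2) gl_meas, of "c0 *\<^sub>R c"]
      by (simp add: F_def case_prod_beta')
    moreover have "(\<integral>z. (case z of (x, y) \<Rightarrow> g (c0 *\<^sub>R c + (e *\<^sub>R x + e *\<^sub>R y))) \<partial>(?g \<Otimes>\<^sub>M ?g)) = G2 c"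
      using integral_gauss_add_scaled[OF ee pos(2) g_meas, of "c0 *\<^sub>R c"]
      by (simp add: G2_def mehler_def)
    moreover have "(\<integral>x. g (c0 *\<^sub>R c + (e *\<^sub>R x + e *\<^sub>R y)) \<partial>?g) = q c y" for y
      by (simp add: q_eq add.commute)
    ultimately show ?case
      using D.xlnx_superadditive by (simp add: q_eq[symmetric] Q_def)
  qed
  hence "(\<integral>c. 2 * Q c \<partial>?g) \<le> (\<integral>c. F c + G2 c * ln (G2 c) \<partial>?g)"
    using Q_int F_int E2.gl_int by (intro integral_mono_AE) auto
  hence "2 * gauss_ent G1 \<le> gauss_ent g + gauss_ent G2"
    using Q_int F_int E2.gl_int by (simp add: F_integral Q_integral gauss_ent_def)
  thus ?thesis by (simp add: G1_def G2_def a1_def e_def c0_def e2_def)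
qed

end

text \<open>The increments are nondecreasing, so the average slope from 0 grows with the index;
  \<open>slope\<close> compares this average with the next increment.\<close>

lemma discrete_convex_chord:
  fixes A :: "nat \<Rightarrow> real"
  assumes conv: "\<And>k. k + 2 \<le> n \<Longrightarrow> 2 * A (k + 1) \<le> A k + A (k + 2)"
    and k: "k \<le> n" and n: "n > 0"
  shows "A k - A 0 \<le> real k / real n * (A n - A 0)"
proof -
  have slope: "A k - A 0 \<le> real k * (A (k + 1) - A k)" if "k + 1 \<le> n" for k
    using that
  proof (induction k)
    case (Suc k)
    have "A (Suc k) - A 0 \<le> real (Suc k) * (A (k + 1) - A k)"
      using Suc by (simp add: algebra_simps)
    also have "\<dots> \<le> real (Suc k) * (A (Suc k + 1) - A (Suc k))"
      using conv[of k] Suc.prems by (intro mult_left_mono) auto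
    finally show ?case .
  qed simp
  show ?thesis
  proof (cases "k = 0")
    case False
    have "(A k - A 0) * real m \<le> real k * (A m - A 0)" if "k \<le> m" "m \<le> n" for m
      using that
    proof (induction m rule: dec_induct)
      case (step m)
      have m: "real m > 0" using False step by simp
      have "(A k - A 0) * real m * real (Suc m) \<le> real k * (A m - A 0) * real (Suc m)"
        using step by (intro mult_right_mono) auto
      also have "\<dots> = real k * ((A m - A 0) * real (Suc m))" by simp
      also have "\<dots> \<le> real k * (real m * (A (Suc m) - A 0))"
        using slope[of m] step.prems by (intro mult_left_mono) (auto simp: algebra_simps)
      finally have "real m * ((A k - A 0) * real (Suc m)) \<le> real m * (real k * (A (Suc m) - A 0))"
        by (simp add: mult_ac)
      thus ?case using m by simp
    qed (simp add: mult.commute)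
    from this[OF k order_refl] n show ?thesis by (simp add: field_simps)
  qed simp
qed

lemma mehler_1_0: "mehler 1 0 f = f"
  by (rule ext) (simp add: mehler_def)

lemma gauss_ent_cong_AE:
  assumes "AE x in std_gaussian. f x = f' x" "f \<in> borel_measurable borel" "f' \<in> borel_measurable borel"
  shows "gauss_ent f = gauss_ent f'"
  unfolding gauss_ent_def using assms by (intro integral_cong_AE) auto

section \<open>The entropy as a function of y = exp (- 2 t)\<close>

context finite_entropy
begin

definition ent_at :: "real \<Rightarrow> real" where
  "ent_at y = gauss_ent (mehler (sqrt y) (sqrt (1 - y)) g)"

lemma ent_at_1: "ent_at 1 = gauss_ent g"
  by (simp add: ent_at_def mehler_1_0)

lemma finite_entropy_mehler_sqrt:
  "0 \<le> y \<Longrightarrow> y \<le> 1 \<Longrightarrow> finite_entropy (mehler (sqrt y) (sqrt (1 - y)) g)"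
  by (rule mehler_finite_entropy) simp

text \<open>The coefficients \<open>sqrt y\<close> multiply under composition, so the semigroup acts
  on \<open>y\<close> by multiplication, and statements at the initial time carry over to any later
  one.\<close>

lemma gauss_ent_mehler_mehler:
  assumes y: "0 \<le> y" "y \<le> 1" and z: "0 \<le> z" "z < 1"
  shows "gauss_ent (mehler (sqrt z) (sqrt (1 - z)) (mehler (sqrt y) (sqrt (1 - y)) g)) = ent_at (z * y)"
proof -
  have zy: "z * y < 1" using mult_left_mono[OF y(2) z(1)] z(2) by simp
  have zy0: "0 \<le> z * y" using y z by simp
  have "AE x in std_gaussian. mehler (sqrt z) (sqrt (1 - z)) (mehler (sqrt y) (sqrt (1 - y)) g) x
     = mehler (sqrt z * sqrt y) (sqrt (1 - z * y)) g x"
    using y z zy zy0 by (intro mehler_semigroup_AE g_int) (auto simp: real_sqrt_mult[symmetric])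
  thus ?thesis
    unfolding ent_at_def real_sqrt_mult[of z y]
    by (rule gauss_ent_cong_AE) measurable
qed

lemma ent_at_mono:
  assumes "0 \<le> y" "y \<le> y'" "y' \<le> 1"
  shows "ent_at y \<le> ent_at y'"
proof (cases "y < y'")
  case True
  hence y': "y' > 0" "y / y' \<ge> 0" "y / y' < 1" using assms by auto
  interpret G: finite_entropy "mehler (sqrt y') (sqrt (1 - y')) g"
    using assms y' by (intro finite_entropy_mehler_sqrt) auto
  have "G.ent_at (y / y') \<le> ent_at y'"
    unfolding G.ent_at_def ent_at_def[of y'] using y' by (intro G.gauss_ent_mehler_le) auto
  moreover have "G.ent_at (y / y') = ent_at y"
    unfolding G.ent_at_def using gauss_ent_mehler_mehler[of y' "y / y'"] y' assms by simp
  ultimately show ?thesis by simp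
qed (use assms in simp)

text \<open>Apply \<open>gauss_ent_midpoint\<close> to the average at \<open>y\<close> with weight
  \<open>\<delta> / y\<close>, which makes the steps in the variable \<open>y\<close> equal to
  \<open>\<delta>\<close>.\<close>

lemma ent_at_midpoint:
  assumes d: "\<delta> > 0" and y: "y - 2 * \<delta> \<ge> 0" "y \<le> 1"
  shows "2 * ent_at (y - \<delta>) \<le> ent_at y + ent_at (y - 2 * \<delta>)"
proof -
  have y0: "y > 0" using d y by simp
  interpret G: finite_entropy "mehler (sqrt y) (sqrt (1 - y)) g"
    using y y0 by (intro finite_entropy_mehler_sqrt) auto
  let ?e = "\<delta> / y"
  have e: "?e > 0" "2 * ?e \<le> 1" using d y y0 by (auto simp: field_simps)
  have "(1 - ?e) * y = y - \<delta>" "(1 - 2 * ?e) * y = y - 2 * \<delta>"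
    using y0 by (auto simp: algebra_simps)
  thus ?thesis
    using G.gauss_ent_midpoint[OF e] gauss_ent_mehler_mehler[of y "1 - ?e"] gauss_ent_mehler_mehler[of y "1 - 2 * ?e"] e y y0
    by (simp add: ent_at_def[of y])
qed

text \<open>Midpoint convexity gives the chord on an equidistant grid of [w, 1]. Monotonicity does
  the work of continuity: \<open>y\<close> is rounded up to the grid at a cost of at most
  \<open>?D / real ?n\<close>, which vanishes as the grid is refined.\<close>

lemma ent_at_chord:
  assumes w: "0 \<le> w" "w < 1" and y: "w \<le> y" "y \<le> 1"
  shows "ent_at y \<le> ent_at w + (y - w) / (1 - w) * (ent_at 1 - ent_at w)"
proof -
  let ?l = "(y - w) / (1 - w)" and ?D = "ent_at 1 - ent_at w"
  have l: "0 \<le> ?l" "?l \<le> 1" using w y by auto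
  have D: "?D \<ge> 0" using ent_at_mono[of w 1] w by simp
  have "ent_at y \<le> ent_at w + (?l + 1 / real (Suc i)) * ?D" for i
  proof -
    let ?n = "Suc i"
    define \<delta> where "\<delta> = (1 - w) / real ?n"
    have d: "\<delta> > 0" "real ?n * \<delta> = 1 - w" using w by (auto simp: \<delta>_def)
    define A where "A k = ent_at (w + real k * \<delta>)" for k
    define k where "k = nat \<lceil>real ?n * ?l\<rceil>"
    have kr: "real ?n * ?l \<le> real k" "real k \<le> real ?n * ?l + 1"
    proof -
      have "0 \<le> real ?n * ?l" using l(1) by (rule mult_nonneg_nonneg[OF of_nat_0_le_iff])
      hence "real k = of_int \<lceil>real ?n * ?l\<rceil>" unfolding k_def by (simp del: of_nat_Suc)
      thus "real ?n * ?l \<le> real k" "real k \<le> real ?n * ?l + 1" by linarith+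
    qed
    have kn: "k \<le> ?n"
    proof -
      have "real ?n * ?l \<le> real ?n * 1" using l by (intro mult_left_mono) auto
      thus ?thesis unfolding k_def nat_le_iff ceiling_le_iff by simp
    qed
    have le1: "w + real j * \<delta> \<le> 1" if "j \<le> ?n" for j
    proof -
      have "real j * \<delta> \<le> real ?n * \<delta>" using that d by (intro mult_right_mono) auto
      thus ?thesis using d by linarith
    qed
    have conv: "2 * A (j + 1) \<le> A j + A (j + 2)" if "j + 2 \<le> ?n" for j
    proof -
      have "w + real (j + 2) * \<delta> - 2 * \<delta> \<ge> 0" using w d by (simp add: algebra_simps)
      from ent_at_midpoint[OF d(1) this le1[OF that]] show ?thesis
        by (simp add: A_def algebra_simps)
    qed
    have "A k - A 0 \<le> real k / real ?n * (A ?n - A 0)"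
      by (rule discrete_convex_chord[OF conv kn]) auto
    moreover have "A 0 = ent_at w" by (simp add: A_def)
    moreover have "A ?n = ent_at 1" unfolding A_def d(2) by simp
    moreover have "ent_at y \<le> A k"
    proof -
      have "y - w = (real ?n * ?l) * \<delta>" using d w by (simp add: \<delta>_def del: of_nat_Suc)
      also have "\<dots> \<le> real k * \<delta>" using kr d by (intro mult_right_mono) auto
      finally show ?thesis unfolding A_def using le1[OF kn] w y by (intro ent_at_mono) auto
    qed
    moreover have "real k / real ?n * ?D \<le> (?l + 1 / real ?n) * ?D"
    proof (rule mult_right_mono[OF _ D])
      have "real k / real ?n \<le> (real ?n * ?l + 1) / real ?n" using kr by (intro divide_right_mono) auto
      thus "real k / real ?n \<le> ?l + 1 / real ?n" by (simp add: add_divide_distrib del: of_nat_Suc)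
    qed
    ultimately show ?thesis by simp
  qed
  moreover have "(\<lambda>i. ent_at w + (?l + 1 / real (Suc i)) * ?D) \<longlonglongrightarrow> ent_at w + (?l + 0) * ?D"
    using LIMSEQ_inverse_real_of_nat by (intro tendsto_intros) (simp add: divide_inverse)
  ultimately have "ent_at y \<le> ent_at w + (?l + 0) * ?D"
    by (intro LIMSEQ_le_const) auto
  thus ?thesis by simp
qed

end

section \<open>The entropy decay\<close>

text \<open>The kernel is symmetric: the self-inverse rotation \<open>T\<close> turns
  \<open>F\<close> into \<open>\<phi> (a x + b y) * h x\<close> and preserves the product
  measure.\<close>

lemma mehler_adjoint:
  fixes \<phi> h :: "real^'n::finite \<Rightarrow> real"
  assumes ab: "a\<^sup>2 + b\<^sup>2 = 1" and [measurable]: "\<phi> \<in> borel_measurable borel"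
    and B: "\<And>x. \<bar>\<phi> x\<bar> \<le> B" and h: "integrable std_gaussian h"
  shows "(\<integral>x. h x * mehler a b \<phi> x \<partial>std_gaussian) = (\<integral>x. \<phi> x * mehler a b h x \<partial>std_gaussian)"
proof -
  let ?g = "std_gaussian :: (real^'n) measure"
  let ?P = "?g \<Otimes>\<^sub>M ?g"
  define T where "T = (\<lambda>(x, y). (a *\<^sub>R x + b *\<^sub>R y, b *\<^sub>R x - a *\<^sub>R y) :: (real^'n) \<times> (real^'n))"
  define F where "F = (\<lambda>(u, v). \<phi> u * h (a *\<^sub>R u + b *\<^sub>R v))"
  have hm [measurable]: "h \<in> borel_measurable borel" using h by (auto dest: borel_measurable_integrable)
  have T [measurable]: "T \<in> measurable ?P ?P" unfolding T_def by measurable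
  have Fm [measurable]: "F \<in> borel_measurable ?P" unfolding F_def by measurable
  have FT: "F (T (x, y)) = \<phi> (a *\<^sub>R x + b *\<^sub>R y) * h x" for x y
  proof -
    have "a *\<^sub>R (a *\<^sub>R x + b *\<^sub>R y) + b *\<^sub>R (b *\<^sub>R x - a *\<^sub>R y) = (a\<^sup>2 + b\<^sup>2) *\<^sub>R x"
      by (simp add: algebra_simps power2_eq_square)
    thus ?thesis by (simp add: F_def T_def ab)
  qed
  have F_int: "integrable ?P F"
  proof (rule Bochner_Integration.integrable_bound)
    have "integrable ?P (\<lambda>(x, y). h (a *\<^sub>R x + b *\<^sub>R y))"
      using h by (simp add: integrable_gauss_add_iff[OF ab hm])
    thus "integrable ?P (\<lambda>p. B * \<bar>h (a *\<^sub>R fst p + b *\<^sub>R snd p)\<bar>)"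
      by (intro integrable_mult_right integrable_abs) (simp add: case_prod_beta')
    show "AE p in ?P. norm (F p) \<le> norm (B * \<bar>h (a *\<^sub>R fst p + b *\<^sub>R snd p)\<bar>)"
    proof (rule AE_I2)
      fix p
      have "\<bar>\<phi> (fst p)\<bar> * \<bar>h (a *\<^sub>R fst p + b *\<^sub>R snd p)\<bar> \<le> \<bar>B\<bar> * \<bar>h (a *\<^sub>R fst p + b *\<^sub>R snd p)\<bar>"
        using B[of "fst p"] by (intro mult_right_mono) auto
      thus "norm (F p) \<le> norm (B * \<bar>h (a *\<^sub>R fst p + b *\<^sub>R snd p)\<bar>)"
        by (simp add: F_def case_prod_beta' abs_mult)
    qed
  qed measurable
  have dist: "distr ?P ?P T = ?P" unfolding T_def by (rule distr_gauss_rotate[OF ab])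
  have FT_int: "integrable ?P (\<lambda>p. F (T p))"
    using F_int integrable_distr_eq[OF T Fm] by (simp add: dist)
  have "(\<integral>p. F p \<partial>?P) = (\<integral>p. F (T p) \<partial>?P)"
    using integral_distr[OF T Fm] by (simp add: dist)
  moreover have "(\<integral>p. F p \<partial>?P) = (\<integral>x. \<phi> x * mehler a b h x \<partial>?g)"
    using gauss2.integral_fst'[OF F_int] by (simp add: F_def mehler_def)
  moreover have "(\<integral>p. F (T p) \<partial>?P) = (\<integral>x. h x * mehler a b \<phi> x \<partial>?g)"
    using gauss2.integral_fst'[OF FT_int] by (simp add: FT mehler_def mult.commute)
  ultimately show ?thesis by simp
qed

text \<open>Coefficient and point enter only through their product, so the lemma serves both for
  continuity in the point and for convergence in time.\<close>

lemma mehler_tendsto: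
  fixes F :: "real^'n::finite \<Rightarrow> real"
  assumes F: "continuous_on UNIV F" and B: "\<And>x. \<bar>F x\<bar> \<le> B"
    and X: "(\<lambda>n. \<alpha> n *\<^sub>R X n) \<longlonglongrightarrow> a *\<^sub>R x" "\<beta> \<longlonglongrightarrow> b"
  shows "(\<lambda>n. mehler (\<alpha> n) (\<beta> n) F (X n)) \<longlonglongrightarrow> mehler a b F x"
  unfolding mehler_def
proof (rule integral_dominated_convergence[where w="\<lambda>_. B"])
  have [measurable]: "F \<in> borel_measurable borel" by (rule borel_measurable_continuous_onI[OF F])
  show "(\<lambda>y. F (a *\<^sub>R x + b *\<^sub>R y)) \<in> borel_measurable std_gaussian"
    "(\<lambda>y. F (\<alpha> n *\<^sub>R X n + \<beta> n *\<^sub>R y)) \<in> borel_measurable std_gaussian" for n by measurable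
  show "AE y in std_gaussian. (\<lambda>n. F (\<alpha> n *\<^sub>R X n + \<beta> n *\<^sub>R y)) \<longlonglongrightarrow> F (a *\<^sub>R x + b *\<^sub>R y)"
    by (intro AE_I2 continuous_on_tendsto_compose[OF F] tendsto_intros X) auto
qed (use B in \<open>auto simp: gauss.integrable_const\<close>)

lemma mehler_noise_tendsto:
  fixes F :: "real^'n::finite \<Rightarrow> real"
  assumes F: "continuous_on UNIV F" and B: "\<And>x. \<bar>F x\<bar> \<le> B"
  shows "(\<lambda>n. mehler (exp (- (1 / real (Suc n)))) (noise (1 / real (Suc n))) F x) \<longlonglongrightarrow> F x"
proof -
  have R: "(\<lambda>n. 1 / real (Suc n)) \<longlonglongrightarrow> 0"
    using LIMSEQ_inverse_real_of_nat by (simp add: divide_inverse)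
  have "(\<lambda>n. mehler (exp (- (1 / real (Suc n)))) (noise (1 / real (Suc n))) F x) \<longlonglongrightarrow> mehler (exp (- 0)) (noise 0) F x"
    by (intro mehler_tendsto[OF F B] tendsto_intros R isCont_tendsto_compose[OF isCont_noise])
  thus ?thesis by (simp add: noise_def mehler_1_0)
qed

text \<open>Supplies test functions for the dual bound: the kernel makes a bounded function
  Lipschitz, and adding \<open>\<epsilon>\<close> keeps it away from 0.\<close>

lemma (in linear_growth) mehler_heat_flow:
  assumes bd: "\<And>x. 0 \<le> u x" "\<And>x. u x \<le> B" and b: "b > 0" and e: "\<epsilon> > 0"
  obtains dk K where "heat_flow (\<lambda>x. mehler a b u x + \<epsilon>) dk K \<epsilon> (B + \<epsilon>)"
proof -
  let ?d = "\<lambda>x. (\<chi> i. a / b * (\<integral>y. u (a *\<^sub>R x + b *\<^sub>R y) * y $ i \<partial>std_gaussian))"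
  let ?K = "\<Sum>i\<in>UNIV. \<bar>a / b\<bar> * (B * (\<integral>y. \<bar>y $ i\<bar> \<partial>(std_gaussian :: (real^'n) measure)))"
  have "heat_flow (\<lambda>x. mehler a b u x + \<epsilon>) ?d ?K \<epsilon> (B + \<epsilon>)"
  proof
    fix x
    show "((\<lambda>x. mehler a b u x + \<epsilon>) has_derivative (\<lambda>v. ?d x \<bullet> v)) (at x)"
      using has_derivative_add_const[OF mehler_has_derivative_kernel[of b a x], of \<epsilon>] b by simp
    have "\<bar>?d x $ i\<bar> \<le> \<bar>a / b\<bar> * (B * (\<integral>y. \<bar>y $ i\<bar> \<partial>(std_gaussian :: (real^'n) measure)))" for i
    proof -
      have "\<bar>\<integral>y. u (a *\<^sub>R x + b *\<^sub>R y) * y $ i \<partial>std_gaussian\<bar>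
          \<le> (\<integral>y. norm (u (a *\<^sub>R x + b *\<^sub>R y) * y $ i) \<partial>std_gaussian)"
        using integral_norm_bound[of std_gaussian "\<lambda>y. u (a *\<^sub>R x + b *\<^sub>R y) * y $ i"] by simp
      also have "\<dots> \<le> (\<integral>y. B * \<bar>y $ i\<bar> \<partial>(std_gaussian :: (real^'n) measure))"
        using bd by (intro integral_mono integrable_norm integrable_gauss_poly real_polynomial_function_nth
            integrable_mult_right integrable_abs integrable_gauss_nth) (auto simp: abs_mult intro!: mult_right_mono)
      finally have "\<bar>\<integral>y. u (a *\<^sub>R x + b *\<^sub>R y) * y $ i \<partial>std_gaussian\<bar>
        \<le> B * (\<integral>y. \<bar>y $ i\<bar> \<partial>(std_gaussian :: (real^'n) measure))" by simp
      hence "\<bar>a / b\<bar> * \<bar>\<integral>y. u (a *\<^sub>R x + b *\<^sub>R y) * y $ i \<partial>std_gaussian\<bar>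
        \<le> \<bar>a / b\<bar> * (B * (\<integral>y. \<bar>y $ i\<bar> \<partial>(std_gaussian :: (real^'n) measure)))"
        by (rule mult_left_mono) simp
      thus ?thesis by (simp only: vec_lambda_beta abs_mult)
    qed
    hence "(\<Sum>i\<in>UNIV. \<bar>?d x $ i\<bar>) \<le> ?K" by (rule sum_mono)
    thus "norm (?d x) \<le> ?K" by (rule order_trans[OF norm_le_l1_cart])
    have "0 \<le> mehler a b u x" unfolding mehler_def using bd by simp
    thus "\<epsilon> \<le> mehler a b u x + \<epsilon>" by simp
    have "mehler a b u x \<le> (\<integral>y. B \<partial>(std_gaussian :: (real^'n) measure))"
      unfolding mehler_def using bd by (intro integral_mono integrable_gauss) auto
    thus "mehler a b u x + \<epsilon> \<le> B + \<epsilon>" by simp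
  next
    show "?d \<in> borel_measurable borel"
      by (rule borel_measurable_vecI) simp
  qed (use e in auto)
  thus ?thesis using that by blast
qed

text \<open>The dual formula is optimal at \<open>k = f\<close>. This choice is approached by
  smoothing \<open>F N\<close> for a short time and adding \<open>\<epsilon>\<close>: the smoothing
  time tends to 0 first, then \<open>N\<close> to infinity, then \<open>\<epsilon>\<close> to 0.
  Finiteness of the entropy is an outcome.\<close>

lemma entropy_le_of_dual:
  fixes f :: "real^'n::finite \<Rightarrow> real" and F :: "nat \<Rightarrow> real^'n \<Rightarrow> real"
  assumes f: "\<And>x. f x \<ge> 0" "integrable std_gaussian f" "(\<integral>x. f x \<partial>std_gaussian) = 1"
    and F: "\<And>N. continuous_on UNIV (F N)" "\<And>N x. 0 \<le> F N x" "\<And>N x. F N x \<le> B N"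
    and Ff: "\<And>N. AE x in std_gaussian. F N x \<le> f x" "AE x in std_gaussian. (\<lambda>N. F N x) \<longlonglongrightarrow> f x"
    and dual: "\<And>k dk K m M. heat_flow k dk K m M \<Longrightarrow>
        (\<integral>x. ln (k x) * f x \<partial>std_gaussian) \<le> ln (\<integral>x. k x \<partial>std_gaussian) + C"
  shows "finite_entropy f" and "gauss_ent f \<le> C"
proof -
  let ?g = "std_gaussian :: (real^'n) measure"
  have fm [measurable]: "f \<in> borel_measurable borel" using f(2) by (auto dest: borel_measurable_integrable)
  have Fm [measurable]: "F N \<in> borel_measurable borel" for N by (rule borel_measurable_continuous_onI[OF F(1)])
  have Fb: "\<bar>F N x\<bar> \<le> B N" for N x using F(2,3) by simp
  have Fi: "integrable ?g (F N)" for N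
    by (rule gauss.integrable_const_bound[where B="B N"]) (use Fb in auto)
  have step2: "(\<integral>x. ln (F N x + \<epsilon>) * f x \<partial>?g) \<le> ln (\<integral>x. F N x + \<epsilon> \<partial>?g) + C"
    and step2_int: "integrable ?g (\<lambda>x. ln (F N x + \<epsilon>) * f x)" if e: "\<epsilon> > 0" for N \<epsilon>
  proof -
    interpret U: linear_growth "F N" "B N" by (rule linear_growth_bounded[OF Fm Fb])
    define t where "t n = 1 / real (Suc n)" for n
    define k where "k n x = mehler (exp (- t n)) (noise (t n)) (F N) x + \<epsilon>" for n x
    have np: "noise (t n) > 0" for n by (intro noise_pos) (simp add: t_def)
    have km [measurable]: "k n \<in> borel_measurable borel" for n unfolding k_def[abs_def] by measurable
    have kb: "\<epsilon> \<le> k n x \<and> k n x \<le> B N + \<epsilon>" for n x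
    proof -
      obtain dk K where "heat_flow (k n) dk K \<epsilon> (B N + \<epsilon>)"
        unfolding k_def[abs_def] using U.mehler_heat_flow[OF F(2,3) np e] by blast
      then interpret heat_flow "k n" dk K \<epsilon> "B N + \<epsilon>" .
      show ?thesis using lower upper by simp
    qed
    have lnb: "\<bar>ln z\<bar> \<le> \<bar>ln \<epsilon>\<bar> + \<bar>ln (B N + \<epsilon>)\<bar>" if "\<epsilon> \<le> z" "z \<le> B N + \<epsilon>" for z
      by (rule abs_ln_le[OF e that])
    have k_lim: "(\<lambda>n. k n x) \<longlonglongrightarrow> F N x + \<epsilon>" for x
      unfolding k_def t_def by (intro tendsto_intros mehler_noise_tendsto[OF F(1) Fb])
    have pos: "F N x + \<epsilon> > 0" for x using F(2)[of N x] e by linarith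
    let ?W = "\<lambda>x. (\<bar>ln \<epsilon>\<bar> + \<bar>ln (B N + \<epsilon>)\<bar>) * f x"
    have W: "integrable ?g ?W" using f(2) by simp
    show "integrable ?g (\<lambda>x. ln (F N x + \<epsilon>) * f x)"
      by (rule Bochner_Integration.integrable_bound[OF W])
         (use F f lnb in \<open>auto intro!: AE_I2 mult_right_mono simp: abs_mult\<close>)
    have lim1: "(\<lambda>n. \<integral>x. ln (k n x) * f x \<partial>?g) \<longlonglongrightarrow> (\<integral>x. ln (F N x + \<epsilon>) * f x \<partial>?g)"
    proof (rule integral_dominated_convergence[OF _ _ W])
      show "AE x in ?g. (\<lambda>n. ln (k n x) * f x) \<longlonglongrightarrow> ln (F N x + \<epsilon>) * f x"
        using pos by (intro AE_I2 tendsto_intros k_lim) (auto simp: less_imp_neq[symmetric])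
      show "AE x in ?g. norm (ln (k n x) * f x) \<le> ?W x" for n
        using kb lnb f(1) by (auto intro!: AE_I2 mult_right_mono simp: abs_mult)
    qed measurable
    have lim2: "(\<lambda>n. \<integral>x. k n x \<partial>?g) \<longlonglongrightarrow> (\<integral>x. F N x + \<epsilon> \<partial>?g)"
    proof (rule integral_dominated_convergence[where w="\<lambda>_. B N + \<epsilon>"])
      show "AE x in ?g. norm (k n x) \<le> B N + \<epsilon>" for n
      proof (rule AE_I2)
        fix x show "norm (k n x) \<le> B N + \<epsilon>" using kb[of n x] e by simp
      qed
    qed (use k_lim in auto)
    have "(\<integral>x. F N x + \<epsilon> \<partial>?g) > 0"
    proof -
      have "(\<integral>x. F N x + \<epsilon> \<partial>?g) = (\<integral>x. F N x \<partial>?g) + \<epsilon>"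
        using Fi by simp
      moreover have "(\<integral>x. F N x \<partial>?g) \<ge> 0" using F(2) by simp
      ultimately show ?thesis using e by linarith
    qed
    hence lim3: "(\<lambda>n. ln (\<integral>x. k n x \<partial>?g) + C) \<longlonglongrightarrow> ln (\<integral>x. F N x + \<epsilon> \<partial>?g) + C"
      by (intro tendsto_intros lim2) simp
    have "(\<integral>x. ln (k n x) * f x \<partial>?g) \<le> ln (\<integral>x. k n x \<partial>?g) + C" for n
    proof -
      obtain dk K where "heat_flow (k n) dk K \<epsilon> (B N + \<epsilon>)"
        unfolding k_def[abs_def] using U.mehler_heat_flow[OF F(2,3) np e] by blast
      thus ?thesis by (rule dual)
    qed
    thus "(\<integral>x. ln (F N x + \<epsilon>) * f x \<partial>?g) \<le> ln (\<integral>x. F N x + \<epsilon> \<partial>?g) + C"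
      using LIMSEQ_le[OF lim1 lim3] by blast
  qed
  \<comment> \<open>\<open>F N\<close> has mass at most 1, so the logarithm on the right is at most
    \<open>\<epsilon>\<close>.\<close>
  have step3: "(\<integral>x. ln (F N x + \<epsilon>) * f x \<partial>?g) \<le> \<epsilon> + C" if e: "\<epsilon> > 0" for N \<epsilon>
  proof -
    have "(\<integral>x. F N x \<partial>?g) \<le> 1" using integral_mono_AE[OF Fi f(2) Ff(1), of N] f(3) by simp
    hence le: "(\<integral>x. F N x + \<epsilon> \<partial>?g) \<le> 1 + \<epsilon>"
      using Fi by simp
    have "(\<integral>x. F N x + \<epsilon> \<partial>?g) \<ge> \<epsilon>"
      using Fi F(2) by simp
    hence "ln (\<integral>x. F N x + \<epsilon> \<partial>?g) \<le> (\<integral>x. F N x + \<epsilon> \<partial>?g) - 1" using e by (intro ln_le_minus_one) linarith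
    thus ?thesis using step2[OF e, of N] le by linarith
  qed
  have fin: "integrable ?g (\<lambda>x. ln (f x + \<epsilon>) * f x) \<and> (\<integral>x. ln (f x + \<epsilon>) * f x \<partial>?g) \<le> \<epsilon> + C" if e: "\<epsilon> > 0" for \<epsilon>
  proof -
    \<comment> \<open>Subtracting \<open>ln \<epsilon>\<close> makes the integrands nonnegative, as
      Fatou's lemma requires for the passage to the limit in \<open>N\<close>.\<close>
    define G where "G N x = (ln (F N x + \<epsilon>) - ln \<epsilon>) * f x" for N x
    define G0 where "G0 x = (ln (f x + \<epsilon>) - ln \<epsilon>) * f x" for x
    have mono: "ln \<epsilon> \<le> ln (z + \<epsilon>)" if "z \<ge> 0" for z using that e by (intro ln_mono) auto
    have Gp: "G N x \<ge> 0" "G0 x \<ge> 0" for N x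
      unfolding G_def G0_def using mono[OF F(2)] mono[OF f(1)] f(1) by (auto intro!: mult_nonneg_nonneg)
    have Gm [measurable]: "G N \<in> borel_measurable borel" "G0 \<in> borel_measurable borel" for N
      unfolding G_def[abs_def] G0_def[abs_def] by measurable
    have Gi: "integrable ?g (G N)" "(\<integral>x. G N x \<partial>?g) \<le> \<epsilon> + C - ln \<epsilon>" for N
    proof -
      have "G N = (\<lambda>x. ln (F N x + \<epsilon>) * f x - ln \<epsilon> * f x)" by (rule ext) (simp add: G_def algebra_simps)
      thus "integrable ?g (G N)" "(\<integral>x. G N x \<partial>?g) \<le> \<epsilon> + C - ln \<epsilon>"
        using step2_int[OF e, of N] f(2,3) step3[OF e, of N] by simp_all
    qed
    have "(\<integral>\<^sup>+x. ennreal (G0 x) \<partial>?g) = (\<integral>\<^sup>+x. liminf (\<lambda>N. ennreal (G N x)) \<partial>?g)"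
    proof (rule nn_integral_cong_AE)
      show "AE x in ?g. ennreal (G0 x) = liminf (\<lambda>N. ennreal (G N x))"
        using Ff(2)
      proof eventually_elim
        case (elim x)
        have "f x + \<epsilon> \<noteq> 0" using f(1)[of x] e by linarith
        hence "(\<lambda>N. G N x) \<longlonglongrightarrow> G0 x"
          unfolding G_def G0_def by (intro tendsto_intros elim)
        hence "(\<lambda>N. ennreal (G N x)) \<longlonglongrightarrow> ennreal (G0 x)" by (rule tendsto_ennrealI)
        thus ?case by (intro lim_imp_Liminf[symmetric]) auto
      qed
    qed
    also have "\<dots> \<le> liminf (\<lambda>N. \<integral>\<^sup>+x. ennreal (G N x) \<partial>?g)"
      by (rule nn_integral_liminf) measurable
    also have "\<dots> \<le> ennreal (\<epsilon> + C - ln \<epsilon>)"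
    proof -
      have "(\<integral>\<^sup>+x. ennreal (G N x) \<partial>?g) \<le> ennreal (\<epsilon> + C - ln \<epsilon>)" for N
        using nn_integral_eq_integral[OF Gi(1)] Gp Gi(2) by (simp add: ennreal_leI)
      hence "liminf (\<lambda>N. \<integral>\<^sup>+x. ennreal (G N x) \<partial>?g) \<le> liminf (\<lambda>N. ennreal (\<epsilon> + C - ln \<epsilon>))"
        by (intro Liminf_mono) auto
      thus ?thesis by (simp add: Liminf_const)
    qed
    finally have le: "(\<integral>\<^sup>+x. ennreal (G0 x) \<partial>?g) \<le> ennreal (\<epsilon> + C - ln \<epsilon>)" .
    have G0i: "integrable ?g G0"
      by (rule integrableI_nonneg) (use Gp le in \<open>auto intro: le_less_trans\<close>)
    have "(\<integral>x. G 0 x \<partial>?g) \<ge> 0" by (intro integral_nonneg_AE) (simp add: Gp)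
    hence nn: "\<epsilon> + C - ln \<epsilon> \<ge> 0" using Gi(2)[of 0] by linarith
    have G0le: "(\<integral>x. G0 x \<partial>?g) \<le> \<epsilon> + C - ln \<epsilon>"
      using le nn nn_integral_eq_integral[OF G0i] Gp by (simp add: ennreal_le_iff)
    have eq: "(\<lambda>x. ln (f x + \<epsilon>) * f x) = (\<lambda>x. G0 x + ln \<epsilon> * f x)"
      by (rule ext) (simp add: G0_def algebra_simps)
    show ?thesis unfolding eq using G0i G0le f(2,3) by simp
  qed
  have le: "f x * ln (f x) \<le> ln (f x + \<epsilon>) * f x" if "\<epsilon> > 0" for x \<epsilon>
  proof (cases "f x = 0")
    case False
    hence "f x > 0" using f(1)[of x] by simp
    hence "ln (f x) \<le> ln (f x + \<epsilon>)" using that by (intro ln_mono) auto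
    thus ?thesis using f(1)[of x] by (simp add: mult.commute mult_left_mono)
  qed simp
  have int: "integrable ?g (\<lambda>x. f x * ln (f x))"
  proof (rule Bochner_Integration.integrable_bound)
    show "integrable ?g (\<lambda>x. \<bar>ln (f x + 1) * f x\<bar> + f x + 1)"
      using fin[of 1] f(2) by auto
    show "AE x in ?g. norm (f x * ln (f x)) \<le> norm (\<bar>ln (f x + 1) * f x\<bar> + f x + 1)"
    proof (rule AE_I2)
      fix x
      show "norm (f x * ln (f x)) \<le> norm (\<bar>ln (f x + 1) * f x\<bar> + f x + 1)"
        using le[of 1 x] xlnx_lower[OF f(1)[of x]] f(1)[of x] unfolding real_norm_def by linarith
    qed
  qed measurable
  show "finite_entropy f" using f int by unfold_locales
  have "gauss_ent f \<le> C + \<epsilon>" if e: "\<epsilon> > 0" for \<epsilon>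
    using integral_mono[OF int conjunct1[OF fin[OF e]]] le[OF e] fin[OF e] by (fastforce simp: gauss_ent_def)
  thus "gauss_ent f \<le> C" by (rule field_le_epsilon)
qed

text \<open>Adjointness turns the bound of \<open>integral_ln_mehler_le\<close> into the dual
  hypothesis of \<open>entropy_le_of_dual\<close>. The constant \<open>C\<close> is given by cases
  because \<open>decay_bound 1\<close> would involve \<open>ln 0\<close>; at \<open>t = 0\<close>
  only zero discrepancy is treated.\<close>

lemma entropy_mehler_le:
  fixes h :: "real^'n::finite \<Rightarrow> real" and \<tau> :: "real^'n \<Rightarrow> real^'n^'n"
  defines "\<nu> \<equiv> density std_gaussian (\<lambda>x. ennreal (h x))"
  defines "S \<equiv> \<integral>x. (norm (\<tau> x - mat 1))\<^sup>2 \<partial>\<nu>"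
  assumes hc: "continuous_on UNIV h" and h0: "\<And>x. h x \<ge> 0"
    and prob: "prob_space \<nu>" and cent: "centered \<nu>"
    and stein: "stein_kernel \<nu> \<tau>" and fin: "finite_stein_discrepancy \<nu> \<tau>"
    and t: "t \<ge> 0" and C: "t > 0 \<Longrightarrow> C = S * decay_bound (exp (- 2 * t))" "t = 0 \<Longrightarrow> S = 0 \<and> C = 0"
  shows "finite_entropy (mehler (exp (- t)) (noise t) h)"
    and "gauss_ent (mehler (exp (- t)) (noise t) h) \<le> C"
    and "integrable std_gaussian h" and "(\<integral>x. h x \<partial>std_gaussian) = 1"
proof -
  let ?g = "std_gaussian :: (real^'n) measure"
  let ?a = "exp (- t)" and ?b = "noise t"
  let ?f = "mehler ?a ?b h"
  interpret nu: prob_space \<nu> by fact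
  have ab: "?a\<^sup>2 + ?b\<^sup>2 = 1" using exp_noise_sq[OF t] .
  have hm [measurable]: "h \<in> borel_measurable borel" by (rule borel_measurable_continuous_onI[OF hc])
  have sets [measurable_cong]: "sets \<nu> = sets borel" by (simp add: \<nu>_def)
  have nn: "(\<integral>\<^sup>+x. ennreal (h x) \<partial>?g) = 1"
    using nu.emeasure_space_1 by (simp add: \<nu>_def emeasure_density)
  show hi: "integrable ?g h" by (rule integrableI_nonneg) (use h0 nn in auto)
  show h1: "(\<integral>x. h x \<partial>?g) = 1"
    using nn nn_integral_eq_integral[OF hi] h0 by (simp add: ennreal_eq_1)
  have Pi: "integrable (?g \<Otimes>\<^sub>M ?g) (\<lambda>(x, y). h (?a *\<^sub>R x + ?b *\<^sub>R y))"
    using hi by (simp add: integrable_gauss_add_iff[OF ab hm])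
  have f0: "?f x \<ge> 0" for x unfolding mehler_def using h0 by simp
  have fi: "integrable ?g ?f" and f1: "(\<integral>x. ?f x \<partial>?g) = 1"
    using gauss2.integrable_fst'[OF Pi] gauss2.integral_fst'[OF Pi] integral_gauss_add[OF ab hm] h1
    by (simp_all add: mehler_def[abs_def])
  \<comment> \<open>Cutting \<open>h\<close> at height \<open>N\<close> makes its averages bounded
    and continuous, while the average of \<open>h\<close> itself is controlled almost everywhere
    only.\<close>
  define hN where "hN N x = min (h x) (real N)" for N x
  have hN_cont: "continuous_on UNIV (hN N)" for N
    unfolding hN_def[abs_def] by (intro continuous_intros hc)
  have hN_m [measurable]: "hN N \<in> borel_measurable borel" for N
    by (rule borel_measurable_continuous_onI[OF hN_cont])
  have hNb: "0 \<le> hN N x" "hN N x \<le> real N" "hN N x \<le> h x" for N x using h0[of x] by (auto simp: hN_def)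
  have hNb': "\<bar>hN N x\<bar> \<le> real N" for N x using hNb[of N x] by simp
  define F where "F N = mehler ?a ?b (hN N)" for N
  have hN_int: "integrable ?g (\<lambda>y. hN N (x + b *\<^sub>R y))" for N x b
    by (rule gauss.integrable_const_bound[where B="real N"]) (use hNb' in auto)
  have F_cont: "continuous_on UNIV (F N)" for N
    \<comment> \<open>Continuity comes from dominated convergence rather than from the kernel, since
      \<open>?b\<close> is 0 when \<open>t = 0\<close>.\<close>
    unfolding F_def by (intro continuous_at_imp_continuous_on ballI)
      (auto simp: continuous_at_sequentially o_def intro!: mehler_tendsto[OF hN_cont hNb'] tendsto_intros)
  have F0: "0 \<le> F N x" for N x unfolding F_def mehler_def using hNb by simp
  have FN: "F N x \<le> real N" for N x
  proof -
    have "F N x \<le> (\<integral>y. real N \<partial>?g)"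
      unfolding F_def mehler_def using hNb by (intro integral_mono hN_int) auto
    thus ?thesis by simp
  qed
  have Ff: "AE x in ?g. F N x \<le> ?f x" for N
    using AE_integrable_gauss_add[OF ab hi]
    by eventually_elim (auto simp: F_def mehler_def hNb intro!: integral_mono hN_int)
  have F_lim: "AE x in ?g. (\<lambda>N. F N x) \<longlonglongrightarrow> ?f x"
    using AE_integrable_gauss_add[OF ab hi]
  proof eventually_elim
    case (elim x)
    show ?case
      unfolding F_def mehler_def
    proof (rule integral_dominated_convergence[OF _ _ elim])
      show "AE y in ?g. (\<lambda>N. hN N (?a *\<^sub>R x + ?b *\<^sub>R y)) \<longlonglongrightarrow> h (?a *\<^sub>R x + ?b *\<^sub>R y)"
      proof (rule AE_I2)
        fix y
        let ?z = "?a *\<^sub>R x + ?b *\<^sub>R y"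
        obtain N0 :: nat where N0: "h ?z \<le> real N0" using real_arch_simple by blast
        have "eventually (\<lambda>N. hN N ?z = h ?z) sequentially"
          using eventually_ge_at_top[of N0]
        proof eventually_elim
          case (elim N)
          hence "h ?z \<le> real N" using N0 by linarith
          thus ?case by (simp add: hN_def)
        qed
        thus "(\<lambda>N. hN N ?z) \<longlonglongrightarrow> h ?z" by (rule tendsto_eventually)
      qed
    qed (use hNb in auto)
  qed
  have dual: "(\<integral>x. ln (k x) * ?f x \<partial>?g) \<le> ln (\<integral>x. k x \<partial>?g) + C" if "heat_flow k dk K m M" for k dk K m M
  proof -
    interpret heat_flow k dk K m M by fact
    have lnk_cont: "continuous_on UNIV (\<lambda>x. ln (k x))"
      using lower m_pos by (intro continuous_on_ln cont) (auto simp: less_le_trans[THEN less_imp_neq, symmetric])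
    have lnk_m [measurable]: "(\<lambda>x. ln (k x)) \<in> borel_measurable borel" by measurable
    have mom: "integrable \<nu> (\<lambda>x. x $ j)" for j using cent by (simp add: centered_def)
    \<comment> \<open>The average moves from \<open>h\<close> to \<open>ln k\<close>, which leaves
      an integral over \<open>\<nu>\<close>.\<close>
    have "(\<integral>x. ln (k x) * ?f x \<partial>?g) = (\<integral>x. h x * mehler ?a ?b (\<lambda>z. ln (k z)) x \<partial>?g)"
      by (rule mehler_adjoint[OF ab lnk_m ln_bound hi, symmetric])
    also have "\<dots> = (\<integral>x. mehler ?a ?b (\<lambda>z. ln (k z)) x \<partial>\<nu>)"
      unfolding \<nu>_def by (subst integral_density) (auto simp: h0)
    also have "\<dots> \<le> ln (\<integral>x. k x \<partial>?g) + C"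
    proof (cases "t = 0")
      case False
      hence "t > 0" using t by simp
      thus ?thesis using integral_ln_mehler_le[OF prob sets mom stein fin] C(1) by (simp add: S_def)
    next
      \<comment> \<open>With \<open>S = 0\<close> the bound at each positive time has no error term,
        and the time is sent to 0.\<close>
      case True
      define s where "s n = 1 / real (Suc n)" for n
      have "(\<integral>x. mehler (exp (- s n)) (noise (s n)) (\<lambda>z. ln (k z)) x \<partial>\<nu>) \<le> ln (\<integral>x. k x \<partial>?g) + C" for n
        using integral_ln_mehler_le[OF prob sets mom stein fin, of "s n"] C(2)[OF True]
        by (simp add: S_def[symmetric] s_def)
      moreover have "(\<lambda>n. \<integral>x. mehler (exp (- s n)) (noise (s n)) (\<lambda>z. ln (k z)) x \<partial>\<nu>) \<longlonglongrightarrow> (\<integral>x. ln (k x) \<partial>\<nu>)"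
      proof (rule integral_dominated_convergence[where w="\<lambda>_. \<bar>ln m\<bar> + \<bar>ln M\<bar>"])
        show "AE x in \<nu>. (\<lambda>n. mehler (exp (- s n)) (noise (s n)) (\<lambda>z. ln (k z)) x) \<longlonglongrightarrow> ln (k x)"
          unfolding s_def by (intro AE_I2 mehler_noise_tendsto[OF lnk_cont ln_bound])
        have "\<bar>mehler a b (\<lambda>z. ln (k z)) x\<bar> \<le> \<bar>ln m\<bar> + \<bar>ln M\<bar>" for a b x
        proof -
          have "\<bar>mehler a b (\<lambda>z. ln (k z)) x\<bar> \<le> (\<integral>y. norm (ln (k (a *\<^sub>R x + b *\<^sub>R y))) \<partial>?g)"
            unfolding mehler_def using integral_norm_bound[of ?g "\<lambda>y. ln (k (a *\<^sub>R x + b *\<^sub>R y))"] by simp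
          also have "\<dots> \<le> (\<integral>y. \<bar>ln m\<bar> + \<bar>ln M\<bar> \<partial>?g)"
            by (intro integral_mono integrable_norm gauss.integrable_const_bound[where B="\<bar>ln m\<bar> + \<bar>ln M\<bar>"])
               (auto simp: ln_bound gauss.integrable_const)
          finally show ?thesis by simp
        qed
        thus "AE x in \<nu>. norm (mehler (exp (- s n)) (noise (s n)) (\<lambda>z. ln (k z)) x) \<le> \<bar>ln m\<bar> + \<bar>ln M\<bar>" for n
          by simp
      qed auto
      ultimately have "(\<integral>x. ln (k x) \<partial>\<nu>) \<le> ln (\<integral>x. k x \<partial>?g) + C"
        by (intro LIMSEQ_le_const2) auto
      thus ?thesis using True by (simp add: noise_def mehler_1_0)
    qed
    finally show ?thesis .
  qed
  show "finite_entropy ?f"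
    by (rule entropy_le_of_dual(1)[OF f0 fi f1 F_cont F0 FN Ff F_lim]) (erule dual)
  show "gauss_ent ?f \<le> C"
    by (rule entropy_le_of_dual(2)[OF f0 fi f1 F_cont F0 FN Ff F_lim]) (erule dual)
qed

section \<open>Real-valued and extended entropy\<close>

lemma gaussian_entropy_eq:
  assumes "finite_entropy f"
  shows "gaussian_entropy f = ereal (gauss_ent f)"
proof -
  interpret finite_entropy f by fact
  let ?p = "\<integral>\<^sup>+x. ennreal (f x * ln (f x)) \<partial>std_gaussian"
  let ?m = "\<integral>\<^sup>+x. ennreal (- (f x * ln (f x))) \<partial>std_gaussian"
  have "?p \<noteq> \<infinity>" "?m \<noteq> \<infinity>" using gl_int by (auto simp: real_integrable_def)
  moreover have "enn2ereal z = ereal (enn2real z)" if "z \<noteq> \<infinity>" for z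
    using that by (cases z) auto
  ultimately have "enn2ereal ?p = ereal (enn2real ?p)" "enn2ereal ?m = ereal (enn2real ?m)" by blast+
  thus ?thesis
    by (simp add: gaussian_entropy_def gauss_ent_def real_lebesgue_integral_def[OF gl_int])
qed

text \<open>The negative part is at most 1 because u ln u >= u - 1, so an infinite positive part
  would make the entropy infinite.\<close>

lemma finite_entropyI:
  fixes f :: "real^'n::finite \<Rightarrow> real"
  assumes f: "\<And>x. f x \<ge> 0" "integrable std_gaussian f" and fin: "gaussian_entropy f \<noteq> \<infinity>"
  shows "finite_entropy f"
proof
  have [measurable]: "f \<in> borel_measurable borel" using f(2) by (auto dest: borel_measurable_integrable)
  let ?p = "\<integral>\<^sup>+x. ennreal (f x * ln (f x)) \<partial>std_gaussian"
  let ?m = "\<integral>\<^sup>+x. ennreal (- (f x * ln (f x))) \<partial>std_gaussian"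
  have "?m \<le> (\<integral>\<^sup>+x. 1 \<partial>(std_gaussian :: (real^'n) measure))"
  proof (rule nn_integral_mono)
    fix x
    have "- (f x * ln (f x)) \<le> 1" using xlnx_lower[OF f(1)[of x]] f(1)[of x] by linarith
    thus "ennreal (- (f x * ln (f x))) \<le> 1" using ennreal_leI by fastforce
  qed
  hence "?m \<le> 1" by (simp add: gauss.emeasure_space_1[simplified])
  hence m: "?m \<noteq> \<infinity>" by (auto simp: top_unique)
  have "?p \<noteq> \<infinity>"
  proof
    assume "?p = \<infinity>"
    moreover have "enn2ereal ?m \<noteq> \<infinity>" using m by (cases ?m) auto
    ultimately show False using fin by (simp add: gaussian_entropy_def)
  qed
  thus "integrable std_gaussian (\<lambda>x. f x * ln (f x))" using m by (simp add: real_integrable_def)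
qed (use f in auto)

lemma (in finite_entropy) gauss_ent_nonneg:
  assumes "(\<integral>x. g x \<partial>std_gaussian) = 1"
  shows "gauss_ent g \<ge> 0"
proof -
  have "(\<integral>x. g x - 1 \<partial>std_gaussian) \<le> (\<integral>x. g x * ln (g x) \<partial>std_gaussian)"
    using g_int gl_int xlnx_lower[OF g_nonneg] by (intro integral_mono) auto
  thus ?thesis using g_int assms by (simp add: gauss_ent_def)
qed

section \<open>Scalar inequalities for the final optimisation\<close>

lemma two_mult_le_exp_diff: "v \<ge> 0 \<Longrightarrow> 2 * v \<le> exp v - exp (- v)" for v :: real
proof -
  assume v: "v \<ge> 0"
  have "(\<lambda>v. exp v - exp (- v) - 2 * v) 0 \<le> (\<lambda>v. exp v - exp (- v) - 2 * v) v"
  proof (rule DERIV_nonneg_imp_nondecreasing[OF v])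
    fix x :: real
    have "((\<lambda>v. exp v - exp (- v) - 2 * v) has_real_derivative exp x + exp (- x) - 2) (at x)"
      by (auto intro!: derivative_eq_intros)
    moreover have "exp x + exp (- x) - 2 \<ge> 0"
      using exp_ge_add_one_self[of x] exp_ge_add_one_self[of "- x"] by linarith
    ultimately show "\<exists>y. ((\<lambda>v. exp v - exp (- v) - 2 * v) has_real_derivative y) (at x) \<and> 0 \<le> y" by blast
  qed
  thus ?thesis by simp
qed

text \<open>The last bound says that the geometric mean of 1 and \<open>1 - y\<close> is at most
  their logarithmic mean \<open>y / l\<close>; it is sinh v >= v at
  \<open>v = l / 2\<close>.\<close>

lemma neg_ln_bounds:
  fixes y :: real
  assumes y: "0 < y" "y < 1"
  defines "l \<equiv> - ln (1 - y)"
  shows "0 < l" and "(1 - y) * l \<le> y" and "(1 - y) * l\<^sup>2 \<le> y\<^sup>2"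
proof -
  have el: "exp (- l) = 1 - y" using y by (simp add: l_def)
  show l: "0 < l" using y by (simp add: l_def)
  have "exp l * (1 - y) = 1" unfolding el[symmetric] by (simp add: exp_minus)
  moreover have "(1 + l) * (1 - y) \<le> exp l * (1 - y)"
    using y by (intro mult_right_mono) auto
  ultimately show "(1 - y) * l \<le> y" by (simp add: algebra_simps)
  let ?q = "exp (- (l / 2))"
  have q: "?q\<^sup>2 = 1 - y" using exp_double[of "- (l / 2)"] el by simp
  have "?q * (2 * (l / 2)) \<le> ?q * (exp (l / 2) - ?q)"
    using two_mult_le_exp_diff[of "l / 2"] l by (intro mult_left_mono) auto
  also have "\<dots> = 1 - ?q\<^sup>2" by (simp add: right_diff_distrib power2_eq_square exp_minus)
  also have "\<dots> = y" by (simp add: q)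
  finally have "?q * l \<le> y" by simp
  hence "(?q * l)\<^sup>2 \<le> y\<^sup>2" using l by (intro power_mono) auto
  thus "(1 - y) * l\<^sup>2 \<le> y\<^sup>2" by (simp add: power_mult_distrib q)
qed

text \<open>The chord from \<open>w = 1 - exp (- 2 E\<^sub>0 / S)\<close> is the optimal one; it gives the bound
  \<open>E\<^sub>0 - (1 - y) S (exp (2 E\<^sub>0 / S) - 1) / 2\<close>. When \<open>y \<le> w\<close> the bound by \<open>decay_bound\<close> suffices.\<close>

lemma entropy_decay_real:
  fixes Ey E0 S y :: real
  assumes S: "S > 0" and y: "0 < y" "y < 1" and E0: "E0 \<ge> 0"
    and direct: "Ey \<le> S * decay_bound y" and mono: "Ey \<le> E0"
    and chord: "\<And>w. 0 < w \<Longrightarrow> w < y \<Longrightarrow>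
      Ey \<le> S * decay_bound w + (y - w) / (1 - w) * (E0 - S * decay_bound w)"
  shows "Ey \<le> y\<^sup>2 / (y + (1 - y) / S * E0) * E0"
proof (cases "E0 = 0")
  case True
  thus ?thesis using mono by simp
next
  case False
  define e where "e = E0 / S"
  have e: "e > 0" "E0 = S * e" using False E0 S by (auto simp: e_def)
  have den: "y + (1 - y) * e > 0" using y e by (intro add_pos_nonneg) auto
  have target: "y\<^sup>2 / (y + (1 - y) / S * E0) * E0 = S * (y\<^sup>2 * e / (y + (1 - y) * e))"
    using S e by simp
  define p where "p = exp (- 2 * e)"
  have p: "0 < p" "p < 1" using e by (auto simp: p_def)
  have "Ey \<le> S * (y\<^sup>2 * e / (y + (1 - y) * e))"
  proof (cases "1 - p < y")
    case True
    have db: "decay_bound (1 - p) = e - (1 - p) / 2" by (simp add: decay_bound_def p_def field_simps)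
    have "Ey \<le> S * decay_bound (1 - p) + (y - (1 - p)) / p * (E0 - S * decay_bound (1 - p))"
      using chord[of "1 - p"] True p by simp
    also have "\<dots> = S * (e - (1 - y) * ((1 / p - 1) / 2))"
      unfolding db e(2) using p by (simp add: field_simps)
    also have "\<dots> \<le> S * (e - (1 - y) * (e + e\<^sup>2))"
    proof -
      \<comment> \<open>The quadratic Taylor term is what yields \<open>e\<^sup>2\<close>; the
        linear one alone would only give the bound \<open>y * E0\<close>.\<close>
      have "1 + 2 * e + (2 * e)\<^sup>2 / 2 \<le> exp (2 * e)" using e by (intro exp_lower_Taylor_quadratic) simp
      moreover have "exp (2 * e) = 1 / p" by (simp add: p_def exp_minus divide_inverse)
      ultimately have "e + e\<^sup>2 \<le> (1 / p - 1) / 2" by (simp add: power2_eq_square)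
      hence "(1 - y) * (e + e\<^sup>2) \<le> (1 - y) * ((1 / p - 1) / 2)" using y by (intro mult_left_mono) auto
      thus ?thesis using S by (intro mult_left_mono) auto
    qed
    also have "\<dots> \<le> S * (y\<^sup>2 * e / (y + (1 - y) * e))"
    proof -
      \<comment> \<open>Once the denominator is cleared, the middle terms cancel and the slack is
        exactly \<open>(1 - y)\<^sup>2 * e ^ 3\<close>.\<close>
      have "(e - (1 - y) * (e + e\<^sup>2)) * (y + (1 - y) * e) = y\<^sup>2 * e - (1 - y)\<^sup>2 * e ^ 3"
        by (simp add: power2_eq_square power3_eq_cube algebra_simps)
      also have "\<dots> \<le> y\<^sup>2 * e" using e by simp
      finally have "e - (1 - y) * (e + e\<^sup>2) \<le> y\<^sup>2 * e / (y + (1 - y) * e)" using den by (simp add: le_divide_eq)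
      thus ?thesis using S by (intro mult_left_mono) auto
    qed
    finally show ?thesis .
  next
    case w: False
    define l where "l = - ln (1 - y)"
    note lb = neg_ln_bounds[OF y, folded l_def]
    have "p \<le> 1 - y" using w by simp
    hence "ln p \<le> ln (1 - y)" using p by (intro ln_mono) auto
    \<comment> \<open>The value \<open>e = l / 2\<close> is the one for which the optimal chord
      would start at \<open>y\<close> itself. The target increases with \<open>e\<close>, so it is
      enough to reach it at \<open>l / 2\<close>.\<close>
    hence le: "l / 2 \<le> e" by (simp add: p_def l_def)
    have den': "y + (1 - y) * (l / 2) > 0" using y lb by (intro add_pos_nonneg) auto
    \<comment> \<open>After multiplication by 4 this is \<open>y\<close> times the second bound of
      \<open>neg_ln_bounds\<close> plus the third.\<close>
    have "(l / 2 - y / 2) * (y + (1 - y) * (l / 2)) \<le> y\<^sup>2 * (l / 2)"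
    proof -
      have "y * ((1 - y) * l) \<le> y * y" using lb y by (intro mult_left_mono) auto
      with lb(3) have "y * ((1 - y) * l) + (1 - y) * l\<^sup>2 \<le> 2 * y\<^sup>2" by (simp add: power2_eq_square)
      moreover have "(l - y) * (2 * y + (1 - y) * l) = y * ((1 - y) * l) + (1 - y) * l\<^sup>2 - 2 * y\<^sup>2 + 2 * (y\<^sup>2 * l)"
        by (simp add: power2_eq_square algebra_simps)
      moreover have "(l / 2 - y / 2) * (y + (1 - y) * (l / 2)) = ((l - y) * (2 * y + (1 - y) * l)) / 4"
        by (simp add: field_simps)
      ultimately show ?thesis by linarith
    qed
    hence "l / 2 - y / 2 \<le> y\<^sup>2 * (l / 2) / (y + (1 - y) * (l / 2))" by (simp only: pos_le_divide_eq[OF den'])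
    also have "\<dots> \<le> y\<^sup>2 * e / (y + (1 - y) * e)"
    proof -
      have "(l / 2) * y \<le> e * y" using le y by (intro mult_right_mono) auto
      moreover have "m * (y + (1 - y) * e) \<le> e * (y + (1 - y) * m)" if "m * y \<le> e * y" for m
        using that by (simp add: algebra_simps)
      ultimately have "(l / 2) * (y + (1 - y) * e) \<le> e * (y + (1 - y) * (l / 2))" by blast
      hence "y\<^sup>2 * ((l / 2) * (y + (1 - y) * e)) \<le> y\<^sup>2 * (e * (y + (1 - y) * (l / 2)))"
        by (intro mult_left_mono) auto
      moreover have "A / D \<le> B / D'" if "A * D' \<le> B * D" "D > 0" "D' > 0" for A B D D' :: real
        using that by (simp add: field_simps)
      ultimately show ?thesis using den den' by (simp only: mult.assoc)
    qed
    finally have "S * (l / 2 - y / 2) \<le> S * (y\<^sup>2 * e / (y + (1 - y) * e))"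
      using S by (intro mult_left_mono) auto
    moreover have "decay_bound y = l / 2 - y / 2" by (simp add: decay_bound_def l_def field_simps)
    ultimately show ?thesis using direct by simp
  qed
  thus ?thesis by (simp only: target)
qed

text \<open>Serves the case of infinite initial entropy, where the quotient is read as its limit; a
  factor 1/2 is given away.\<close>

lemma decay_bound_le:
  assumes y: "0 < y" "y < 1"
  shows "decay_bound y \<le> y\<^sup>2 / (1 - y)"
proof -
  have "- ln (1 - y) \<le> y / (1 - y)"
    using neg_ln_bounds(2)[OF y] y by (simp add: le_divide_eq mult.commute)
  hence "decay_bound y \<le> (y / (1 - y) - y) / 2"
    unfolding decay_bound_def by (intro divide_right_mono) linarith+
  also have "\<dots> = y\<^sup>2 / (1 - y) / 2" using y by (simp add: field_simps power2_eq_square)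
  also have "\<dots> \<le> y\<^sup>2 / (1 - y)"
  proof -
    have half: "x / 2 \<le> x" if "0 \<le> x" for x :: real using that by simp
    show ?thesis by (rule half) (use y in simp)
  qed
  finally show ?thesis .
qed

theorem corollary2p7:
  fixes h :: "real ^ 'n::finite \<Rightarrow> real"
    and \<nu> :: "(real ^ 'n) measure"
    and \<tau> :: "real ^ 'n \<Rightarrow> real ^ 'n ^ 'n"
    and t :: real
  assumes "smooth h" and "\<forall>x. h x \<ge> 0"
    and "\<nu> = density std_gaussian (\<lambda>x. ennreal (h x))"
    and "prob_space \<nu>" and "centered \<nu>"
    and "stein_kernel \<nu> \<tau>" and "finite_stein_discrepancy \<nu> \<tau>"
    and "t \<ge> 0"
  shows "gaussian_entropy (ou_semigroup t h)
           \<le> entropy_decay t (stein_discrepancy \<nu> \<tau>) (gaussian_entropy h)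
       \<and> entropy_decay t (stein_discrepancy \<nu> \<tau>) (gaussian_entropy h)
           \<le> stein_decay t (stein_discrepancy \<nu> \<tau>)"
proof -
  define S where "S = (\<integral>x. (norm (\<tau> x - mat 1))\<^sup>2 \<partial>\<nu>)"
  have S0: "S \<ge> 0" by (simp add: S_def)
  have sd: "stein_discrepancy \<nu> \<tau> = sqrt S" by (simp add: stein_discrepancy_def S_def)
  have "Ck 0 h" using \<open>smooth h\<close> unfolding smooth_def by blast
  hence hc: "continuous_on UNIV h" by simp
  have h0: "h x \<ge> 0" for x using assms(2) by simp
  have ou: "ou_semigroup t h = mehler (exp (- t)) (noise t) h"
    by (rule ext) (simp add: ou_semigroup_def mehler_def noise_def)
  note main = entropy_mehler_le[OF hc h0, of \<tau>, folded assms(3), OF assms(4-7), folded S_def]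
  \<comment> \<open>These facts concern \<open>h\<close> alone; the time 1 is an arbitrary
    choice.\<close>
  have h_int: "integrable std_gaussian h" "(\<integral>x. h x \<partial>std_gaussian) = 1"
    using main(3,4)[of 1] by simp_all
  have ent: "finite_entropy (mehler (exp (- s)) (noise s) h)"
    "gauss_ent (mehler (exp (- s)) (noise s) h) \<le> S * decay_bound (exp (- 2 * s))" if "s > 0" for s
    using main(1,2)[of s "S * decay_bound (exp (- 2 * s))"] that by auto
  show ?thesis
  proof (cases "S = 0")
    \<comment> \<open>All terms on the right are 0 by convention, so an entropy of at most 0 is what
      has to be shown, at \<open>t = 0\<close> as well.\<close>
    case True
    have "finite_entropy (mehler (exp (- t)) (noise t) h)" "gauss_ent (mehler (exp (- t)) (noise t) h) \<le> 0"
      using main(1,2)[of t 0] True assms(8) by auto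
    thus ?thesis using True by (simp add: sd entropy_decay_def stein_decay_def ou gaussian_entropy_eq zero_ereal_def)
  next
    case False
    hence Sp: "S > 0" "sqrt S \<noteq> 0" "(sqrt S)\<^sup>2 = S" using S0 by auto
    show ?thesis
    proof (cases "t = 0")
      \<comment> \<open>At time 0 the quotient is the initial entropy itself, finite or not, and the
        right-most term is infinite.\<close>
      case True
      hence "ou_semigroup t h = h" using ou by (simp add: noise_def mehler_1_0)
      moreover have "gaussian_entropy h \<le> entropy_decay t (sqrt S) (gaussian_entropy h)"
      proof (cases "gaussian_entropy h = \<infinity>")
        case H: False
        have "gaussian_entropy h = ereal (gauss_ent h)"
          by (intro gaussian_entropy_eq finite_entropyI h0 h_int H)
        thus ?thesis using True Sp by (simp add: entropy_decay_def)
      qed (use True Sp in \<open>simp add: entropy_decay_def stein_decay_def\<close>)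
      ultimately show ?thesis using True Sp by (simp add: sd stein_decay_def)
    next
      case tn: False
      hence t: "t > 0" using assms(8) by simp
      define y where "y = exp (- 2 * t)"
      have y: "0 < y" "y < 1" using t by (auto simp: y_def)
      have y2: "exp (- 4 * t) = y\<^sup>2" using exp_double[of "- 2 * t"] by (simp add: y_def)
      let ?Ey = "gauss_ent (mehler (exp (- t)) (noise t) h)"
      have Ey: "gaussian_entropy (ou_semigroup t h) = ereal ?Ey" "?Ey \<le> S * decay_bound y"
        using ent[OF t] by (auto simp: ou gaussian_entropy_eq y_def)
      have sdec: "stein_decay t (sqrt S) = ereal (y\<^sup>2 / (1 - y) * S)"
        using Sp t y2 by (simp add: stein_decay_def y_def)
      have db: "S * decay_bound y \<le> y\<^sup>2 / (1 - y) * S"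
        using mult_left_mono[OF decay_bound_le[OF y], of S] Sp by (simp add: mult.commute)
      show ?thesis
      proof (cases "gaussian_entropy h = \<infinity>")
        \<comment> \<open>Both terms on the right coincide here, and the dual bound is
          enough.\<close>
        case True
        thus ?thesis using Sp Ey db by (simp add: sd entropy_decay_def sdec)
      next
        case H: False
        interpret G: finite_entropy h
          by (intro finite_entropyI h0 h_int H)
        define E0 where "E0 = gauss_ent h"
        have HE: "gaussian_entropy h = ereal E0"
          unfolding E0_def by (rule gaussian_entropy_eq) unfold_locales
        have E0: "E0 \<ge> 0" unfolding E0_def by (rule G.gauss_ent_nonneg[OF h_int(2)])
        have ent_at_eq: "G.ent_at (exp (- 2 * s)) = gauss_ent (mehler (exp (- s)) (noise s) h)" for s
        proof -
          have "sqrt (exp (- 2 * s)) = exp (- s)"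
            using exp_double[of "- s"] by (intro real_sqrt_unique) auto
          thus ?thesis by (simp add: G.ent_at_def noise_def)
        qed
        have Ey_at: "?Ey = G.ent_at y" by (simp only: y_def ent_at_eq)
        have chord: "?Ey \<le> S * decay_bound w + (y - w) / (1 - w) * (E0 - S * decay_bound w)"
          if w: "0 < w" "w < y" for w
        proof -
          \<comment> \<open>The time whose parameter is \<open>w\<close>: finite because
            \<open>w > 0\<close>, and later than \<open>t\<close> because
            \<open>w < y\<close>.\<close>
          define s where "s = - ln w / 2"
          have s: "s > 0" "exp (- 2 * s) = w" using w y by (auto simp: s_def)
          have Ew: "G.ent_at w \<le> S * decay_bound w" using ent(2)[OF s(1)] ent_at_eq[of s] s(2) by simp
          let ?l = "(y - w) / (1 - w)"
          have l: "0 \<le> ?l" "?l \<le> 1" using w y by auto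
          \<comment> \<open>Written as a convex combination, the chord has weight
            \<open>1 - L\<close> at its left end; this weight is nonnegative, so the larger value
            \<open>S * decay_bound w\<close> may be put there.\<close>
          have mix: "A + L * (E0 - A) = (1 - L) * A + L * E0" for A L :: real
            by (simp add: algebra_simps)
          have "?Ey \<le> G.ent_at w + ?l * (E0 - G.ent_at w)"
            using G.ent_at_chord[of w y] w y by (simp add: Ey_at G.ent_at_1 E0_def)
          also have "\<dots> = (1 - ?l) * G.ent_at w + ?l * E0" by (rule mix)
          also have "\<dots> \<le> (1 - ?l) * (S * decay_bound w) + ?l * E0"
            using l Ew by (intro add_right_mono mult_left_mono) auto
          also have "\<dots> = S * decay_bound w + ?l * (E0 - S * decay_bound w)" by (rule mix[symmetric])
          finally show ?thesis .
        qed
        have "?Ey \<le> E0"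
          using G.ent_at_mono[of y 1] y by (simp add: Ey_at G.ent_at_1 E0_def)
        from entropy_decay_real[OF Sp(1) y E0 Ey(2) this chord]
        have le1: "?Ey \<le> y\<^sup>2 / (y + (1 - y) / S * E0) * E0" .
        have den: "y + (1 - y) / S * E0 > 0" using y Sp E0 by (intro add_pos_nonneg) auto
        have ed: "entropy_decay t (sqrt S) (ereal E0) = ereal (y\<^sup>2 / (y + (1 - y) / S * E0) * E0)"
        proof -
          have "entropy_decay t (sqrt S) (ereal E0)
              = ereal (y\<^sup>2) / (ereal y + ereal ((1 - y) / S) * ereal E0) * ereal E0"
            using Sp y2 by (simp only: entropy_decay_def y_def) simp
          thus ?thesis using den by simp
        qed
        \<comment> \<open>Multiplied by \<open>S\<close>, the denominator is \<open>S * y\<close>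
          plus \<open>(1 - y) * E0\<close>; dropping the first term gives the right-most
          bound.\<close>
        have "y\<^sup>2 / (y + (1 - y) / S * E0) * E0 \<le> y\<^sup>2 / (1 - y) * S"
        proof -
          have "S * ((1 - y) / S * E0) = (1 - y) * E0" using Sp by simp
          moreover have "0 \<le> S * y" using Sp y by simp
          ultimately have "(1 - y) * E0 \<le> S * (y + (1 - y) / S * E0)" by (simp only: distrib_left)
          hence "y\<^sup>2 * ((1 - y) * E0) \<le> y\<^sup>2 * (S * (y + (1 - y) / S * E0))" by (intro mult_left_mono) auto
          thus ?thesis using den y by (simp add: divide_le_eq le_divide_eq mult_ac)
        qed
        thus ?thesis using le1 by (simp add: sd HE ed sdec Ey(1))
      qed
    qed
  qed
qed

end
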